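(* Assume $2\mu\bar c>\sigma^2 r$. The HJB problem (defined below) admits a unique solution $v$ in the sense of the definition below. Furthermore, $v_x$ is continuous on $\mathcal Q$ and $v$ is Lipschitz continuous in $c$; and for every $p>1$, with $\alpha=1-1/p$, there is a constant $K>0$ such that: $0\le -v_c\le K$ a.e.; $0\le v\le \bar c/r$; $0\le v_x\le K$; for all $(x,c)\in\mathcal Q$ and $y\ge x$, $v_x(y,c)\le\max\{v_x(x,c),1\}$; and for all $c\in[0,\bar c]$ and $N\in\mathbb N$, $\|v(\cdot,c)\|_{W^{2}_p[N-1,N]}+\|v(\cdot,c)\|_{C^{1+\alpha}([0,\infty))}\le K$.
   Context: Constants: $\mu\in\mathbb R$, $\sigma>0$, $r>0$, $\bar c\in(0,\mu]$, $b\in[0,1]$. Operators (in the variable $x$): $\mathcal L v=\tfrac12\sigma^2v_{xx}+\mu v_x-rv$, $\mathcal T v=b(1-v_x)+(1-b)(1-v_x)^+$. $\mathcal Q=[0,\infty)\times[0,\bar c]$, $\mathcal Q_0=[0,\infty)\times[0,\bar c)$. Let $\gamma=\frac{\sqrt{(\mu-\bar c)^2+2\sigma^2 r}+(\mu-\bar c)}{\sigma^2}$, $\lambda_{1}=\frac{\sqrt{(\mu-b\bar c)^2+2\sigma^2 r}-(\mu-b\bar c)}{\sigma^2}$, $\lambda_{2}=\frac{\sqrt{(\mu-b\bar c)^2+2\sigma^2 r}+(\mu-b\bar c)}{\sigma^2}$, $k_1=\frac{1}{\lambda_1+\lambda_2}\big[1+\lambda_2\big(\frac{(1-b)\bar c}{r}-\frac1\gamma\big)\big]$,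 $k_2=\frac{1}{\lambda_1+\lambda_2}\big[1-\lambda_1\big(\frac{(1-b)\bar c}{r}-\frac1\gamma\big)\big]$; when $2\mu\bar c>\sigma^2r$, $y_0>0$ is the unique positive root of $k_1e^{-\lambda_1y}-k_2e^{\lambda_2y}+\frac{b\bar c}{r}=0$ and $g(x)=k_1e^{\lambda_1(x-y_0)}-k_2e^{-\lambda_2(x-y_0)}+\frac{b\bar c}{r}$ for $0\le x\le y_0$, $g(x)=-\frac1\gamma e^{-\gamma(x-y_0)}+\frac{\bar c}{r}$ for $x>y_0$. HJB problem: $\min\{-\mathcal Lv-c\,\mathcal Tv,\,-v_c\}=0$ in $\mathcal Q$, $v(0,c)=0$ for $c\in[0,\bar c]$, $v(x,\bar c)=g(x)$ for $x\ge0$. Let $\mathcal A$ be the class of $v\in C(\mathcal Q)$ that are non-increasing in $c$ and such that $v(\cdot,c)\in W^2_{p,\mathrm{loc}}([0,\infty))\cap L^\infty([0,\infty))$ for each $c\in[0,\bar c]$ (some $p>1$). A solution of the HJB problem is a $v$ such that: (1) $v\in\mathcal A$; (2) $v(0,c)=0$ and $v(x,\bar c)=g(x)$; (3) for each $c\in[0,\bar c]$, $-\mathcal Lv(\cdot,c)-c\,\mathcal Tv(\cdot,c)\ge0$ a.e. in $[0,\infty)$; (4) whenever $(x,c)\in\mathcal Q_0$ satisfies $v(x,c)>v(x,s)$ for all $s\in(c,\bar c]$, then $-\mathcal Lv(y,c)-c\,\mathcal Tv(y,c)=0$ for (a.e.) $y\in[0,x]$. *)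

theory Defs
  imports "HOL-Analysis.Analysis"
begin

definition gam :: "real \<Rightarrow> real \<Rightarrow> real \<Rightarrow> real \<Rightarrow> real" where
  "gam \<mu> \<sigma> r cb = (sqrt ((\<mu> - cb)^2 + 2 * \<sigma>^2 * r) + (\<mu> - cb)) / \<sigma>^2"

definition lam1 :: "real \<Rightarrow> real \<Rightarrow> real \<Rightarrow> real \<Rightarrow> real \<Rightarrow> real" where
  "lam1 \<mu> \<sigma> r cb b = (sqrt ((\<mu> - b * cb)^2 + 2 * \<sigma>^2 * r) - (\<mu> - b * cb)) / \<sigma>^2"

definition lam2 :: "real \<Rightarrow> real \<Rightarrow> real \<Rightarrow> real \<Rightarrow> real \<Rightarrow> real" where
  "lam2 \<mu> \<sigma> r cb b = (sqrt ((\<mu> - b * cb)^2 + 2 * \<sigma>^2 * r) + (\<mu> - b * cb)) / \<sigma>^2"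

definition kk1 :: "real \<Rightarrow> real \<Rightarrow> real \<Rightarrow> real \<Rightarrow> real \<Rightarrow> real" where
  "kk1 \<mu> \<sigma> r cb b = (1 / (lam1 \<mu> \<sigma> r cb b + lam2 \<mu> \<sigma> r cb b)) *
     (1 + lam2 \<mu> \<sigma> r cb b * ((1 - b) * cb / r - 1 / gam \<mu> \<sigma> r cb))"

definition kk2 :: "real \<Rightarrow> real \<Rightarrow> real \<Rightarrow> real \<Rightarrow> real \<Rightarrow> real" where
  "kk2 \<mu> \<sigma> r cb b = (1 / (lam1 \<mu> \<sigma> r cb b + lam2 \<mu> \<sigma> r cb b)) *
     (1 - lam1 \<mu> \<sigma> r cb b * ((1 - b) * cb / r - 1 / gam \<mu> \<sigma> r cb))"

text \<open>y0: the unique positive root (the paper asserts existence and uniqueness when 2 mu cbar > sigma^2 r).\<close>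
definition y0 :: "real \<Rightarrow> real \<Rightarrow> real \<Rightarrow> real \<Rightarrow> real \<Rightarrow> real" where
  "y0 \<mu> \<sigma> r cb b = (THE y. y > 0 \<and>
     kk1 \<mu> \<sigma> r cb b * exp (- lam1 \<mu> \<sigma> r cb b * y) - kk2 \<mu> \<sigma> r cb b * exp (lam2 \<mu> \<sigma> r cb b * y)
       + b * cb / r = 0)"

definition gfun :: "real \<Rightarrow> real \<Rightarrow> real \<Rightarrow> real \<Rightarrow> real \<Rightarrow> real \<Rightarrow> real" where
  "gfun \<mu> \<sigma> r cb b x =
     (let y = y0 \<mu> \<sigma> r cb b in
      if x \<le> y then kk1 \<mu> \<sigma> r cb b * exp (lam1 \<mu> \<sigma> r cb b * (x - y))
                    - kk2 \<mu> \<sigma> r cb b * exp (- lam2 \<mu> \<sigma> r cb b * (x - y)) + b * cb / r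
      else - (1 / gam \<mu> \<sigma> r cb) * exp (- gam \<mu> \<sigma> r cb * (x - y)) + cb / r)"

definition test_fun :: "(real \<Rightarrow> real) \<Rightarrow> bool" where
  "test_fun \<phi> \<longleftrightarrow> (\<forall>k x. ((deriv ^^ k) \<phi>) differentiable (at x)) \<and>
     (\<exists>a b. 0 < a \<and> a \<le> b \<and> (\<forall>x. x \<notin> {a..b} \<longrightarrow> \<phi> x = 0))"

definition loc_int :: "(real \<Rightarrow> real) \<Rightarrow> bool" where
  "loc_int f \<longleftrightarrow> (\<forall>N::real. set_integrable lborel {0..N} f)"

definition weak_deriv :: "(real \<Rightarrow> real) \<Rightarrow> (real \<Rightarrow> real) \<Rightarrow> bool" where
  "weak_deriv f g \<longleftrightarrow> loc_int f \<and> loc_int g \<and>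
     (\<forall>\<phi>. test_fun \<phi> \<longrightarrow>
        (LINT x:{0<..}|lborel. f x * deriv \<phi> x) = - (LINT x:{0<..}|lborel. g x * \<phi> x))"

definition Lp_int :: "real \<Rightarrow> real set \<Rightarrow> (real \<Rightarrow> real) \<Rightarrow> ennreal" where
  "Lp_int p S f = (\<integral>\<^sup>+ x\<in>S. ennreal (\<bar>f x\<bar> powr p) \<partial>lborel)"

text \<open>L^p norm on S (meaningful when Lp_int p S f is finite).\<close>
definition Lp_norm :: "real \<Rightarrow> real set \<Rightarrow> (real \<Rightarrow> real) \<Rightarrow> real" where
  "Lp_norm p S f = enn2real (Lp_int p S f) powr (1 / p)"

definition Lp_loc :: "real \<Rightarrow> (real \<Rightarrow> real) \<Rightarrow> bool" where
  "Lp_loc p f \<longleftrightarrow> set_borel_measurable lborel {0..} f \<and> (\<forall>N::real. Lp_int p {0..N} f < \<infinity>)"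

definition L_infty :: "(real \<Rightarrow> real) \<Rightarrow> bool" where
  "L_infty f \<longleftrightarrow> set_borel_measurable lborel {0..} f \<and>
     (\<exists>M. AE x in lborel. x \<in> {0..} \<longrightarrow> \<bar>f x\<bar> \<le> M)"

definition W2p_loc_with :: "real \<Rightarrow> (real \<Rightarrow> real) \<Rightarrow> (real \<Rightarrow> real) \<Rightarrow> (real \<Rightarrow> real) \<Rightarrow> bool" where
  "W2p_loc_with p f f1 f2 \<longleftrightarrow> weak_deriv f f1 \<and> weak_deriv f1 f2 \<and>
     Lp_loc p f \<and> Lp_loc p f1 \<and> Lp_loc p f2"

definition W2p_loc :: "real \<Rightarrow> (real \<Rightarrow> real) \<Rightarrow> bool" where
  "W2p_loc p f \<longleftrightarrow> (\<exists>f1 f2. W2p_loc_with p f f1 f2)"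

definition W2p_norm :: "real \<Rightarrow> real set \<Rightarrow> (real \<Rightarrow> real) \<Rightarrow> (real \<Rightarrow> real) \<Rightarrow> (real \<Rightarrow> real) \<Rightarrow> real" where
  "W2p_norm p S f f1 f2 = Lp_norm p S f + Lp_norm p S f1 + Lp_norm p S f2"

definition C1alpha_norm :: "real \<Rightarrow> (real \<Rightarrow> real) \<Rightarrow> (real \<Rightarrow> real) \<Rightarrow> ereal" where
  "C1alpha_norm \<alpha> f f1 =
     (SUP x\<in>{0::real..}. ereal \<bar>f x\<bar>) + (SUP x\<in>{0::real..}. ereal \<bar>f1 x\<bar>) +
     (SUP z\<in>{(x,y). 0 \<le> x \<and> 0 \<le> y \<and> x \<noteq> y}. ereal (\<bar>f1 (fst z) - f1 (snd z)\<bar> / \<bar>fst z - snd z\<bar> powr \<alpha>))"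

definition Qset :: "real \<Rightarrow> (real \<times> real) set" where
  "Qset cb = {0..} \<times> {0..cb}"

definition Q0set :: "real \<Rightarrow> (real \<times> real) set" where
  "Q0set cb = {0..} \<times> {0..<cb}"

definition hjb_op :: "real \<Rightarrow> real \<Rightarrow> real \<Rightarrow> real \<Rightarrow> real \<Rightarrow> real \<Rightarrow> real \<Rightarrow> real \<Rightarrow> real" where
  "hjb_op \<mu> \<sigma> r b c v vx vxx =
     - (1/2 * \<sigma>^2 * vxx + \<mu> * vx - r * v) - c * (b * (1 - vx) + (1 - b) * max (1 - vx) 0)"

definition classA :: "real \<Rightarrow> (real \<Rightarrow> real \<Rightarrow> real) \<Rightarrow> bool" where
  "classA cb v \<longleftrightarrow> continuous_on (Qset cb) (\<lambda>z. v (fst z) (snd z)) \<and>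
     (\<forall>x\<ge>0. \<forall>c1\<in>{0..cb}. \<forall>c2\<in>{0..cb}. c1 \<le> c2 \<longrightarrow> v x c2 \<le> v x c1) \<and>
     (\<exists>p>1. \<forall>c\<in>{0..cb}. W2p_loc p (\<lambda>x. v x c) \<and> L_infty (\<lambda>x. v x c))"

definition hjb_solution :: "real \<Rightarrow> real \<Rightarrow> real \<Rightarrow> real \<Rightarrow> real \<Rightarrow> (real \<Rightarrow> real \<Rightarrow> real) \<Rightarrow> bool" where
  "hjb_solution \<mu> \<sigma> r cb b v \<longleftrightarrow>
     classA cb v \<and>
     (\<forall>c\<in>{0..cb}. v 0 c = 0) \<and>
     (\<forall>x\<ge>0. v x cb = gfun \<mu> \<sigma> r cb b x) \<and>
     (\<forall>c\<in>{0..cb}. \<exists>f1 f2. weak_deriv (\<lambda>x. v x c) f1 \<and> weak_deriv f1 f2 \<and>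
         (AE y in lborel. y \<in> {0..} \<longrightarrow> hjb_op \<mu> \<sigma> r b c (v y c) (f1 y) (f2 y) \<ge> 0)) \<and>
     (\<forall>x c. (x, c) \<in> Q0set cb \<and> (\<forall>s\<in>{c<..cb}. v x c > v x s) \<longrightarrow>
        (\<exists>f1 f2. weak_deriv (\<lambda>x. v x c) f1 \<and> weak_deriv f1 f2 \<and>
         (AE y in lborel. y \<in> {0..x} \<longrightarrow> hjb_op \<mu> \<sigma> r b c (v y c) (f1 y) (f2 y) = 0)))"

end

theory Submission
  imports Defs
begin

text \<open>The solution is the limit of a scheme on dyadic grids of rates. Starting from \<open>g\<close> at the top rate, the
  rate is lowered one grid step at a time. If \<open>h\<close> is the profile at the rate \<open>c'\<close>, the profile at the next
  rate \<open>c < c'\<close> is the solution \<open>w\<close> of the equation at the rate \<open>c\<close> with \<open>w(0) = 0\<close> and the least initial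
  slope such that \<open>w \<ge> h\<close>: it touches \<open>h\<close> at some point, beyond which it is continued by \<open>h\<close>.
  For \<open>b = 0\<close> the profile \<open>h\<close> itself solves the problem at the rate \<open>c\<close>. Every step preserves the bounds on the
  profile and its first two derivatives, the inequality \<open>v\<^sub>x(y) \<le> max {v\<^sub>x(x), 1}\<close> and the supersolution
  property; the maximum principle bounds the increment of a step by a multiple of the step size and shows that
  refining the grid increases the profiles. Hence the profiles converge, and so do their slopes, being
  equi-Lipschitz. Uniqueness follows from the maximum principle, applied at a maximum of the difference of two
  solutions with the largest possible rate. Derivatives in \<open>c\<close>, and second derivatives in \<open>x\<close>, are those
  of Lipschitz functions.\<close>

text \<open>Everything turns on the sign of \<open>T p\<close>: nonnegative for slopes at most 1
  and, if \<open>b > 0\<close>, negative above 1. When the rate is lowered, a supersolution remains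
  one where its slope is at most 1, but may fail where the slope is larger; so only an initial
  stretch has to be replaced. Minimality of the initial slope forces a tangential contact. A contact
  at a slope above 1 is impossible, so the old profile has slope at most 1 there and, by
  \<open>p y \<le> max (p x) 1\<close>, from there on; hence it may serve as the continuation at the
  new rate. On the new stretch the equation holds exactly, and this is the source of the equality
  clause of the definition after passage to the limit. The bounds \<open>cb / r\<close>,
  \<open>K1\<close> and \<open>K2\<close> depend on the parameters of the problem alone, neither on
  the rate nor on the number of steps already made; otherwise the estimates would deteriorate as the
  grid is refined. The second derivative of a profile may jump at each contact point, and contact
  points can accumulate in the limit. Second derivatives are therefore claimed almost everywhere
  only, and the file opens with Rademacher's theorem on the line.\<close>

section \<open>Differentiability of Lipschitz functions almost everywhere\<close>

text \<open>The short intervals on which \<open>\<phi>\<close> stretches by a factor at most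
  \<open>\<alpha>\<close> form a Vitali cover of \<open>E\<close>. Countably many disjoint ones
  exhaust \<open>E\<close> up to a null set, whose image is null because \<open>\<phi>\<close> is
  Lipschitz. The images of the chosen intervals have total length at most \<open>\<alpha>\<close>
  times that of an open set barely larger than \<open>E\<close>.\<close>

lemma emeasure_image_le_slope:
  fixes \<phi> :: "real \<Rightarrow> real"
  assumes mono: "strict_mono \<phi>" and lip: "C-lipschitz_on UNIV \<phi>"
    and E: "E \<in> sets borel" and PE: "\<phi> ` E \<in> sets borel" and a0: "0 < \<alpha>"
    and small: "\<And>x d. x \<in> E \<Longrightarrow> d > 0 \<Longrightarrow>
      \<exists>u v. u < v \<and> u \<le> x \<and> x \<le> v \<and> v - u < d \<and> \<phi> v - \<phi> u \<le> \<alpha> * (v - u)"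
  shows "emeasure lborel (\<phi> ` E) \<le> ennreal \<alpha> * emeasure lborel E"
proof (rule ennreal_le_epsilon)
  fix e :: real assume e: "0 < e"
  obtain U where U: "open U" "E \<subseteq> U" "emeasure lborel (U - E) < ennreal (e / \<alpha>)"
    using outer_regular_lborel[OF E, of "e / \<alpha>"] e a0 by auto
  define K where "K = {(u, v). u < v \<and> {u..v} \<subseteq> U \<and> \<phi> v - \<phi> u \<le> \<alpha> * (v - u)}"
  \<comment> \<open>Midpoint and radius: the covering theorem speaks of closed balls.\<close>
  define a where "a = (\<lambda>(u::real, v::real). (u + v) / 2)"
  define r where "r = (\<lambda>(u::real, v::real). (v - u) / 2)"
  have cb: "cball (a i) (r i) = {fst i..snd i}" for i
    unfolding cball_eq_atLeastAtMost a_def r_def by (auto simp: case_prod_beta field_simps)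
  have rpos: "0 < r i" if "i \<in> K" for i using that by (auto simp: K_def r_def)
  have cov: "\<exists>i. i \<in> K \<and> x \<in> cball (a i) (r i) \<and> r i < d" if x: "x \<in> E" and d: "0 < d" for x d
  proof -
    obtain \<delta> where \<delta>: "\<delta> > 0" "ball x \<delta> \<subseteq> U" using U x open_contains_ball by blast
    obtain u v where uv: "u < v" "u \<le> x" "x \<le> v" "v - u < min \<delta> d" "\<phi> v - \<phi> u \<le> \<alpha> * (v - u)"
      using small[OF x, of "min \<delta> d"] \<delta> d by auto
    have "{u..v} \<subseteq> ball x \<delta>" using uv by (auto simp: dist_real_def)
    then have "(u, v) \<in> K" using uv \<delta> by (auto simp: K_def)
    moreover have "x \<in> cball (a (u,v)) (r (u,v))" unfolding cb using uv by auto
    moreover have "r (u,v) < d" using uv by (auto simp: r_def)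
    ultimately show ?thesis by blast
  qed
  obtain D where D: "countable D" "D \<subseteq> K"
     "pairwise (\<lambda>i j. disjnt (cball (a i) (r i)) (cball (a j) (r j))) D"
     "negligible (E - (\<Union>i \<in> D. cball (a i) (r i)))"
    using Vitali_covering_theorem_cballs[of K r E a, OF rpos cov] by blast
  define N where "N = E - (\<Union>i \<in> D. {fst i..snd i})"
  have negN: "negligible N" using D(4) unfolding cb N_def .
  have negPN: "negligible (\<phi> ` N)"
  proof (rule negligible_locally_Lipschitz_image[OF _ negN])
    fix x assume "x \<in> N"
    show "\<exists>T B. open T \<and> x \<in> T \<and> (\<forall>y\<in>N \<inter> T. norm (\<phi> y - \<phi> x) \<le> B * norm (y - x))"
      using lipschitz_onD[OF lip] by (intro exI[of _ UNIV] exI[of _ C]) (auto simp: dist_norm)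
  qed auto
  have inj: "inj \<phi>" using mono by (rule strict_mono_on_imp_inj_on)
  have cont: "continuous_on UNIV \<phi>" using lip by (rule lipschitz_on_continuous_on)
  have cpt: "\<phi> ` {u..v} \<in> sets borel" for u v
    by (intro borel_closed compact_imp_closed compact_continuous_image continuous_on_subset[OF cont]) auto
  have disj: "disjoint_family_on (\<lambda>i. {fst i..snd i}) D"
    using D(3) unfolding cb pairwise_def disjoint_family_on_def disjnt_def by blast
  have disjP: "disjoint_family_on (\<lambda>i. \<phi> ` {fst i..snd i}) D"
    using disj inj unfolding disjoint_family_on_def by (metis image_Int image_empty)
  have "emeasure lborel (\<phi> ` E) = emeasure lebesgue (\<phi> ` E)" using PE by simp
  also have "\<dots> \<le> emeasure lebesgue ((\<Union>i\<in>D. \<phi> ` {fst i..snd i}) \<union> \<phi> ` N)"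
  proof (rule emeasure_mono)
    show "\<phi> ` E \<subseteq> (\<Union>i\<in>D. \<phi> ` {fst i..snd i}) \<union> \<phi> ` N" unfolding N_def by blast
    have "(\<Union>i\<in>D. \<phi> ` {fst i..snd i}) \<in> sets borel" using cpt D(1) by (intro sets.countable_UN') auto
    moreover have "\<phi> ` N \<in> sets lebesgue" using negPN by (simp add: negligible_iff_null_sets null_setsD2)
    ultimately show "(\<Union>i\<in>D. \<phi> ` {fst i..snd i}) \<union> \<phi> ` N \<in> sets lebesgue" by (intro sets.Un) auto
  qed
  also have "\<dots> = emeasure lebesgue (\<Union>i\<in>D. \<phi> ` {fst i..snd i})"
    using negPN cpt D(1) by (intro emeasure_Un_null_set) (auto simp: negligible_iff_null_sets intro!: sets.countable_UN'')
  also have "\<dots> = emeasure lborel (\<Union>i\<in>D. \<phi> ` {fst i..snd i})"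
  proof -
    have "(\<Union>i\<in>D. \<phi> ` {fst i..snd i}) \<in> sets borel" using cpt D(1) by (intro sets.countable_UN'') auto
    then show ?thesis by simp
  qed
  also have "\<dots> = (\<integral>\<^sup>+i. emeasure lborel (\<phi> ` {fst i..snd i}) \<partial>count_space D)"
    using cpt D(1) disjP by (intro emeasure_UN_countable) auto
  also have "\<dots> \<le> (\<integral>\<^sup>+i. ennreal \<alpha> * emeasure lborel {fst i..snd i} \<partial>count_space D)"
  proof (rule nn_integral_mono)
    fix i assume "i \<in> space (count_space D)"
    then have i: "fst i < snd i" "\<phi> (snd i) - \<phi> (fst i) \<le> \<alpha> * (snd i - fst i)" using D(2) by (auto simp: K_def)
    have "\<phi> ` {fst i..snd i} \<subseteq> {\<phi> (fst i)..\<phi> (snd i)}" using mono by (auto simp: strict_mono_less_eq)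
    then have "emeasure lborel (\<phi> ` {fst i..snd i}) \<le> emeasure lborel {\<phi> (fst i)..\<phi> (snd i)}"
      by (intro emeasure_mono) auto
    also have "\<dots> = ennreal (\<phi> (snd i) - \<phi> (fst i))" using mono i by (simp add: strict_mono_less_eq)
    also have "\<dots> \<le> ennreal (\<alpha> * (snd i - fst i))" using i by (intro ennreal_leI) auto
    also have "\<dots> = ennreal \<alpha> * emeasure lborel {fst i..snd i}" using i a0 by (simp add: ennreal_mult)
    finally show "emeasure lborel (\<phi> ` {fst i..snd i}) \<le> ennreal \<alpha> * emeasure lborel {fst i..snd i}" .
  qed
  also have "\<dots> = ennreal \<alpha> * (\<integral>\<^sup>+i. emeasure lborel {fst i..snd i} \<partial>count_space D)"
    by (rule nn_integral_cmult) auto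
  also have "(\<integral>\<^sup>+i. emeasure lborel {fst i..snd i} \<partial>count_space D) = emeasure lborel (\<Union>i\<in>D. {fst i..snd i})"
    using D(1) disj by (intro emeasure_UN_countable[symmetric]) auto
  also have "\<dots> \<le> emeasure lborel U" using D(2) U(1) by (intro emeasure_mono) (fastforce simp: K_def)+
  also have "emeasure lborel U \<le> emeasure lborel E + emeasure lborel (U - E)"
  proof -
    have "U = E \<union> (U - E)" using U(2) by auto
    then show ?thesis using emeasure_subadditive[of E lborel "U - E"] E U(1) by auto
  qed
  also have "ennreal \<alpha> * (emeasure lborel E + emeasure lborel (U - E)) \<le> ennreal \<alpha> * (emeasure lborel E + ennreal (e / \<alpha>))"
    using U(3) by (intro mult_left_mono add_left_mono) auto
  also have "\<dots> = ennreal \<alpha> * emeasure lborel E + ennreal e"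
    using a0 e by (simp add: distrib_left flip: ennreal_mult)
  finally show "emeasure lborel (\<phi> ` E) \<le> ennreal \<alpha> * emeasure lborel E + ennreal e"
    by (simp add: mult_left_mono)
qed

definition slope_below :: "(real \<Rightarrow> real) \<Rightarrow> real \<Rightarrow> real \<Rightarrow> bool" where
  "slope_below f \<alpha> x \<longleftrightarrow> (\<forall>d>0. \<exists>u v. u < x \<and> x < v \<and> v - u < d \<and> f v - f u < \<alpha> * (v - u))"

lemma slope_below_mono: "slope_below f \<alpha> x \<Longrightarrow> \<alpha> \<le> \<beta> \<Longrightarrow> slope_below f \<beta> x"
  unfolding slope_below_def
proof (intro allI impI)
  fix d :: real assume H: "\<forall>d>0. \<exists>u v. u < x \<and> x < v \<and> v - u < d \<and> f v - f u < \<alpha> * (v - u)" "\<alpha> \<le> \<beta>" "0 < d"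
  then obtain u v where uv: "u < x" "x < v" "v - u < d" "f v - f u < \<alpha> * (v - u)" by blast
  have "f v - f u < \<beta> * (v - u)"
    using uv(4) by (rule order.strict_trans2) (use uv H in \<open>intro mult_right_mono, auto\<close>)
  with uv show "\<exists>u v. u < x \<and> x < v \<and> v - u < d \<and> f v - f u < \<beta> * (v - u)"
    by (intro exI[of _ u] exI[of _ v]) auto
qed

text \<open>Continuity in the parameter \<open>x\<close> makes the condition at each scale open
  jointly in \<open>(x, s)\<close>. The exceptional set in the plane is thus Borel, as required
  before Fubini's theorem is applied to it.\<close>

lemma Gdelta_slope_below:
  fixes f :: "real \<Rightarrow> real \<Rightarrow> real"
  assumes cont: "\<And>s. continuous_on UNIV (\<lambda>x. f x s)"
  shows "{z. slope_below (f (fst z)) \<alpha> (snd z)} \<in> sets borel"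
proof -
  define O' where "O' n = (\<Union>u. \<Union>v\<in>{v. v - u < 1 / Suc n}. {x. f x v - f x u < \<alpha> * (v - u)} \<times> {u<..<v})" for n :: nat
  have "open (O' n)" for n
    unfolding O'_def
    by (intro open_UN ballI open_Times open_Collect_less continuous_intros cont open_greaterThanLessThan)
  then have *: "(\<Inter>n. O' n) \<in> sets borel" by (intro sets.countable_INT) auto
  have "{z. slope_below (f (fst z)) \<alpha> (snd z)} = (\<Inter>n. O' n)"
  proof safe
    fix x s n assume "slope_below (f (fst (x, s))) \<alpha> (snd (x, s))"
    then have "\<exists>u v. u < s \<and> s < v \<and> v - u < 1 / Suc n \<and> f x v - f x u < \<alpha> * (v - u)"
      unfolding slope_below_def fst_conv snd_conv by (elim allE[of _ "1 / Suc n"]) auto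
    then show "(x, s) \<in> O' n" unfolding O'_def by fastforce
  next
    fix x s assume H: "(x, s) \<in> (\<Inter>n. O' n)"
    show "slope_below (f (fst (x, s))) \<alpha> (snd (x, s))" unfolding slope_below_def fst_conv snd_conv
    proof (intro allI impI)
      fix d :: real assume "d > 0"
      then obtain n where n: "1 / Suc n < d" using nat_approx_posE by (metis inverse_eq_divide)
      from H have "(x, s) \<in> O' n" by blast
      then obtain u v where "v - u < 1 / Suc n" "f x v - f x u < \<alpha> * (v - u)" "u < s" "s < v"
        unfolding O'_def by auto
      then show "\<exists>u v. u < s \<and> s < v \<and> v - u < d \<and> f x v - f x u < \<alpha> * (v - u)"
        using n by (intro exI[of _ u] exI[of _ v]) auto
    qed
  qed
  with * show ?thesis by simp
qed

lemma borel_slope_below: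
  assumes "continuous_on UNIV f"
  shows "{x. slope_below f \<alpha> x} \<in> sets borel"
proof -
  define O' where "O' n = (\<Union>u. \<Union>v\<in>{v. v - u < 1 / Suc n \<and> f v - f u < \<alpha> * (v - u)}. {u<..<v})" for n :: nat
  have "open (O' n)" for n unfolding O'_def by (intro open_UN ballI open_greaterThanLessThan)
  then have *: "(\<Inter>n. O' n) \<in> sets borel" by (intro sets.countable_INT) auto
  have "{x. slope_below f \<alpha> x} = (\<Inter>n. O' n)"
  proof safe
    fix s n assume "slope_below f \<alpha> s"
    then have "\<exists>u v. u < s \<and> s < v \<and> v - u < 1 / Suc n \<and> f v - f u < \<alpha> * (v - u)"
      unfolding slope_below_def by (elim allE[of _ "1 / Suc n"]) auto
    then show "s \<in> O' n" unfolding O'_def by fastforce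
  next
    fix s assume H: "s \<in> (\<Inter>n. O' n)"
    show "slope_below f \<alpha> s" unfolding slope_below_def
    proof (intro allI impI)
      fix d :: real assume "d > 0"
      then obtain n where n: "1 / Suc n < d" using nat_approx_posE by (metis inverse_eq_divide)
      from H have "s \<in> O' n" by blast
      then obtain u v where "v - u < 1 / Suc n" "f v - f u < \<alpha> * (v - u)" "u < s" "s < v"
        unfolding O'_def by auto
      then show "\<exists>u v. u < s \<and> s < v \<and> v - u < d \<and> f v - f u < \<alpha> * (v - u)"
        using n by (intro exI[of _ u] exI[of _ v]) auto
    qed
  qed
  with * show ?thesis by simp
qed

text \<open>For the increasing map \<open>\<phi> x = f x + (K + 1) x\<close>, Vitali coverings show that such a set \<open>E\<close> satisfies
  \<open>\<beta>' |E| \<le> |\<phi> E| \<le> \<alpha>' |E|\<close> with \<open>\<alpha>' = \<alpha> + K + 1 < \<beta>' = \<beta> + K + 1\<close>.\<close>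
lemma null_slope_oscillation:
  fixes f :: "real \<Rightarrow> real"
  assumes lip: "K-lipschitz_on UNIV f" and ab: "\<alpha> < \<beta>"
  shows "emeasure lborel {x. slope_below f \<alpha> x \<and> slope_below (\<lambda>x. - f x) (- \<beta>) x} = 0"
proof -
  define \<phi> where "\<phi> x = f x + (K + 1) * x" for x
  have K0: "K \<ge> 0" using lip by (rule lipschitz_on_nonneg)
  have fb: "\<bar>f y - f x\<bar> \<le> K * \<bar>y - x\<bar>" for x y using lipschitz_onD[OF lip] by (auto simp: dist_real_def)
  \<comment> \<open>This expansion makes the inverse \<open>\<psi>\<close> 1-Lipschitz, so that the
    covering estimate can be applied to \<open>\<psi>\<close> as well as to
    \<open>\<phi>\<close>.\<close>
  have expand: "y - x \<le> \<phi> y - \<phi> x" if "x \<le> y" for x y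
    using fb[of y x] that unfolding \<phi>_def by (simp add: algebra_simps abs_le_iff)
  have sm: "strict_mono \<phi>" 
  proof (rule strict_monoI)
    fix x y :: real assume "x < y"
    then show "\<phi> x < \<phi> y" using expand[of x y] by linarith
  qed
  have lipP: "(2 * K + 1)-lipschitz_on UNIV \<phi>"
  proof (rule lipschitz_onI)
    fix x y :: real
    have "\<phi> x - \<phi> y = (f x - f y) + (K + 1) * (x - y)" unfolding \<phi>_def by (simp add: algebra_simps)
    then have "\<bar>\<phi> x - \<phi> y\<bar> \<le> \<bar>f x - f y\<bar> + (K + 1) * \<bar>x - y\<bar>"
      using K0 abs_triangle_ineq[of "f x - f y" "(K + 1) * (x - y)"] by (simp add: abs_mult)
    also have "\<dots> \<le> (2 * K + 1) * \<bar>x - y\<bar>" using fb[of x y] by (simp add: algebra_simps)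
    finally show "dist (\<phi> x) (\<phi> y) \<le> (2 * K + 1) * dist x y" by (simp add: dist_real_def)
  qed (use K0 in auto)
  have contP: "continuous_on UNIV \<phi>" using lipP by (rule lipschitz_on_continuous_on)
  have surj: "\<exists>x. \<phi> x = y" for y
  proof -
    define m where "m = \<bar>y - \<phi> 0\<bar>"
    have "\<phi> (- m) \<le> y" "y \<le> \<phi> m" using expand[of "-m" 0] expand[of 0 m] unfolding m_def by auto
    then show ?thesis using IVT'[of \<phi> "-m" y m] contP continuous_on_subset unfolding m_def by fastforce
  qed
  define \<psi> where "\<psi> = inv \<phi>"
  have inj: "inj \<phi>" using sm by (rule strict_mono_on_imp_inj_on)
  have PQ: "\<phi> (\<psi> y) = y" for y using surj unfolding \<psi>_def by (metis f_inv_into_f rangeI)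
  have QP: "\<psi> (\<phi> x) = x" for x using inj unfolding \<psi>_def by simp
  have smQ: "strict_mono \<psi>" using sm PQ by (intro strict_monoI) (metis not_less_iff_gr_or_eq strict_mono_less)
  have lipQ: "1-lipschitz_on UNIV \<psi>"
  proof (rule lipschitz_onI)
    fix x y :: real
    show "dist (\<psi> x) (\<psi> y) \<le> 1 * dist x y"
      using expand[of "\<psi> x" "\<psi> y"] expand[of "\<psi> y" "\<psi> x"] PQ by (cases "\<psi> x \<le> \<psi> y") (auto simp: dist_real_def)
  qed auto
  have contQ: "continuous_on UNIV \<psi>" using lipQ by (rule lipschitz_on_continuous_on)
  have cf: "continuous_on UNIV f" using lip by (rule lipschitz_on_continuous_on)
  define A where "A = {x. slope_below f \<alpha> x \<and> slope_below (\<lambda>x. - f x) (- \<beta>) x}"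
  have A: "A \<in> sets borel"
    unfolding A_def Collect_conj_eq by (intro sets.Int borel_slope_below continuous_intros cf)
  \<comment> \<open>Truncation makes the measure finite, so that \<open>b * e \<le> a * e\<close>
    with \<open>a < b\<close> forces \<open>e = 0\<close>.\<close>
  have "emeasure lborel (A \<inter> {-m..m}) = 0" for m
  proof (cases "A \<inter> {-m..m} = {}")
    case False
    define E where "E = A \<inter> {-m..m}"
    have E: "E \<in> sets borel" using A unfolding E_def by auto
    have "\<phi> ` E = \<psi> -` E" using PQ QP by (auto simp: image_iff) metis
    then have PE: "\<phi> ` E \<in> sets borel"
      using measurable_sets_borel[OF borel_measurable_continuous_onI[OF contQ] E] by simp
    have QPE: "\<psi> ` (\<phi> ` E) = E" by (auto simp: image_image QP)
    define a where "a = \<alpha> + K + 1" define b where "b = \<beta> + K + 1"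
    have small: "\<exists>u v. u < v \<and> u \<le> x \<and> x \<le> v \<and> v - u < d \<and> \<phi> v - \<phi> u \<le> a * (v - u)" if "x \<in> E" "d > 0" for x d
    proof -
      from that have "slope_below f \<alpha> x" by (simp add: E_def A_def)
      with that obtain u v where "u < x" "x < v" "v - u < d" "f v - f u < \<alpha> * (v - u)" unfolding slope_below_def by blast
      then show ?thesis by (intro exI[of _ u] exI[of _ v]) (auto simp: \<phi>_def a_def algebra_simps)
    qed
    have large: "\<exists>u v. u < x \<and> x < v \<and> v - u < d \<and> b * (v - u) \<le> \<phi> v - \<phi> u" if "x \<in> E" "d > 0" for x d
    proof -
      from that have "slope_below (\<lambda>x. - f x) (- \<beta>) x" by (simp add: E_def A_def)
      with that obtain u v where "u < x" "x < v" "v - u < d" "- f v - - f u < - \<beta> * (v - u)" unfolding slope_below_def by blast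
      then show ?thesis by (intro exI[of _ u] exI[of _ v]) (auto simp: \<phi>_def b_def algebra_simps)
    qed
    \<comment> \<open>One short interval of slope at most \<open>a\<close>, compared with the
      expansion of \<open>\<phi>\<close>, gives \<open>1 \<le> a\<close>; the factors
      \<open>a\<close> and \<open>1 / b\<close> are then positive, as the covering estimate
      demands.\<close>
    obtain x0 where "x0 \<in> E" using False unfolding E_def by blast
    then obtain u v where "u < v" "\<phi> v - \<phi> u \<le> a * (v - u)" using small[of x0 1] by auto
    then have "1 * (v - u) \<le> a * (v - u)"
      unfolding mult_1 using order_trans[OF expand[of u v], of "a * (v - u)"] by simp
    then have a1: "1 \<le> a" using \<open>u < v\<close> mult_strict_right_mono[of a 1 "v - u"] by (cases "a < 1") auto
    then have b1: "a < b" "0 < b" using ab unfolding a_def b_def by auto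
    have le1: "emeasure lborel (\<phi> ` E) \<le> ennreal a * emeasure lborel E"
      using a1 by (intro emeasure_image_le_slope[OF sm lipP E PE _ small]) auto
    have le2: "emeasure lborel (\<psi> ` (\<phi> ` E)) \<le> ennreal (1 / b) * emeasure lborel (\<phi> ` E)"
    proof (rule emeasure_image_le_slope[OF smQ lipQ PE])
      show "\<psi> ` (\<phi> ` E) \<in> sets borel" using E QPE by simp
      show "0 < 1 / b" using b1 by simp
      fix y d assume y: "y \<in> \<phi> ` E" and d: "d > (0::real)"
      then obtain x where x: "x \<in> E" "y = \<phi> x" by auto
      \<comment> \<open>The image of an interval of length below \<open>d / (2 * K + 1)\<close>
        under the \<open>(2 * K + 1)\<close>-Lipschitz map \<open>\<phi>\<close> is shorter than
        \<open>d\<close>.\<close>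
      obtain u v where uv: "u < x" "x < v" "v - u < d / (2 * K + 1)" "b * (v - u) \<le> \<phi> v - \<phi> u"
        using large[OF x(1), of "d / (2 * K + 1)"] d K0 by auto
      have "\<phi> v - \<phi> u \<le> (2 * K + 1) * (v - u)"
        using lipschitz_onD[OF lipP, of v u] uv sm by (auto simp: dist_real_def)
      also have "\<dots> < d" using uv K0 by (simp add: field_simps)
      finally show "\<exists>u v. u < v \<and> u \<le> y \<and> y \<le> v \<and> v - u < d \<and> \<psi> v - \<psi> u \<le> 1 / b * (v - u)"
        using uv x sm b1 by (intro exI[of _ "\<phi> u"] exI[of _ "\<phi> v"]) (auto simp: QP strict_mono_less strict_mono_less_eq field_simps)
    qed
    define e where "e = measure lborel E"
    have "emeasure lborel E \<le> emeasure lborel {-m..m}" unfolding E_def by (intro emeasure_mono) auto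
    also have "\<dots> < \<infinity>" by (simp add: emeasure_lborel_Icc_eq)
    finally have em: "emeasure lborel E = ennreal e" unfolding e_def
      by (intro emeasure_eq_ennreal_measure) auto
    have "ennreal e \<le> ennreal (1 / b) * (ennreal a * ennreal e)"
      using le2 mult_left_mono[OF le1, of "ennreal (1/b)"] unfolding QPE em by (meson order_trans zero_le)
    also have "\<dots> = ennreal (a / b * e)" using a1 b1 by (simp add: e_def flip: ennreal_mult)
    finally have "e \<le> a / b * e" using a1 b1 by (subst (asm) ennreal_le_iff) (auto simp: e_def)
    then have "b * e \<le> a * e" using b1 by (simp add: field_simps)
    then have "e \<le> 0" using b1 by (meson mult_less_cancel_right not_less)
    then show ?thesis using em E_def by (simp add: ennreal_neg)
  qed auto
  then have "emeasure lborel (\<Union>n::nat. A \<inter> {- real n..real n}) = 0"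
    using A by (intro emeasure_UN_eq_0) auto
  moreover have "(\<Union>n::nat. A \<inter> {- real n..real n}) = A"
  proof safe
    fix x assume "x \<in> A"
    obtain n :: nat where "\<bar>x\<bar> \<le> real n" using real_arch_simple by blast
    then show "x \<in> (\<Union>n::nat. A \<inter> {- real n..real n})" using \<open>x \<in> A\<close> by (auto intro!: exI[of _ n])
  qed
  ultimately show ?thesis unfolding A_def by simp
qed

text \<open>The candidate \<open>D\<close> is the infimum of the levels below which slopes of
  arbitrarily short intervals around \<open>x\<close> fall. Slopes below \<open>D - e\<close> are
  excluded on short intervals by the infimum, slopes above \<open>D + e\<close> by the absence of
  oscillation between two rational levels just above \<open>D\<close>.\<close>

lemma differentiable_if_no_oscillation:
  fixes f :: "real \<Rightarrow> real"
  assumes lip: "K-lipschitz_on UNIV f"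
    and no: "\<And>\<alpha> \<beta>. \<alpha> \<in> \<rat> \<Longrightarrow> \<beta> \<in> \<rat> \<Longrightarrow> \<alpha> < \<beta> \<Longrightarrow> \<not> (slope_below f \<alpha> x \<and> slope_below (\<lambda>x. - f x) (- \<beta>) x)"
  shows "\<exists>D. (f has_real_derivative D) (at x)"
proof -
  have K0: "K \<ge> 0" using lip by (rule lipschitz_on_nonneg)
  have fb: "\<bar>f y - f x\<bar> \<le> K * \<bar>y - x\<bar>" for x y using lipschitz_onD[OF lip] by (auto simp: dist_real_def)
  define S where "S = {\<alpha>. slope_below f \<alpha> x}"
  have "K + 1 \<in> S" unfolding S_def slope_below_def
  proof safe
    fix d :: real assume "d > 0"
    have e: "(x + d/3) - (x - d/3) = 2 * d / 3" by simp
    have "f (x + d/3) - f (x - d/3) < (K + 1) * ((x + d/3) - (x - d/3))"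
      using fb[of "x + d/3" "x - d/3"] \<open>d > 0\<close> unfolding e distrib_right by linarith
    then show "\<exists>u v. u < x \<and> x < v \<and> v - u < d \<and> f v - f u < (K + 1) * (v - u)"
      using \<open>d > 0\<close> by (intro exI[of _ "x - d/3"] exI[of _ "x + d/3"]) auto
  qed
  have low: "- K \<le> \<alpha>" if "\<alpha> \<in> S" for \<alpha>
  proof -
    from that obtain u v where "u < x" "x < v" "f v - f u < \<alpha> * (v - u)" unfolding S_def slope_below_def by (auto dest!: spec[of _ 1])
    then have "- K * (v - u) < \<alpha> * (v - u)" using fb[of v u] by auto
    moreover have "0 < v - u" using \<open>u < x\<close> \<open>x < v\<close> by simp
    ultimately show ?thesis by (meson less_eq_real_def mult_less_cancel_right_pos)
  qed
  then have bdd: "bdd_below S" by (intro bdd_belowI)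
  define D where "D = Inf S"
  have est: "\<exists>d>0. \<forall>u v. u < x \<longrightarrow> x < v \<longrightarrow> v - u < d \<longrightarrow> \<bar>f v - f u - D * (v - u)\<bar> \<le> e * (v - u)" if "e > 0" for e
  proof -
    have "D - e \<notin> S" using cInf_lower[OF _ bdd, of "D - e"] that D_def by auto
    then obtain d1 where d1: "d1 > 0" "\<And>u v. u < x \<Longrightarrow> x < v \<Longrightarrow> v - u < d1 \<Longrightarrow> (D - e) * (v - u) \<le> f v - f u"
      unfolding S_def slope_below_def by force
    have "S \<noteq> {}" "Inf S < D + e / 3" using \<open>K + 1 \<in> S\<close> that by (auto simp: D_def)
    then obtain \<alpha> where "\<alpha> \<in> S" "\<alpha> < D + e / 3" using cInf_lessD by blast
    obtain q1 q2 where q: "q1 \<in> \<rat>" "q2 \<in> \<rat>" "\<alpha> < q1" "q1 < q2" "q2 < D + e"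
    proof -
      have "D + e / 3 < D + e" using \<open>e > 0\<close> by simp
      then obtain q2 where "q2 \<in> \<rat>" "D + e / 3 < q2" "q2 < D + e" using Rats_dense_in_real by blast
      moreover obtain q1 where "q1 \<in> \<rat>" "\<alpha> < q1" "q1 < D + e / 3"
        using Rats_dense_in_real[OF \<open>\<alpha> < D + e / 3\<close>] by blast
      ultimately show ?thesis by (intro that[of q1 q2]) auto
    qed
    have "slope_below f q1 x" using slope_below_mono[of f \<alpha> x q1] \<open>\<alpha> \<in> S\<close> q S_def by auto
    then have "\<not> slope_below (\<lambda>x. - f x) (- q2) x" using no[OF q(1,2,4)] by blast
    then obtain d2 where d2: "d2 > 0" "\<And>u v. u < x \<Longrightarrow> x < v \<Longrightarrow> v - u < d2 \<Longrightarrow> - q2 * (v - u) \<le> - f v + f u"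
      unfolding slope_below_def by force
    show ?thesis
    proof (intro exI[of _ "min d1 d2"] conjI allI impI)
      fix u v assume uv: "u < x" "x < v" "v - u < min d1 d2"
      have "(D - e) * (v - u) \<le> f v - f u" using d1 uv by auto
      moreover have "f v - f u \<le> q2 * (v - u)" using d2(2)[of u v] uv by auto
      moreover have "q2 * (v - u) \<le> (D + e) * (v - u)" using q uv by (intro mult_right_mono) auto
      ultimately show "\<bar>f v - f u - D * (v - u)\<bar> \<le> e * (v - u)" by (simp add: algebra_simps abs_le_iff)
    qed (use d1 d2 in auto)
  qed
  have cf: "continuous_on UNIV f" using lip by (rule lipschitz_on_continuous_on)
  have ic: "isCont f x" using cf by (simp add: continuous_on_eq_continuous_at)
  have "(f has_real_derivative D) (at x)"
    unfolding has_field_derivative_def has_derivative_at_alt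
  proof (intro conjI allI impI)
    show "bounded_linear ((*) D)" by (rule bounded_linear_mult_right)
    fix e :: real assume "e > 0"
    then obtain d where d: "d > 0" "\<And>u v. u < x \<Longrightarrow> x < v \<Longrightarrow> v - u < d \<Longrightarrow> \<bar>f v - f u - D * (v - u)\<bar> \<le> e * (v - u)"
      using est[of e] by blast
    \<comment> \<open>only intervals with x in the interior are controlled, so one endpoint is moved to x by continuity\<close>
    show "\<exists>d>0. \<forall>y. norm (y - x) < d \<longrightarrow> norm (f y - f x - D * (y - x)) \<le> e * norm (y - x)"
    proof (intro exI[of _ d] conjI allI impI)
      fix y assume y: "norm (y - x) < d"
      consider "y = x" | "y > x" | "y < x" by linarith
      then show "norm (f y - f x - D * (y - x)) \<le> e * norm (y - x)"
      proof cases
        case 2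
        have "((\<lambda>u. \<bar>f y - f u - D * (y - u)\<bar>) \<longlongrightarrow> \<bar>f y - f x - D * (y - x)\<bar>) (at_left x)"
          using ic by (intro tendsto_intros) (auto simp: isCont_def filterlim_at_split)
        moreover have "((\<lambda>u. e * (y - u)) \<longlongrightarrow> e * (y - x)) (at_left x)" by (intro tendsto_intros)
        moreover have "eventually (\<lambda>u. \<bar>f y - f u - D * (y - u)\<bar> \<le> e * (y - u)) (at_left x)"
          using eventually_at_left_real[of "y - d" x] y 2 by (auto elim!: eventually_mono intro!: d(2))
        ultimately have "\<bar>f y - f x - D * (y - x)\<bar> \<le> e * (y - x)"
          by (intro tendsto_le[OF trivial_limit_at_left_real])
        then show ?thesis using 2 by simp
      next
        case 3
        have "((\<lambda>v. \<bar>f v - f y - D * (v - y)\<bar>) \<longlongrightarrow> \<bar>f x - f y - D * (x - y)\<bar>) (at_right x)"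
          using ic by (intro tendsto_intros) (auto simp: isCont_def filterlim_at_split)
        moreover have "((\<lambda>v. e * (v - y)) \<longlongrightarrow> e * (x - y)) (at_right x)" by (intro tendsto_intros)
        moreover have "eventually (\<lambda>v. \<bar>f v - f y - D * (v - y)\<bar> \<le> e * (v - y)) (at_right x)"
          using eventually_at_right_real[of x "y + d"] y 3 by (auto elim!: eventually_mono intro!: d(2))
        ultimately have "\<bar>f x - f y - D * (x - y)\<bar> \<le> e * (x - y)"
          by (intro tendsto_le[OF trivial_limit_at_right_real])
        then show ?thesis using 3 by (simp add: algebra_simps abs_le_iff)
      qed auto
    qed (use d in auto)
  qed
  then show ?thesis by blast
qed

text \<open>Each of the countably many pairs of rational levels contributes a null set.\<close>

theorem lipschitz_differentiable_AE:
  fixes f :: "real \<Rightarrow> real"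
  assumes lip: "K-lipschitz_on UNIV f"
  shows "AE x in lborel. \<exists>D. (f has_real_derivative D) (at x)"
proof -
  have cf: "continuous_on UNIV f" using lip by (rule lipschitz_on_continuous_on)
  have "AE x in lborel. \<forall>\<alpha>\<in>\<rat>. \<forall>\<beta>\<in>\<rat>. \<alpha> < \<beta> \<longrightarrow> \<not> (slope_below f \<alpha> x \<and> slope_below (\<lambda>x. - f x) (- \<beta>) x)"
  proof (intro AE_ball_countable' countable_rat)
    fix \<alpha> \<beta> :: real
    show "AE x in lborel. \<alpha> < \<beta> \<longrightarrow> \<not> (slope_below f \<alpha> x \<and> slope_below (\<lambda>x. - f x) (- \<beta>) x)"
    proof (cases "\<alpha> < \<beta>")
      case True
      have "{x. slope_below f \<alpha> x \<and> slope_below (\<lambda>x. - f x) (- \<beta>) x} \<in> sets borel"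
        unfolding Collect_conj_eq by (intro sets.Int borel_slope_below continuous_intros cf)
      then have "{x. slope_below f \<alpha> x \<and> slope_below (\<lambda>x. - f x) (- \<beta>) x} \<in> null_sets lborel"
        using null_slope_oscillation[OF lip True] by (auto simp: null_sets_def)
      then show ?thesis by (rule AE_I') auto
    qed auto
  qed
  then show ?thesis by (rule AE_mp) (auto intro!: AE_I2 differentiable_if_no_oscillation[OF lip])
qed

text \<open>For each pair of rational levels all sections of the exceptional set are null by the
  result on the line, hence the set itself is null by Fubini. This serves the derivative of the
  value function in the rate.\<close>

theorem partial_lipschitz_differentiable_AE:
  fixes f :: "real \<Rightarrow> real \<Rightarrow> real"
  assumes lip: "\<And>x. K-lipschitz_on UNIV (f x)" and cont: "\<And>s. continuous_on UNIV (\<lambda>x. f x s)"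
  shows "AE z in lborel. \<exists>D. (f (fst z) has_real_derivative D) (at (snd z))"
proof -
  have "AE z in lborel. \<forall>\<alpha>\<in>\<rat>. \<forall>\<beta>\<in>\<rat>. \<alpha> < \<beta> \<longrightarrow>
    \<not> (slope_below (f (fst z)) \<alpha> (snd z) \<and> slope_below (\<lambda>s. - f (fst z) s) (- \<beta>) (snd z))"
  proof (intro AE_ball_countable' countable_rat)
    fix \<alpha> \<beta> :: real
    show "AE z in lborel. \<alpha> < \<beta> \<longrightarrow> \<not> (slope_below (f (fst z)) \<alpha> (snd z) \<and> slope_below (\<lambda>s. - f (fst z) s) (- \<beta>) (snd z))"
    proof (cases "\<alpha> < \<beta>")
      case True
      define A where "A = {z. slope_below (f (fst z)) \<alpha> (snd z) \<and> slope_below (\<lambda>s. - f (fst z) s) (- \<beta>) (snd z)}"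
      have A: "A \<in> sets borel"
        unfolding Collect_conj_eq A_def by (intro sets.Int Gdelta_slope_below cont Gdelta_slope_below[of "\<lambda>x s. - f x s"] continuous_intros)
      have "emeasure (lborel \<Otimes>\<^sub>M lborel) A = (\<integral>\<^sup>+ x. emeasure lborel (Pair x -` A) \<partial>lborel)"
        using A by (intro lborel.emeasure_pair_measure_alt) (metis lborel_prod sets_lborel)
      also have "\<dots> = (\<integral>\<^sup>+ x. 0 \<partial>(lborel :: real measure))"
        by (intro nn_integral_cong) (use null_slope_oscillation[OF lip True] in \<open>simp add: A_def vimage_def\<close>)
      finally have "emeasure lborel A = 0" by (simp add: lborel_prod)
      then have "A \<in> null_sets lborel" using A by (auto simp: null_sets_def)
      then show ?thesis by (rule AE_I') (auto simp: A_def)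
    qed auto
  qed
  then show ?thesis by (rule AE_mp) (auto intro!: AE_I2 differentiable_if_no_oscillation[OF lip])
qed

section \<open>Second-order equations and a maximum principle\<close>

lemma continuous_on_integral_from_0:
  fixes f :: "real \<Rightarrow> real"
  assumes "continuous_on {0..} f"
  shows "continuous_on {0..} (\<lambda>y. integral {0..y} f)"
proof (rule continuous_on_eq_continuous_within[THEN iffD2], rule ballI)
  fix x :: real assume x: "x \<in> {0..}"
  have "continuous_on {0..x+1} f" using assms by (rule continuous_on_subset) auto
  then have "continuous_on {0..x+1} (\<lambda>y. integral {0..y} f)"
    by (intro indefinite_integral_continuous_1 integrable_continuous_real)
  then have "continuous (at x within {0..x+1}) (\<lambda>y. integral {0..y} f)"
    using x by (simp add: continuous_on_eq_continuous_within)
  moreover have "at x within {0..x+1} = at x within {0..}"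
    using x by (intro at_within_nhd[of _ "{..<x+1}"]) auto
  ultimately show "continuous (at x within {0..}) (\<lambda>y. integral {0..y} f)" by simp
qed

text \<open>In the exponentially weighted norm, integration gains a factor \<open>1 / l\<close>.
  This turns Picard iteration into a contraction on the whole half-line at once.\<close>

lemma abs_integral_le_exp:
  fixes h :: "real \<Rightarrow> real"
  assumes "0 < l" "0 \<le> M" "0 \<le> y" "continuous_on {0..y} h"
    and le: "\<And>t. 0 \<le> t \<Longrightarrow> t \<le> y \<Longrightarrow> \<bar>h t\<bar> \<le> M * exp (l * t)"
  shows "\<bar>integral {0..y} h\<bar> \<le> M * exp (l * y) / l"
proof -
  have I: "((\<lambda>t. M * exp (l * t)) has_integral (M * exp (l * y) / l - M * exp (l * 0) / l)) {0..y}"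
    using assms(1,3) by (intro fundamental_theorem_of_calculus)
      (auto intro!: derivative_eq_intros simp flip: has_real_derivative_iff_has_vector_derivative)
  have "norm (integral {0..y} h) \<le> integral {0..y} (\<lambda>t. M * exp (l * t))"
    using le I by (intro integral_norm_bound_integral integrable_continuous_real assms)
      (auto intro!: continuous_intros)
  also have "\<dots> \<le> M * exp (l * y) / l" using integral_unique[OF I] assms by simp
  finally show ?thesis by simp
qed

text \<open>The unknown is the slope, and the value is its integral. After division by
  \<open>exp (l * x)\<close> the integral operator contracts by \<open>1 / 2\<close> on bounded
  continuous functions, which gives global existence; the factor 2 in the dependence on the initial
  slope \<open>a\<close> is \<open>1 / (1 - 1 / 2)\<close>.\<close>

lemma picard_second_order:
  fixes G :: "real \<Rightarrow> real \<Rightarrow> real"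
  assumes L: "L > 0" and lip: "\<And>u p u' p'. \<bar>G u p - G u' p'\<bar> \<le> L * (\<bar>u - u'\<bar> + \<bar>p - p'\<bar>)"
  obtains P :: "real \<Rightarrow> real \<Rightarrow> real" where
    "\<And>a. continuous_on UNIV (P a)" "\<And>a x. x \<le> 0 \<Longrightarrow> P a x = a"
    "\<And>a x. 0 \<le> x \<Longrightarrow> P a x = a + integral {0..x} (\<lambda>t. G (integral {0..t} (P a)) (P a t))"
    "\<And>a a' x. 0 \<le> x \<Longrightarrow> \<bar>P a x - P a' x\<bar> \<le> 2 * \<bar>a - a'\<bar> * exp ((4 * L + 1) * x)"
proof -
  \<comment> \<open>In the contraction factor \<open>L / l * (1 / l + 1)\<close> the outer
    \<open>1 / l\<close> comes from integrating \<open>G\<close>, the inner one from recovering the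
    value from the slope, and 1 from the slope itself. With \<open>l = 4 * L + 1\<close> it is at
    most \<open>1 / 4 * 2\<close>.\<close>
  define l where "l = 4 * L + 1"
  have l: "l > 0" "l \<ge> 1" "L / l * (1 / l + 1) \<le> 1 / 2"
  proof -
    have "L / l \<le> 1 / 4" "1 / l + 1 \<le> 2" using L by (auto simp: l_def field_simps)
    then have "L / l * (1 / l + 1) \<le> 1 / 4 * 2" using L by (intro mult_mono) (auto simp: l_def)
    then show "L / l * (1 / l + 1) \<le> 1 / 2" by simp
  qed (use L in \<open>auto simp: l_def\<close>)
  have contG: "continuous_on S (\<lambda>t. G (f t) (g t))"
    if "continuous_on S f" "continuous_on S g" for S :: "real set" and f g
  proof -
    have "((\<lambda>t. G (f t) (g t)) \<longlongrightarrow> G (f x) (g x)) (at x within S)" if x: "x \<in> S" for x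
    proof (rule Lim_null_comparison[THEN LIM_zero_cancel])
      show "\<forall>\<^sub>F t in at x within S. norm (G (f t) (g t) - G (f x) (g x)) \<le> L * (\<bar>f t - f x\<bar> + \<bar>g t - g x\<bar>)"
        using lip by simp
      have "((\<lambda>t. L * (\<bar>f t - f x\<bar> + \<bar>g t - g x\<bar>)) \<longlongrightarrow> L * (\<bar>f x - f x\<bar> + \<bar>g x - g x\<bar>)) (at x within S)"
        using \<open>continuous_on S f\<close> \<open>continuous_on S g\<close> x by (intro tendsto_intros) (auto simp: continuous_on_def)
      then show "((\<lambda>t. L * (\<bar>f t - f x\<bar> + \<bar>g t - g x\<bar>)) \<longlongrightarrow> 0) (at x within S)" by simp
    qed
    then show ?thesis by (simp add: continuous_on_def)
  qed
  \<comment> \<open>\<open>q\<close> is the weighted slope and \<open>H q\<close> the integrand of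
    the equation for the slope \<open>exp (l * t) * q t\<close>. Clamping the argument at 0 in
    \<open>\<Psi>\<close> produces functions on the whole line, constant to the left of 0.\<close>
  define H where "H q t = G (integral {0..t} (\<lambda>s. exp (l * s) * q s)) (exp (l * t) * q t)" for q t
  define \<Psi> where "\<Psi> a q x = exp (- l * max 0 x) * (a + integral {0..max 0 x} (H q))" for a q x
  have contH: "continuous_on {0..} (H q)" if "continuous_on UNIV q" for q
    unfolding H_def using that
    by (intro contG continuous_on_integral_from_0 continuous_intros continuous_on_subset[OF that]) auto
  have contPsi: "continuous_on UNIV (\<Psi> a q)" if "continuous_on UNIV q" for a q
  proof -
    have "continuous_on UNIV (\<lambda>x. integral {0..max 0 x} (H q))"
      by (rule continuous_on_compose2[OF continuous_on_integral_from_0[OF contH[OF that]], of _ "\<lambda>x. max 0 x"])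
        (auto intro!: continuous_intros)
    then show ?thesis unfolding \<Psi>_def by (intro continuous_intros)
  qed
  have diffH: "\<bar>H q t - H q' t\<bar> \<le> L * d * (1 / l + 1) * exp (l * t)"
    if "continuous_on UNIV q" "continuous_on UNIV q'" "\<And>s. \<bar>q s - q' s\<bar> \<le> d" "0 \<le> t" for q q' d t
  proof -
    have d0: "d \<ge> 0" using that(3)[of 0] by linarith
    have int: "(\<lambda>s. exp (l * s) * w s) integrable_on {0..t}" if "continuous_on UNIV w" for w
      by (intro integrable_continuous_real continuous_intros continuous_on_subset[OF that]) auto
    have "\<bar>integral {0..t} (\<lambda>s. exp (l * s) * q s) - integral {0..t} (\<lambda>s. exp (l * s) * q' s)\<bar>
      = \<bar>integral {0..t} (\<lambda>s. exp (l * s) * (q s - q' s))\<bar>"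
      using int that by (simp add: right_diff_distrib Henstock_Kurzweil_Integration.integral_diff)
    also have "\<dots> \<le> d * exp (l * t) / l"
    proof (rule abs_integral_le_exp[OF l(1) d0 that(4)])
      show "continuous_on {0..t} (\<lambda>s. exp (l * s) * (q s - q' s))"
        by (intro continuous_intros continuous_on_subset[OF that(1)] continuous_on_subset[OF that(2)]) auto
      show "\<bar>exp (l * s) * (q s - q' s)\<bar> \<le> d * exp (l * s)" for s
        using that(3)[of s] by (simp add: abs_mult mult.commute)
    qed
    finally have 1: "\<bar>integral {0..t} (\<lambda>s. exp (l * s) * q s) - integral {0..t} (\<lambda>s. exp (l * s) * q' s)\<bar> \<le> d * exp (l * t) / l" .
    have "\<bar>exp (l * t) * q t - exp (l * t) * q' t\<bar> = exp (l * t) * \<bar>q t - q' t\<bar>"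
      by (simp add: abs_mult flip: right_diff_distrib)
    then have 2: "\<bar>exp (l * t) * q t - exp (l * t) * q' t\<bar> \<le> d * exp (l * t)"
      using that(3)[of t] by (simp add: mult.commute)
    have "\<bar>H q t - H q' t\<bar> \<le> L * (d * exp (l * t) / l + d * exp (l * t))"
      unfolding H_def by (rule order_trans[OF lip]) (use L 1 2 in \<open>intro mult_left_mono add_mono, auto\<close>)
    then show ?thesis by (simp add: algebra_simps)
  qed
  have diffPsi: "\<bar>\<Psi> a q x - \<Psi> a' q' x\<bar> \<le> \<bar>a - a'\<bar> + d / 2"
    if "continuous_on UNIV q" "continuous_on UNIV q'" "\<And>s. \<bar>q s - q' s\<bar> \<le> d" for a a' q q' d x
  proof -
    define y where "y = max 0 x"
    have y: "0 \<le> y" by (simp add: y_def)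
    have d0: "d \<ge> 0" using that(3)[of 0] by linarith
    have int: "H w integrable_on {0..y}" if "continuous_on UNIV w" for w
      by (intro integrable_continuous_real continuous_on_subset[OF contH[OF that]]) auto
    have "\<bar>integral {0..y} (\<lambda>t. H q t - H q' t)\<bar> \<le> (L * d * (1 / l + 1)) * exp (l * y) / l"
      using L d0 l y diffH[OF that]
      by (intro abs_integral_le_exp continuous_intros continuous_on_subset[OF contH[OF that(1)]]
          continuous_on_subset[OF contH[OF that(2)]]) auto
    also have "\<dots> = L / l * (1 / l + 1) * (d * exp (l * y))" by simp
    also have "\<dots> \<le> 1 / 2 * (d * exp (l * y))" using l(3) d0 by (intro mult_right_mono) auto
    finally have 1: "\<bar>integral {0..y} (H q) - integral {0..y} (H q')\<bar> \<le> d / 2 * exp (l * y)"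
      using int that by (simp add: Henstock_Kurzweil_Integration.integral_diff)
    have "\<Psi> a q x - \<Psi> a' q' x = exp (- (l * y)) * ((a - a') + (integral {0..y} (H q) - integral {0..y} (H q')))"
      unfolding \<Psi>_def y_def by (simp add: algebra_simps)
    then have "\<bar>\<Psi> a q x - \<Psi> a' q' x\<bar> = exp (- (l * y)) * \<bar>(a - a') + (integral {0..y} (H q) - integral {0..y} (H q'))\<bar>"
      by (simp add: abs_mult)
    also have "\<dots> \<le> exp (- (l * y)) * (\<bar>a - a'\<bar> * exp (l * y) + d / 2 * exp (l * y))"
    proof (intro mult_left_mono)
      have "\<bar>a - a'\<bar> * 1 \<le> \<bar>a - a'\<bar> * exp (l * y)" using l y by (intro mult_left_mono) auto
      with 1 show "\<bar>(a - a') + (integral {0..y} (H q) - integral {0..y} (H q'))\<bar> \<le> \<bar>a - a'\<bar> * exp (l * y) + d / 2 * exp (l * y)"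
        using abs_triangle_ineq[of "a - a'" "integral {0..y} (H q) - integral {0..y} (H q')"] by auto
    qed auto
    also have "\<dots> = \<bar>a - a'\<bar> + d / 2" by (simp add: field_simps exp_minus)
    finally show ?thesis .
  qed
  have bnd0: "\<bar>\<Psi> a (\<lambda>_. 0) x\<bar> \<le> \<bar>a\<bar> + \<bar>G 0 0\<bar>" for a x
  proof -
    define y where "y = max 0 x"
    have y: "0 \<le> y" by (simp add: y_def)
    have "y \<le> exp (l * y)" using exp_ge_add_one_self[of "l * y"] l y mult_right_mono[of 1 l y] by linarith
    then have e: "exp (- (l * y)) * y \<le> 1" by (simp add: exp_minus field_simps)
    have "\<Psi> a (\<lambda>_. 0) x = exp (- (l * y)) * a + (exp (- (l * y)) * y) * G 0 0"
      unfolding \<Psi>_def H_def y_def by (simp add: algebra_simps)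
    also have "\<bar>\<dots>\<bar> \<le> exp (- (l * y)) * \<bar>a\<bar> + (exp (- (l * y)) * y) * \<bar>G 0 0\<bar>"
      using y by (intro order_trans[OF abs_triangle_ineq]) (auto simp: abs_mult)
    also have "\<dots> \<le> 1 * \<bar>a\<bar> + 1 * \<bar>G 0 0\<bar>"
      using e y l by (intro add_mono mult_right_mono) auto
    finally show ?thesis by simp
  qed
  have bc: "\<Psi> a (apply_bcontfun q) \<in> bcontfun" for a q
  proof -
    have c: "continuous_on UNIV (apply_bcontfun q)" by (rule continuous_on_apply_bcontfun)
    have "\<bar>\<Psi> a q x\<bar> \<le> \<bar>a\<bar> + \<bar>G 0 0\<bar> + norm q / 2" for x
    proof -
      have "\<bar>\<Psi> a q x - \<Psi> a (\<lambda>_. 0) x\<bar> \<le> \<bar>a - a\<bar> + norm q / 2"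
        using norm_bounded[of q] by (intro diffPsi[OF c]) auto
      with bnd0[of a x] show ?thesis by linarith
    qed
    then show ?thesis using contPsi[OF c] unfolding bcontfun_def bounded_iff by auto
  qed
  define \<Phi> where "\<Phi> a q = Bcontfun (\<Psi> a (apply_bcontfun q))" for a q
  have app: "apply_bcontfun (\<Phi> a q) x = \<Psi> a (apply_bcontfun q) x" for a q x
    unfolding \<Phi>_def using bc by (simp add: Bcontfun_inverse)
  have dd: "\<bar>apply_bcontfun q s - apply_bcontfun q' s\<bar> \<le> dist q q'" for q q' :: "real \<Rightarrow>\<^sub>C real" and s
    using dist_bounded[of q s q'] by (simp add: dist_real_def)
  have contr: "dist (\<Phi> a q) (\<Phi> a' q') \<le> \<bar>a - a'\<bar> + dist q q' / 2" for a a' q q'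
    by (rule dist_bound) (auto simp: app dist_real_def intro!: diffPsi dd)
  have "\<exists>!q. \<Phi> a q = q" for a
    using contr[of a _ a] by (intro banach_fix_type[of "1/2"]) auto
  then obtain Q where Q: "\<And>a. \<Phi> a (Q a) = Q a" by metis
  define P where "P a x = exp (l * max 0 x) * apply_bcontfun (Q a) x" for a x
  have cQ: "continuous_on UNIV (apply_bcontfun (Q a))" for a by (rule continuous_on_apply_bcontfun)
  have Peq: "P a x = a + integral {0..max 0 x} (H (Q a))" for a x
    unfolding P_def using app[of a "Q a" x] unfolding Q \<Psi>_def by (simp add: exp_minus)
  have P: "P a t = exp (l * t) * Q a t" if "0 \<le> t" for a t using that by (simp add: P_def)
  have dQ: "dist (Q a) (Q a') \<le> 2 * \<bar>a - a'\<bar>" for a a' using contr[of a "Q a" a' "Q a'"] unfolding Q by simp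
  show ?thesis
  proof
    show "continuous_on UNIV (P a)" for a unfolding P_def by (intro continuous_intros cQ)
    show "P a x = a" if "x \<le> 0" for a x using that by (simp add: Peq max_absorb1)
    show "P a x = a + integral {0..x} (\<lambda>t. G (integral {0..t} (P a)) (P a t))" if "0 \<le> x" for a x
    proof -
      have "integral {0..t} (P a) = integral {0..t} (\<lambda>s. exp (l * s) * Q a s)" for t
        by (intro integral_cong) (simp add: P)
      then have "integral {0..x} (\<lambda>t. G (integral {0..t} (P a)) (P a t)) = integral {0..x} (H (Q a))"
        by (intro integral_cong) (simp add: H_def P)
      then show ?thesis using that by (simp add: Peq max_absorb2)
    qed
    show "\<bar>P a x - P a' x\<bar> \<le> 2 * \<bar>a - a'\<bar> * exp ((4 * L + 1) * x)" if "0 \<le> x" for a a' x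
    proof -
      have "\<bar>P a x - P a' x\<bar> = exp (l * x) * \<bar>Q a x - Q a' x\<bar>" using that by (simp add: P abs_mult flip: right_diff_distrib)
      also have "\<dots> \<le> exp (l * x) * (2 * \<bar>a - a'\<bar>)" using dd[of "Q a" x "Q a'"] dQ[of a a'] by (intro mult_left_mono) auto
      finally show ?thesis by (simp add: l_def mult.commute)
    qed
  qed
qed

text \<open>\<open>G\<close> is a lower bound, in integrated form, for the second derivative of
  \<open>u\<close>. Where it is positive the slope increases and \<open>u\<close> rises strictly
  above its tangent; at a maximum this is absurd.\<close>

lemma local_convex_right:
  fixes u up G :: "real \<Rightarrow> real"
  assumes du: "\<And>x. z \<le> x \<Longrightarrow> x \<le> z + d \<Longrightarrow> (u has_real_derivative up x) (at x)" and d: "d > 0"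
    and G: "continuous_on {z..z+d} G" "G z > 0"
    and ge: "\<And>x y. z \<le> x \<Longrightarrow> x \<le> y \<Longrightarrow> y \<le> z + d \<Longrightarrow> integral {x..y} G \<le> up y - up x"
  shows "\<exists>\<delta>>0. \<delta> \<le> d \<and> (\<forall>y. z < y \<and> y \<le> z + \<delta> \<longrightarrow> up z < up y \<and> u z + up z * (y - z) < u y)"
proof -
  have "\<exists>e>0. \<forall>x\<in>{z..z+d}. dist x z < e \<longrightarrow> dist (G x) (G z) < G z"
    using G d unfolding continuous_on_iff by (metis atLeastAtMost_iff le_add_same_cancel1 less_eq_real_def)
  then obtain e where e: "e > 0" "\<And>x. z \<le> x \<Longrightarrow> x \<le> z + d \<Longrightarrow> x - z < e \<Longrightarrow> \<bar>G x - G z\<bar> < G z"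
    unfolding dist_real_def by fastforce
  define \<delta> where "\<delta> = min d (e / 2)"
  have \<delta>: "\<delta> > 0" "\<delta> \<le> d" "\<delta> < e" using e d by (auto simp: \<delta>_def)
  have up: "up z < up y" if "z < y" "y \<le> z + \<delta>" for y
  proof -
    have c: "continuous_on {z..y} G" using G(1) by (rule continuous_on_subset) (use that \<delta> in auto)
    have pos: "G x > 0" if "z \<le> x" "x \<le> y" for x using e(2)[of x] that \<open>y \<le> z + \<delta>\<close> \<delta> by force
    have "0 < integral {z..y} G"
    proof -
      have "0 \<le> integral {z..y} G" using pos by (intro integral_nonneg integrable_continuous_real c) (auto intro: less_imp_le)
      moreover have "integral {z..y} G \<noteq> 0"
        using integral_eq_0_iff[OF c] pos \<open>z < y\<close> by (metis atLeastAtMost_iff less_eq_real_def less_irrefl)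
      ultimately show ?thesis by simp
    qed
    with ge[of z y] that \<delta> show ?thesis by auto
  qed
  have "u z + up z * (y - z) < u y" if y: "z < y" "y \<le> z + \<delta>" for y
  proof -
    obtain \<xi> where "\<xi> > z" "\<xi> < y" "u y - u z = (y - z) * up \<xi>" using MVT2[OF y(1) du] y \<delta> by auto
    moreover have "(y - z) * up z < (y - z) * up \<xi>"
      using up[of \<xi>] \<open>\<xi> > z\<close> \<open>\<xi> < y\<close> y by (intro mult_strict_left_mono) auto
    ultimately show ?thesis unfolding mult.commute[of "up z"] by linarith
  qed
  with up \<delta> show ?thesis by blast
qed

text \<open>The reflection \<open>x \<mapsto> - x\<close> of the preceding lemma. The uniqueness
  proof needs this side, since there the equation is known only to the left of the maximum.\<close>

lemma local_convex_left:
  fixes u up G :: "real \<Rightarrow> real"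
  assumes du: "\<And>x. z - d \<le> x \<Longrightarrow> x \<le> z \<Longrightarrow> (u has_real_derivative up x) (at x)" and d: "d > 0"
    and G: "continuous_on {z-d..z} G" "G z > 0"
    and ge: "\<And>x y. z - d \<le> x \<Longrightarrow> x \<le> y \<Longrightarrow> y \<le> z \<Longrightarrow> integral {x..y} G \<le> up y - up x"
  shows "\<exists>\<delta>>0. \<delta> \<le> d \<and> (\<forall>y. z - \<delta> \<le> y \<and> y < z \<longrightarrow> up y < up z \<and> u z + up z * (y - z) < u y)"
proof -
  have "\<exists>\<delta>>0. \<delta> \<le> d \<and> (\<forall>y. - z < y \<and> y \<le> - z + \<delta> \<longrightarrow> - up (- (- z)) < - up (- y) \<and> u (- (- z)) + - up (- (- z)) * (y - - z) < u (- y))"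
  proof (rule local_convex_right[where G = "\<lambda>x. G (- x)"])
    show "((\<lambda>x. u (- x)) has_real_derivative - up (- x)) (at x)" if "- z \<le> x" "x \<le> - z + d" for x
      by (rule DERIV_cong[OF DERIV_chain'[OF DERIV_minus[OF DERIV_ident] du]]) (use that in auto)
    show "continuous_on {- z..- z + d} (\<lambda>x. G (- x))"
      by (rule continuous_on_compose2[OF G(1)]) (auto intro!: continuous_intros)
    show "integral {x..y} (\<lambda>x. G (- x)) \<le> - up (- y) - - up (- x)" if "- z \<le> x" "x \<le> y" "y \<le> - z + d" for x y
    proof -
      have "integral {x..y} (\<lambda>x. G (- x)) = integral {- y..- x} G"
        using Henstock_Kurzweil_Integration.integral_reflect_real[where a = "- y" and b = "- x" and f = G] by simp
      then show ?thesis using ge[of "- y" "- x"] that by simp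
    qed
  qed (use d G in auto)
  then obtain \<delta> where \<delta>: "\<delta> > 0" "\<delta> \<le> d" and H:
    "\<And>y. - z < y \<Longrightarrow> y \<le> - z + \<delta> \<Longrightarrow> - up (- (- z)) < - up (- y) \<and> u (- (- z)) + - up (- (- z)) * (y - - z) < u (- y)" by blast
  show ?thesis
  proof (intro exI[of _ \<delta>] conjI allI impI)
    fix y assume "z - \<delta> \<le> y \<and> y < z"
    with H[of "- y"] show "up y < up z" "u z + up z * (y - z) < u y" by (auto simp: algebra_simps)
  qed (use \<delta> in auto)
qed

text \<open>At an interior maximum above \<open>e / \<rho>\<close> the slope vanishes, so the
  first-order term drops out whatever \<open>B\<close> is, and the second derivative is bounded
  below by something positive.\<close>

lemma maximum_principle:
  fixes u up :: "real \<Rightarrow> real"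
  assumes du: "\<And>x. (u has_real_derivative up x) (at x)" and cup: "continuous_on UNIV up"
    and \<rho>: "\<rho> > 0"
    and ge: "\<And>x y. \<alpha> \<le> x \<Longrightarrow> x \<le> y \<Longrightarrow> y \<le> \<beta> \<Longrightarrow> integral {x..y} (\<lambda>t. \<rho> * u t - B * \<bar>up t\<bar> - e) \<le> up y - up x"
    and bd: "u \<alpha> \<le> e / \<rho>" "u \<beta> \<le> e / \<rho>" and x: "x \<in> {\<alpha>..\<beta>}"
  shows "u x \<le> e / \<rho>"
proof (rule ccontr)
  assume "\<not> u x \<le> e / \<rho>"
  have cu: "continuous_on S u" for S using du by (meson DERIV_isCont continuous_at_imp_continuous_on)
  obtain z where z: "z \<in> {\<alpha>..\<beta>}" "\<And>y. y \<in> {\<alpha>..\<beta>} \<Longrightarrow> u y \<le> u z"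
    using continuous_attains_sup[of "{\<alpha>..\<beta>}" u] cu x by auto
  have uz: "u z > e / \<rho>" using z(2)[OF x] \<open>\<not> u x \<le> e / \<rho>\<close> by linarith
  then have zi: "\<alpha> < z" "z < \<beta>" using z(1) bd by (auto simp: less_le)
  have upz: "up z = 0"
  proof (rule DERIV_local_max[OF du])
    show "0 < min (z - \<alpha>) (\<beta> - z)" using zi by auto
    show "\<forall>y. \<bar>z - y\<bar> < min (z - \<alpha>) (\<beta> - z) \<longrightarrow> u y \<le> u z" by (auto intro!: z(2) simp: abs_less_iff)
  qed
  have "\<exists>\<delta>>0. \<delta> \<le> \<beta> - z \<and> (\<forall>y. z < y \<and> y \<le> z + \<delta> \<longrightarrow> up z < up y \<and> u z + up z * (y - z) < u y)"
  proof (rule local_convex_right[OF du, where G = "\<lambda>t. \<rho> * u t - B * \<bar>up t\<bar> - e"])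
    show "continuous_on {z..z + (\<beta> - z)} (\<lambda>t. \<rho> * u t - B * \<bar>up t\<bar> - e)"
      by (intro continuous_intros cu continuous_on_subset[OF cup]) auto
    show "\<rho> * u z - B * \<bar>up z\<bar> - e > 0" using uz \<rho> upz by (simp add: field_simps)
  qed (use zi ge in auto)
  then obtain \<delta> where "\<delta> > 0" "\<delta> \<le> \<beta> - z" "u z < u (z + \<delta>)" using upz by force
  moreover have "u (z + \<delta>) \<le> u z" using z zi calculation by auto
  ultimately show False by simp
qed

text \<open>At the first return to the level \<open>k\<close> the function comes down from above, so
  its derivative there cannot be positive. The premise \<open>up\<close> may use that the level was
  exceeded at all earlier points.\<close>

lemma stays_above:
  fixes f :: "real \<Rightarrow> real"
  assumes cont: "continuous_on {X..Y} f" and X: "f X > k"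
    and up: "\<And>x. X < x \<Longrightarrow> x \<le> Y \<Longrightarrow> f x = k \<Longrightarrow> (\<And>y. X \<le> y \<Longrightarrow> y < x \<Longrightarrow> f y > k) \<Longrightarrow>
      \<exists>D>0. (f has_real_derivative D) (at x)"
    and x: "X \<le> x" "x \<le> Y"
  shows "f x > k"
proof (rule ccontr)
  assume "\<not> f x > k"
  define A where "A = {y \<in> {X..x}. f y \<le> k}"
  have cx: "continuous_on {X..x} f" using cont by (rule continuous_on_subset) (use x in auto)
  have A: "x \<in> A" "bdd_below A" using \<open>\<not> f x > k\<close> x by (auto simp: A_def intro!: bdd_belowI[of _ X])
  have "closed A" unfolding A_def by (intro continuous_on_closed_Collect_le cx closed_atLeastAtMost continuous_on_const)
  then have "Inf A \<in> A" using A by (intro closed_contains_Inf) auto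
  define s where "s = Inf A"
  have s: "X \<le> s" "s \<le> x" "f s \<le> k" using \<open>Inf A \<in> A\<close> by (auto simp: A_def s_def)
  then have sX: "X < s" using X by (cases "s = X") auto
  have before: "f y > k" if "X \<le> y" "y < s" for y
    using cInf_lower[of y A] A that s unfolding s_def A_def by force
  have fs: "f s = k"
  proof (rule ccontr)
    assume "f s \<noteq> k"
    then have "f s < k" using s(3) by simp
    moreover obtain y where "X \<le> y" "y \<le> s" "f y = k"
      using IVT2'[of f s k X] s X continuous_on_subset[OF cx, of "{X..s}"] by auto
    ultimately show False using before[of y] by (cases "y = s") auto
  qed
  obtain D where D: "D > 0" "(f has_real_derivative D) (at s)" using up[OF sX _ fs before] s x by auto
  obtain d where d: "d > 0" "\<And>h. 0 < h \<Longrightarrow> h < d \<Longrightarrow> f (s - h) < f s"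
    using DERIV_pos_inc_left[OF D(2,1)] by blast
  define h where "h = min (d / 2) (s - X)"
  have "f (s - h) < f s" using d sX by (intro d(2)) (auto simp: h_def)
  moreover have "f (s - h) > k" using d sX by (intro before) (auto simp: h_def)
  ultimately show False using fs by simp
qed

section \<open>Gluing differentiable functions and taking primitives\<close>

lemma DERIV_glue:
  fixes f h :: "real \<Rightarrow> real"
  assumes f: "\<And>x. x \<le> z \<Longrightarrow> (f has_real_derivative f' x) (at x)"
    and h: "\<And>x. z \<le> x \<Longrightarrow> (h has_real_derivative h' x) (at x)"
    and eq: "f z = h z" "f' z = h' z"
  shows "((\<lambda>x. if x \<le> z then f x else h x) has_real_derivative (if x \<le> z then f' x else h' x)) (at x)"
proof -
  consider "x < z" | "x > z" | "x = z" by linarith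
  then show ?thesis
  proof cases
    case 1
    then have ev: "eventually (\<lambda>y. (if y \<le> z then f y else h y) = f y) (nhds x)"
      unfolding eventually_nhds by (intro exI[of _ "{..<z}"]) auto
    show ?thesis using 1 f[of x] by (simp add: DERIV_cong_ev[OF refl ev refl])
  next
    case 2
    then have ev: "eventually (\<lambda>y. (if y \<le> z then f y else h y) = h y) (nhds x)"
      unfolding eventually_nhds by (intro exI[of _ "{z<..}"]) auto
    show ?thesis using 2 h[of x] by (simp add: DERIV_cong_ev[OF refl ev refl])
  next
    case 3
    have f0: "((\<lambda>y. (f y - f z) / (y - z)) \<longlongrightarrow> f' z) (at_left z)"
      and h0: "((\<lambda>y. (h y - h z) / (y - z)) \<longlongrightarrow> h' z) (at_right z)"
      using f[of z] h[of z] unfolding has_field_derivative_iff filterlim_at_split by blast+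
    have e1: "\<forall>\<^sub>F y in at_left z. (f y - f z) / (y - z) = ((if y \<le> z then f y else h y) - f z) / (y - z)"
      unfolding eventually_at_filter by (intro always_eventually) auto
    have e2: "\<forall>\<^sub>F y in at_right z. (h y - h z) / (y - z) = ((if y \<le> z then f y else h y) - f z) / (y - z)"
      unfolding eventually_at_filter by (intro always_eventually) (auto simp: eq)
    have "((\<lambda>y. ((if y \<le> z then f y else h y) - f z) / (y - z)) \<longlongrightarrow> f' z) (at z)"
      unfolding filterlim_at_split eq(2)
      using Lim_transform_eventually[OF f0 e1] Lim_transform_eventually[OF h0 e2] unfolding eq(2) by blast
    then show ?thesis using 3 by (simp add: has_field_derivative_iff)
  qed
qed

lemma antiderivative_exists:
  fixes p :: "real \<Rightarrow> real"
  assumes p: "continuous_on UNIV p"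
  shows "\<exists>f. f 0 = 0 \<and> (\<forall>x. (f has_real_derivative p x) (at x))"
proof -
  \<comment> \<open>For either sign of \<open>x\<close> one of the two integrals is over an empty or
    one-point interval and vanishes.\<close>
  define f where "f x = integral {0..x} p - integral {x..0} p" for x
  have "(f has_real_derivative p x) (at x)" for x
  proof -
    define N where "N = \<bar>x\<bar> + 1"
    have io: "p integrable_on {u..v}" for u v by (intro integrable_continuous_real continuous_on_subset[OF p]) auto
    have "f y = integral {-N..y} p - integral {-N..0} p" if "y \<in> {-N<..<N}" for y
    proof (cases "0 \<le> y")
      case True
      have "integral {-N..0} p + integral {0..y} p = integral {-N..y} p"
        using True by (intro Henstock_Kurzweil_Integration.integral_combine io) (auto simp: N_def)
      moreover have "integral {y..0} p = 0" using True by (cases "y = 0") auto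
      ultimately show ?thesis by (simp add: f_def)
    next
      case False
      have "integral {-N..y} p + integral {y..0} p = integral {-N..0} p"
        using False that by (intro Henstock_Kurzweil_Integration.integral_combine io) auto
      then show ?thesis using False by (simp add: f_def)
    qed
    then have ev: "eventually (\<lambda>y. f y = integral {-N..y} p - integral {-N..0} p) (nhds x)"
      unfolding eventually_nhds by (intro exI[of _ "{-N<..<N}"]) (auto simp: N_def)
    have "((\<lambda>y. integral {-N..y} p) has_real_derivative p x) (at x within {-N..N})"
      by (intro integral_has_real_derivative continuous_on_subset[OF p]) (auto simp: N_def)
    then have "((\<lambda>y. integral {-N..y} p) has_real_derivative p x) (at x)"
      by (simp add: at_within_Icc_at N_def)
    then have "((\<lambda>y. integral {-N..y} p - integral {-N..0} p) has_real_derivative p x - 0) (at x)"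
      by (intro DERIV_diff DERIV_const)
    then show ?thesis by (simp add: DERIV_cong_ev[OF refl ev refl])
  qed
  then show ?thesis by (intro exI[of _ f]) (auto simp: f_def)
qed

lemma C1_integral:
  fixes f p :: "real \<Rightarrow> real"
  assumes "\<And>x. (f has_real_derivative p x) (at x)" "x \<le> y"
  shows "(p has_integral (f y - f x)) {x..y}"
  using assms by (intro fundamental_theorem_of_calculus)
    (auto intro: has_field_derivative_at_within simp flip: has_real_derivative_iff_has_vector_derivative)

section \<open>Weak derivatives\<close>

lemma DERIV_eventually_eq:
  "(f has_real_derivative D) (at x) \<Longrightarrow> eventually (\<lambda>y. g y = f y) (nhds x) \<Longrightarrow> (g has_real_derivative D) (at x)"
  by (simp add: DERIV_cong_ev[OF refl _ refl])

text \<open>A measurable choice of the derivative is the limit of difference quotients along the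
  steps \<open>1 / Suc n\<close>. Clamping it to \<open>[-K, K]\<close> gives the bound at every
  point, including those where the limit does not exist.\<close>

lemma lipschitz_AE_derivative:
  fixes f :: "real \<Rightarrow> real"
  assumes lip: "K-lipschitz_on UNIV f"
  obtains q where "q \<in> borel_measurable borel" "\<And>x. \<bar>q x\<bar> \<le> K"
    "AE x in lborel. (f has_real_derivative q x) (at x)"
proof -
  have K0: "K \<ge> 0" using lip by (rule lipschitz_on_nonneg)
  have fb: "\<bar>f y - f x\<bar> \<le> K * \<bar>y - x\<bar>" for x y using lipschitz_onD[OF lip] by (auto simp: dist_real_def)
  have cf: "continuous_on UNIV f" using lip by (rule lipschitz_on_continuous_on)
  have mf[measurable]: "f \<in> borel_measurable borel" using cf by (rule borel_measurable_continuous_onI)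
  define h where "h n = 1 / real (Suc n)" for n
  have h: "h n > 0" for n by (simp add: h_def)
  have h0: "h \<longlonglongrightarrow> 0" unfolding h_def by (rule LIMSEQ_Suc[OF lim_1_over_n])
  define D where "D n x = (f (x + h n) - f x) / h n" for n x
  define q where "q x = max (- K) (min K (lim (\<lambda>n. D n x)))" for x
  have D: "(\<lambda>n. D n x) \<longlonglongrightarrow> d" if "(f has_real_derivative d) (at x)" for x d
  proof -
    have "((\<lambda>y. (f (x + y) - f x) / y) \<longlongrightarrow> d) (at 0)" using that by (simp add: DERIV_def)
    then show ?thesis unfolding D_def
      by (rule filterlim_compose) (use h0 h in \<open>auto simp: filterlim_at less_imp_neq[THEN not_sym]\<close>)
  qed
  have Dle: "\<bar>D n x\<bar> \<le> K" for n x using fb[of "x + h n" x] h[of n] by (simp add: D_def field_simps)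
  show ?thesis
  proof
    have "(\<lambda>x. D n x) \<in> borel_measurable borel" for n unfolding D_def by measurable
    then have "(\<lambda>x. lim (\<lambda>n. D n x)) \<in> borel_measurable borel" by (rule borel_measurable_lim_metric)
    then show "q \<in> borel_measurable borel" unfolding q_def by measurable
    show "\<bar>q x\<bar> \<le> K" for x using K0 by (auto simp: q_def)
    show "AE x in lborel. (f has_real_derivative q x) (at x)"
      using lipschitz_differentiable_AE[OF lip]
    proof (rule AE_mp, intro AE_I2 impI)
      fix x assume "\<exists>D. (f has_real_derivative D) (at x)"
      then obtain d where d: "(f has_real_derivative d) (at x)" by blast
      have "\<bar>d\<bar> \<le> K" by (rule tendsto_upperbound[OF tendsto_rabs[OF D[OF d]]]) (auto intro: always_eventually Dle)
      then have "q x = d" using limI[OF D[OF d]] by (auto simp: q_def)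
      with d show "(f has_real_derivative q x) (at x)" by simp
    qed
  qed
qed

text \<open>Translation invariance moves the increment of the difference quotient from
  \<open>f\<close> to \<open>\<phi>\<close>. Dominated convergence applies on both sides, the
  Lipschitz constant of \<open>f\<close> and the bound of \<open>\<phi>'\<close> supplying the
  majorants.\<close>

lemma integral_by_parts_lipschitz:
  fixes f q \<phi> \<phi>' :: "real \<Rightarrow> real"
  assumes lip: "K-lipschitz_on UNIV f" and q: "q \<in> borel_measurable borel" "\<And>x. \<bar>q x\<bar> \<le> M"
    and fq: "AE x in lborel. (f has_real_derivative q x) (at x)"
    and d\<phi>: "\<And>x. (\<phi> has_real_derivative \<phi>' x) (at x)" and c\<phi>: "continuous_on UNIV \<phi>'"
    and supp: "\<And>x. x \<notin> {a..b} \<Longrightarrow> \<phi> x = 0"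
  shows "(LINT x|lborel. f x * \<phi>' x) = - (LINT x|lborel. q x * \<phi> x)"
proof -
  have K0: "K \<ge> 0" using lip by (rule lipschitz_on_nonneg)
  have fb: "\<bar>f y - f x\<bar> \<le> K * \<bar>y - x\<bar>" for x y using lipschitz_onD[OF lip] by (auto simp: dist_real_def)
  have cf: "continuous_on UNIV f" using lip by (rule lipschitz_on_continuous_on)
  have cphi: "continuous_on UNIV \<phi>" using d\<phi> by (meson DERIV_isCont continuous_at_imp_continuous_on)
  have [measurable]: "f \<in> borel_measurable borel" "\<phi> \<in> borel_measurable borel" "\<phi>' \<in> borel_measurable borel"
    using cf cphi c\<phi> by (auto intro: borel_measurable_continuous_onI)
  note q(1)[measurable]
  define h where "h n = 1 / real (Suc n)" for n
  have h: "h n > 0" "h n \<noteq> 0" "h n \<le> 1" for n by (auto simp: h_def)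
  have h0: "h \<longlonglongrightarrow> 0" unfolding h_def by (rule LIMSEQ_Suc[OF lim_1_over_n])
  have supp': "\<phi>' x = 0" if "x \<notin> {a..b}" for x
  proof (rule DERIV_unique[OF d\<phi>])
    have "open (- {a..b})" by (intro open_Compl closed_atLeastAtMost)
    with that have "eventually (\<lambda>y. \<phi> y = 0) (nhds x)"
      unfolding eventually_nhds using supp by (intro exI[of _ "- {a..b}"]) auto
    then show "(\<phi> has_real_derivative 0) (at x)" using DERIV_cong_ev[of x x \<phi> "\<lambda>_. 0" 0 0] by auto
  qed
  obtain C where C: "\<And>x. x \<in> {a..b} \<Longrightarrow> \<bar>\<phi>' x\<bar> \<le> C"
    using compact_imp_bounded[OF compact_continuous_image[OF continuous_on_subset[OF c\<phi>] compact_Icc], of a b]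
    unfolding bounded_iff by fastforce
  define C' where "C' = max C 0"
  have C': "\<bar>\<phi>' x\<bar> \<le> C'" "0 \<le> C'" for x using C[of x] supp'[of x] by (cases "x \<in> {a..b}") (auto simp: C'_def)
  have int: "integrable lborel w" if "continuous_on UNIV w" "\<And>x. x \<notin> {c..d} \<Longrightarrow> w x = 0" for w :: "real \<Rightarrow> real" and c d
  proof -
    have "integrable lborel (\<lambda>x. indicator {c..d} x *\<^sub>R w x)"
      by (intro borel_integrable_compact continuous_on_subset[OF that(1)]) auto
    also have "(\<lambda>x. indicator {c..d} x *\<^sub>R w x) = w" using that(2) by (intro ext) (auto simp: indicator_def)
    finally show ?thesis .
  qed
  have shift: "\<phi> (x - h n) = 0" if "x \<notin> {a..b+1}" for x n using that h[of n] by (intro supp) auto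
  have A: "(\<lambda>n. LINT x|lborel. (f (x + h n) - f x) / h n * \<phi> x) \<longlonglongrightarrow> (LINT x|lborel. q x * \<phi> x)"
  proof (rule integral_dominated_convergence)
    show "integrable lborel (\<lambda>x. K * \<bar>\<phi> x\<bar>)"
      by (rule int[of _ a b]) (auto intro!: continuous_intros cphi simp: supp)
    show "AE x in lborel. (\<lambda>n. (f (x + h n) - f x) / h n * \<phi> x) \<longlonglongrightarrow> q x * \<phi> x"
      using fq
    proof (rule AE_mp, intro AE_I2 impI)
      fix x assume "(f has_real_derivative q x) (at x)"
      then have "((\<lambda>y. (f (x + y) - f x) / y) \<longlongrightarrow> q x) (at 0)" by (simp add: DERIV_def)
      then have "(\<lambda>n. (f (x + h n) - f x) / h n) \<longlonglongrightarrow> q x"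
        by (rule filterlim_compose) (use h0 h in \<open>auto simp: filterlim_at\<close>)
      then show "(\<lambda>n. (f (x + h n) - f x) / h n * \<phi> x) \<longlonglongrightarrow> q x * \<phi> x" by (intro tendsto_intros)
    qed
    show "AE x in lborel. norm ((f (x + h n) - f x) / h n * \<phi> x) \<le> K * \<bar>\<phi> x\<bar>" for n
    proof (intro AE_I2)
      fix x
      have "\<bar>(f (x + h n) - f x) / h n\<bar> \<le> K" using fb[of "x + h n" x] h[of n] by (simp add: field_simps)
      then show "norm ((f (x + h n) - f x) / h n * \<phi> x) \<le> K * \<bar>\<phi> x\<bar>"
        unfolding real_norm_def abs_mult by (intro mult_right_mono) auto
    qed
  qed measurable
  have B: "(\<lambda>n. LINT x|lborel. f x * ((\<phi> (x - h n) - \<phi> x) / h n)) \<longlonglongrightarrow> (LINT x|lborel. f x * (- \<phi>' x))"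
  proof (rule integral_dominated_convergence)
    show "integrable lborel (\<lambda>x. indicator {a..b+1} x *\<^sub>R (\<bar>f x\<bar> * C'))"
      by (intro borel_integrable_compact continuous_intros continuous_on_subset[OF cf]) auto
    show "AE x in lborel. (\<lambda>n. f x * ((\<phi> (x - h n) - \<phi> x) / h n)) \<longlonglongrightarrow> f x * (- \<phi>' x)"
    proof (intro AE_I2 tendsto_intros)
      fix x
      have "((\<lambda>y. (\<phi> (x + y) - \<phi> x) / y) \<longlongrightarrow> \<phi>' x) (at 0)" using d\<phi>[of x] by (simp add: DERIV_def)
      then have "(\<lambda>n. (\<phi> (x + - h n) - \<phi> x) / - h n) \<longlonglongrightarrow> \<phi>' x"
        by (rule filterlim_compose) (use tendsto_minus[OF h0] h in \<open>auto simp: filterlim_at\<close>)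
      from tendsto_minus[OF this] show "(\<lambda>n. (\<phi> (x - h n) - \<phi> x) / h n) \<longlonglongrightarrow> - \<phi>' x" by simp
    qed
    show "AE x in lborel. norm (f x * ((\<phi> (x - h n) - \<phi> x) / h n)) \<le> indicator {a..b+1} x *\<^sub>R (\<bar>f x\<bar> * C')" for n
    proof (intro AE_I2)
      fix x
      show "norm (f x * ((\<phi> (x - h n) - \<phi> x) / h n)) \<le> indicator {a..b+1} x *\<^sub>R (\<bar>f x\<bar> * C')"
      proof (cases "x \<in> {a..b+1}")
        case True
        obtain z where "\<phi> x - \<phi> (x - h n) = (x - (x - h n)) * \<phi>' z"
          using MVT2[of "x - h n" x \<phi> \<phi>'] d\<phi> h[of n] by auto
        then have "\<phi> (x - h n) - \<phi> x = - (h n * \<phi>' z)" by simp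
        then have "\<bar>(\<phi> (x - h n) - \<phi> x) / h n\<bar> \<le> C'" using h[of n] C'(1)[of z] by simp
          then have "\<bar>f x\<bar> * \<bar>(\<phi> (x - h n) - \<phi> x) / h n\<bar> \<le> \<bar>f x\<bar> * C'" by (intro mult_left_mono) auto
        then show ?thesis using True unfolding real_norm_def abs_mult by simp
      next
        case False
        then have "\<phi> (x - h n) = 0" "\<phi> x = 0" using shift[of x n] supp[of x] by auto
        then show ?thesis using False by simp
      qed
    qed
  qed measurable
  have eq: "(LINT x|lborel. (f (x + h n) - f x) / h n * \<phi> x) = (LINT x|lborel. f x * ((\<phi> (x - h n) - \<phi> x) / h n))" for n
  proof -
    have i1: "integrable lborel (\<lambda>x. f (x + h n) * \<phi> x)"
      by (rule int[of _ a b]) (auto intro!: continuous_intros continuous_on_compose2[OF cf] cphi simp: supp)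
    have i2: "integrable lborel (\<lambda>x. f x * \<phi> x)"
      by (rule int[of _ a b]) (auto intro!: continuous_intros cf cphi simp: supp)
    have i3: "integrable lborel (\<lambda>x. f x * \<phi> (x - h n))"
      by (rule int[of _ a "b+1"]) (auto intro!: continuous_intros continuous_on_compose2[OF cphi] cf simp: shift)
    have tr: "(LINT x|lborel. f x * \<phi> (x - h n)) = (LINT x|lborel. f (x + h n) * \<phi> x)"
      by (subst lborel_integral_real_affine[of 1 _ "h n"]) (auto simp: add.commute)
    have "(LINT x|lborel. (f (x + h n) - f x) / h n * \<phi> x) = (LINT x|lborel. (f (x + h n) * \<phi> x - f x * \<phi> x) / h n)"
      by (intro Bochner_Integration.integral_cong) (auto simp: algebra_simps diff_divide_distrib)
    also have "\<dots> = ((LINT x|lborel. f x * \<phi> (x - h n)) - (LINT x|lborel. f x * \<phi> x)) / h n"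
      using i1 i2 tr by simp
    also have "\<dots> = (LINT x|lborel. (f x * \<phi> (x - h n) - f x * \<phi> x) / h n)"
      using i3 i2 by simp
    also have "\<dots> = (LINT x|lborel. f x * ((\<phi> (x - h n) - \<phi> x) / h n))"
      by (intro Bochner_Integration.integral_cong) (auto simp: algebra_simps diff_divide_distrib)
    finally show ?thesis .
  qed
  have "(LINT x|lborel. q x * \<phi> x) = (LINT x|lborel. f x * (- \<phi>' x))"
    using LIMSEQ_unique[OF A] B unfolding eq by blast
  then show ?thesis by simp
qed

lemma test_funD:
  assumes "test_fun \<phi>"
  shows "\<exists>a b. 0 < a \<and> a \<le> b \<and> (\<forall>x. x \<notin> {a..b} \<longrightarrow> \<phi> x = 0)"
    and "(\<phi> has_real_derivative deriv \<phi> x) (at x)" and "continuous_on S (deriv \<phi>)"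
proof -
  show "\<exists>a b. 0 < a \<and> a \<le> b \<and> (\<forall>x. x \<notin> {a..b} \<longrightarrow> \<phi> x = 0)" using assms unfolding test_fun_def by blast
  have d: "((deriv ^^ k) \<phi>) differentiable (at x)" for k x using assms unfolding test_fun_def by blast
  show "(\<phi> has_real_derivative deriv \<phi> x) (at x)" using d[of 0] by (simp add: DERIV_deriv_iff_real_differentiable)
  have "deriv \<phi> differentiable (at x)" for x using d[of 1] by simp
  then show "continuous_on S (deriv \<phi>)"
    by (intro continuous_at_imp_continuous_on ballI differentiable_imp_continuous_within)
qed

lemma loc_int_bounded:
  assumes "q \<in> borel_measurable borel" "\<And>x. \<bar>q x\<bar> \<le> M"
  shows "loc_int q"
  unfolding loc_int_def set_integrable_def
  using assms by (intro allI integrableI_bounded_set_indicator[where B = M]) (auto simp: emeasure_lborel_Icc_eq)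

lemma loc_int_continuous:
  assumes "continuous_on {0..} f"
  shows "loc_int f"
  unfolding loc_int_def set_integrable_def
  by (intro allI borel_integrable_compact continuous_on_subset[OF assms]) auto

text \<open>Test functions vanish to the left of some \<open>a > 0\<close>, so the integrals over
  the half-line are integrals over the whole line.\<close>

lemma weak_deriv_lipschitz:
  assumes lip: "K-lipschitz_on UNIV f" and q: "q \<in> borel_measurable borel" "\<And>x. \<bar>q x\<bar> \<le> M"
    and fq: "AE x in lborel. (f has_real_derivative q x) (at x)"
  shows "weak_deriv f q"
  unfolding weak_deriv_def
proof (intro conjI allI impI)
  show "loc_int f" using lip by (intro loc_int_continuous) (auto intro: lipschitz_on_continuous_on lipschitz_on_subset)
  show "loc_int q" using q by (rule loc_int_bounded)
  fix \<phi> assume t: "test_fun \<phi>"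
  note d = test_funD(2,3)[OF t]
  obtain a b where ab: "0 < a" "a \<le> b" "\<And>x. x \<notin> {a..b} \<Longrightarrow> \<phi> x = 0" using test_funD(1)[OF t] by blast
  have z: "deriv \<phi> x = 0" if "x \<le> 0" for x
  proof (rule DERIV_unique[OF d(1)])
    have "eventually (\<lambda>y. \<phi> y = 0) (nhds x)"
      unfolding eventually_nhds using ab that by (intro exI[of _ "{..<a}"]) auto
    then show "(\<phi> has_real_derivative 0) (at x)" using DERIV_cong_ev[of x x \<phi> "\<lambda>_. 0" 0 0] by auto
  qed
  have "(LINT x:{0<..}|lborel. f x * deriv \<phi> x) = (LINT x|lborel. f x * deriv \<phi> x)"
    unfolding set_lebesgue_integral_def using z
    by (intro Bochner_Integration.integral_cong) (auto simp: indicator_def not_less)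
  moreover have "(LINT x:{0<..}|lborel. q x * \<phi> x) = (LINT x|lborel. q x * \<phi> x)"
    unfolding set_lebesgue_integral_def using ab
    by (intro Bochner_Integration.integral_cong) (auto simp: indicator_def not_less)
  ultimately show "(LINT x:{0<..}|lborel. f x * deriv \<phi> x) = - (LINT x:{0<..}|lborel. q x * \<phi> x)"
    using integral_by_parts_lipschitz[OF lip q fq d ab(3)] by simp
qed

section \<open>Smooth bumps approximating intervals\<close>

primrec smooth_upto :: "nat \<Rightarrow> (real \<Rightarrow> real) \<Rightarrow> bool" where
  "smooth_upto 0 f = True"
| "smooth_upto (Suc n) f = (\<exists>f'. (\<forall>x. (f has_real_derivative f' x) (at x)) \<and> smooth_upto n f')"

lemma smooth_upto_SucI:
  "(\<And>x. (f has_real_derivative f' x) (at x)) \<Longrightarrow> smooth_upto n f' \<Longrightarrow> smooth_upto (Suc n) f"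
  by auto

lemma smooth_upto_pred: "smooth_upto (Suc n) f \<Longrightarrow> smooth_upto n f"
proof (induction n arbitrary: f)
  case (Suc n)
  from Suc.prems obtain f' where "\<forall>x. (f has_real_derivative f' x) (at x)" "smooth_upto (Suc n) f'"
    unfolding smooth_upto.simps(2)[of "Suc n"] by blast
  with Suc.IH[of f'] show ?case by auto
qed simp

text \<open>The link to \<open>test_fun\<close>. Carrying a witness for every derivative lets sums,
  products and affine substitutions be handled by induction on the order before the passage to
  iterated \<open>deriv\<close>.\<close>

lemma smooth_upto_deriv_funpow:
  "smooth_upto (Suc k) f \<Longrightarrow> ((deriv ^^ k) f) differentiable (at x)"
proof (induction k arbitrary: f)
  case 0 then show ?case by (auto simp: real_differentiable_def)
next
  case (Suc k)
  from Suc.prems obtain f' where f': "\<forall>x. (f has_real_derivative f' x) (at x)" "smooth_upto (Suc k) f'"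
    unfolding smooth_upto.simps(2)[of "Suc k"] by blast
  have "deriv f = f'" using f'(1) by (auto intro: DERIV_imp_deriv)
  with Suc.IH[OF f'(2)] show ?case by (simp add: funpow_swap1)
qed

lemma smooth_upto_const [simp]: "smooth_upto n (\<lambda>_. c)"
  by (induction n arbitrary: c) (auto intro!: exI[of _ "\<lambda>_. 0"])

lemma smooth_upto_add: "smooth_upto n f \<Longrightarrow> smooth_upto n g \<Longrightarrow> smooth_upto n (\<lambda>x. f x + g x)"
proof (induction n arbitrary: f g)
  case (Suc n)
  then obtain f' g' where "\<forall>x. (f has_real_derivative f' x) (at x)" "smooth_upto n f'"
    "\<forall>x. (g has_real_derivative g' x) (at x)" "smooth_upto n g'" by auto
  with Suc.IH[of f' g'] show ?case by (auto intro!: exI[of _ "\<lambda>x. f' x + g' x"] derivative_intros)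
qed simp

lemma smooth_upto_mult: "smooth_upto n f \<Longrightarrow> smooth_upto n g \<Longrightarrow> smooth_upto n (\<lambda>x. f x * g x)"
proof (induction n arbitrary: f g)
  case (Suc n)
  then obtain f' g' where 1: "\<forall>x. (f has_real_derivative f' x) (at x)" "smooth_upto n f'"
    "\<forall>x. (g has_real_derivative g' x) (at x)" "smooth_upto n g'" by auto
  have "smooth_upto n f" "smooth_upto n g" using Suc.prems smooth_upto_pred by blast+
  then have "smooth_upto n (\<lambda>x. f' x * g x + f x * g' x)" using 1 Suc.IH by (intro smooth_upto_add) auto
  moreover have "((\<lambda>x. f x * g x) has_real_derivative f' x * g x + f x * g' x) (at x)" for x
    using 1 by (auto intro!: derivative_eq_intros)
  ultimately show ?case by (intro smooth_upto_SucI)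
qed simp

lemma smooth_upto_affine: "smooth_upto n f \<Longrightarrow> smooth_upto n (\<lambda>x. f (c * x + d))"
proof (induction n arbitrary: f)
  case (Suc n)
  then obtain f' where 1: "\<forall>x. (f has_real_derivative f' x) (at x)" "smooth_upto n f'" by auto
  have "smooth_upto n (\<lambda>x. c * f' (c * x + d))" using Suc.IH[OF 1(2)] by (intro smooth_upto_mult) auto
  moreover have "((\<lambda>x. f (c * x + d)) has_real_derivative c * f' (c * x + d)) (at x)" for x
    by (rule DERIV_cong[OF DERIV_chain'[where g = f and f = "\<lambda>x. c * x + d" and D = c]])
      (use 1 in \<open>auto intro!: derivative_eq_intros simp: mult.commute\<close>)
  ultimately show ?case by (intro smooth_upto_SucI)
qed simp

text \<open>The classical flat function \<open>exp (- 1 / t)\<close>, with powers of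
  \<open>1 / t\<close> as factors so that derivatives are linear combinations of members of the
  family.\<close>

definition exp_inv :: "nat \<Rightarrow> real \<Rightarrow> real" where
  "exp_inv k t = (if t > 0 then (1 / t) ^ k * exp (- (1 / t)) else 0)"

lemma exp_inv_deriv:
  "(exp_inv k has_real_derivative exp_inv (k + 2) t + - real k * exp_inv (k + 1) t) (at t)"
proof -
  consider "t > 0" | "t < 0" | "t = 0" by linarith
  then show ?thesis
  proof cases
    case 1
    have "((\<lambda>t. (1 / t) ^ k * exp (- (1 / t))) has_real_derivative exp_inv (k + 2) t + - real k * exp_inv (k + 1) t) (at t)"
    proof -
      have A: "((\<lambda>t. 1 / t) has_real_derivative - ((1 / t)\<^sup>2)) (at t)"
        using 1 by (auto intro!: derivative_eq_intros simp: power2_eq_square)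
      have B: "((\<lambda>s. s ^ k * exp (- s)) has_real_derivative
          real k * s ^ (k - 1) * exp (- s) - s ^ k * exp (- s)) (at s)" for s :: real
        by (auto intro!: derivative_eq_intros)
      have "((\<lambda>t. (1 / t) ^ k * exp (- (1 / t))) has_real_derivative
          (real k * (1 / t) ^ (k - 1) * exp (- (1 / t)) - (1 / t) ^ k * exp (- (1 / t))) * - ((1 / t)\<^sup>2)) (at t)"
        by (rule DERIV_chain'[OF A B[of "1 / t"]])
      moreover have "(real k * s ^ (k - 1) * e - s ^ k * e) * - (s\<^sup>2) = s ^ (k + 2) * e + - real k * (s ^ (k + 1) * e)"
        for s e :: real by (cases k) (simp_all add: power2_eq_square algebra_simps)
      ultimately show ?thesis using 1 unfolding exp_inv_def by (simp only: if_True)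
    qed
    moreover have "eventually (\<lambda>s. exp_inv k s = (1 / s) ^ k * exp (- (1 / s))) (nhds t)"
      using 1 unfolding eventually_nhds by (intro exI[of _ "{0<..}"]) (auto simp: exp_inv_def)
    ultimately show ?thesis by (rule DERIV_eventually_eq)
  next
    case 2
    then have "eventually (\<lambda>s. exp_inv k s = 0) (nhds t)"
      unfolding eventually_nhds by (intro exI[of _ "{..<0}"]) (auto simp: exp_inv_def)
    then have "(exp_inv k has_real_derivative 0) (at t)" using DERIV_cong_ev[of t t "exp_inv k" "\<lambda>_. 0" 0 0] by auto
    then show ?thesis using 2 by (simp add: exp_inv_def)
  next
    case 3
    have r: "((\<lambda>h. (1 / h) ^ (k + 1) * exp (- (1 / h))) \<longlongrightarrow> 0) (at_right (0::real))"
    proof -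
      have "((\<lambda>h. inverse h ^ (k + 1) / exp (inverse h)) \<longlongrightarrow> 0) (at_right (0::real))"
        by (rule filterlim_compose[OF tendsto_power_div_exp_0 filterlim_inverse_at_top_right])
      then show ?thesis by (simp add: exp_minus field_simps)
    qed
    have "((\<lambda>h. exp_inv k h / h) \<longlongrightarrow> 0) (at_right 0)"
      by (rule Lim_transform_eventually[OF r]) (auto simp: eventually_at_filter exp_inv_def)
    moreover have "((\<lambda>h. exp_inv k h / h) \<longlongrightarrow> 0) (at_left 0)"
      by (rule Lim_transform_eventually[OF tendsto_const]) (auto simp: eventually_at_filter exp_inv_def)
    ultimately have "((\<lambda>h. exp_inv k h / h) \<longlongrightarrow> 0) (at 0)" by (simp add: filterlim_split_at)
    then have "(exp_inv k has_real_derivative 0) (at 0)" by (simp add: DERIV_def exp_inv_def)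
    then show ?thesis using 3 by (simp add: exp_inv_def)
  qed
qed

lemma smooth_upto_exp_inv: "smooth_upto n (exp_inv k)"
proof (induction n arbitrary: k)
  case (Suc n)
  have "smooth_upto n (\<lambda>t. exp_inv (k + 2) t + - real k * exp_inv (k + 1) t)"
    by (intro smooth_upto_add smooth_upto_mult Suc.IH smooth_upto_const)
  then show ?case by (rule smooth_upto_SucI[OF exp_inv_deriv])
qed simp

text \<open>A smooth approximation from below of the indicator of \<open>(s, t)\<close>. The margin
  \<open>1 / n\<close> at both ends keeps the support away from 0 even for \<open>s = 0\<close>, as
  \<open>test_fun\<close> demands.\<close>

definition bump :: "real \<Rightarrow> real \<Rightarrow> nat \<Rightarrow> real \<Rightarrow> real" where
  "bump s t n x = exp_inv 0 (real n * x + (- real n * s - 1)) * exp_inv 0 (- real n * x + (real n * t - 1))"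

lemma smooth_upto_bump: "smooth_upto k (bump s t n)"
  unfolding bump_def by (intro smooth_upto_mult smooth_upto_affine smooth_upto_exp_inv)

lemma continuous_on_bump: "continuous_on S (bump s t n)"
proof -
  obtain f' where "\<And>x. (bump s t n has_real_derivative f' x) (at x)"
    using smooth_upto_bump[of "Suc 0" s t n] by auto
  then show ?thesis by (meson DERIV_isCont continuous_at_imp_continuous_on)
qed

lemma bump_bounds: "0 \<le> bump s t n x" "bump s t n x \<le> 1"
  unfolding bump_def exp_inv_def by (auto intro!: mult_le_one)

lemma bump_support:
  assumes "n > 0" "bump s t n x \<noteq> 0"
  shows "s + 1 / real n < x" "x < t - 1 / real n"
  using assms unfolding bump_def exp_inv_def by (auto simp: field_simps split: if_splits)

lemma bump_LIMSEQ: "(\<lambda>n. bump s t n x) \<longlonglongrightarrow> indicator {s<..<t} x"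
proof (cases "s < x \<and> x < t")
  case True
  have E: "(\<lambda>n. exp_inv 0 (real n * d - 1)) \<longlonglongrightarrow> 1" if "d > 0" for d
  proof -
    have 1: "filterlim (\<lambda>n. real n * d - 1) at_top sequentially"
      using filterlim_tendsto_pos_mult_at_top[OF tendsto_const[of d] that filterlim_real_sequentially]
      by (intro filterlim_tendsto_add_at_top[OF tendsto_const[of "-1"], simplified]) (simp add: mult.commute)
    then have "(\<lambda>n. inverse (real n * d - 1)) \<longlonglongrightarrow> 0" by (rule tendsto_inverse_0_at_top)
    then have "(\<lambda>n. exp (- inverse (real n * d - 1))) \<longlonglongrightarrow> exp (- 0)" by (intro tendsto_intros)
    then have 2: "(\<lambda>n. exp (- inverse (real n * d - 1))) \<longlonglongrightarrow> 1" by simp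
    show ?thesis
    proof (rule Lim_transform_eventually[OF 2])
      show "\<forall>\<^sub>F n in sequentially. exp (- inverse (real n * d - 1)) = exp_inv 0 (real n * d - 1)"
        using filterlim_at_top_dense[THEN iffD1, OF 1, rule_format, of 0]
        by (auto elim!: eventually_mono simp: exp_inv_def inverse_eq_divide)
    qed
  qed
  have "(\<lambda>n. exp_inv 0 (real n * (x - s) - 1) * exp_inv 0 (real n * (t - x) - 1)) \<longlonglongrightarrow> 1 * 1"
    using True by (intro tendsto_mult E) auto
  then show ?thesis using True by (simp add: bump_def algebra_simps)
next
  case False
  have "bump s t n x = 0" for n
  proof (cases "n = 0")
    case True then show ?thesis by (simp add: bump_def exp_inv_def)
  next
    case n: False
    then have "0 < 1 / real n" by simp
    then show ?thesis using bump_support[of n s t x] n False by (smt (verit) not_gr_zero)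
  qed
  then show ?thesis using False by auto
qed

lemma test_funI:
  assumes d: "\<And>x. (\<phi> has_real_derivative \<eta> x) (at x)" and sm: "\<And>n. smooth_upto n \<eta>"
    and "0 < a" "a \<le> b" "\<And>x. x \<notin> {a..b} \<Longrightarrow> \<phi> x = 0"
  shows "test_fun \<phi>"
  unfolding test_fun_def
proof (intro conjI allI)
  fix k x
  have "smooth_upto (Suc k) \<phi>" by (rule smooth_upto_SucI[OF d sm])
  then show "((deriv ^^ k) \<phi>) differentiable (at x)" by (rule smooth_upto_deriv_funpow)
qed (use assms in blast)

section \<open>From weak derivatives back to primitives\<close>

lemma loc_int_integrable:
  assumes "loc_int g"
  shows "integrable lborel (\<lambda>x. indicator {0..N::real} x * g x)"
  using assms unfolding loc_int_def set_integrable_def by simp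

lemma continuous_on_loc_integral:
  assumes "loc_int g"
  shows "continuous_on {0..} (\<lambda>x. LINT t:{0..x}|lborel. g t)"
proof (rule continuous_on_eq_continuous_within[THEN iffD2], rule ballI)
  fix x :: real assume x: "x \<in> {0..}"
  have i: "set_integrable lborel {0..y} g" for y :: real using assms unfolding loc_int_def by blast
  have eq: "(LINT t:{0..y}|lborel. g t) = integral {0..y} g" for y using set_borel_integral_eq_integral[OF i] by blast
  have "continuous_on {0..x+1} (\<lambda>y. integral {0..y} g)"
    using set_borel_integral_eq_integral(1)[OF i] by (intro indefinite_integral_continuous_1)
  then have "continuous (at x within {0..x+1}) (\<lambda>y. LINT t:{0..y}|lborel. g t)"
    using x unfolding eq by (simp add: continuous_on_eq_continuous_within)
  moreover have "at x within {0..x+1} = at x within {0..}"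
    using x by (intro at_within_nhd[of _ "{..<x+1}"]) auto
  ultimately show "continuous (at x within {0..}) (\<lambda>y. LINT t:{0..y}|lborel. g t)" by simp
qed

text \<open>Fubini on the triangle \<open>0 \<le> t \<le> x \<le> N\<close>: integrating
  \<open>\<phi>'\<close> over \<open>[t, N]\<close> leaves \<open>- \<phi> t\<close>. No regularity
  of \<open>g\<close> beyond integrability enters.\<close>

lemma integral_by_parts_primitive:
  fixes g \<phi> \<phi>' :: "real \<Rightarrow> real"
  assumes g: "loc_int g" and d: "\<And>x. (\<phi> has_real_derivative \<phi>' x) (at x)" and c: "continuous_on UNIV \<phi>'"
    and N: "0 \<le> N" and z: "\<And>x. N \<le> x \<Longrightarrow> \<phi> x = 0"
  shows "(LINT x:{0..N}|lborel. (LINT t:{0..x}|lborel. g t) * \<phi>' x) = - (LINT x:{0..N}|lborel. g x * \<phi> x)"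
proof -
  define g' where "g' t = indicator {0..N} t * g t" for t
  have ig: "integrable lborel g'" unfolding g'_def by (rule loc_int_integrable[OF g])
  then have [measurable]: "g' \<in> borel_measurable borel" by (auto dest: borel_measurable_integrable)
  define \<psi> where "\<psi> x = indicator {0..N} x * \<phi>' x" for x
  have ip: "integrable lborel \<psi>"
    using borel_integrable_compact[of "{0..N}" \<phi>'] continuous_on_subset[OF c] unfolding \<psi>_def by auto
  then have [measurable]: "\<psi> \<in> borel_measurable borel" by (auto dest: borel_measurable_integrable)
  define h where "h = (\<lambda>(x, t). indicator {0..x} t * (\<psi> x * g' t))"
  have hm[measurable]: "h \<in> borel_measurable (lborel \<Otimes>\<^sub>M lborel)"
  proof -
    have "h = (\<lambda>z. (if 0 \<le> snd z \<and> snd z \<le> fst z then 1 else 0) * (\<psi> (fst z) * g' (snd z)))"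
      unfolding h_def by (auto simp: indicator_def fun_eq_iff)
    also have "\<dots> \<in> borel_measurable (lborel \<Otimes>\<^sub>M lborel)" by measurable
    finally show ?thesis .
  qed
  have i2: "integrable lborel (\<lambda>t. h (x, t))" for x
    by (rule Bochner_Integration.integrable_bound[OF integrable_mult_right[OF ig, of "\<psi> x"]])
      (auto simp: h_def indicator_def)
  have "integrable (lborel \<Otimes>\<^sub>M lborel) h"
  proof (rule lborel_pair.Fubini_integrable[OF hm])
    show "integrable lborel (\<lambda>x. LINT t|lborel. norm (h (x, t)))"
    proof (rule Bochner_Integration.integrable_bound[OF integrable_mult_left[OF ip, of "LINT t|lborel. norm (g' t)"]])
      show "AE x in lborel. norm (LINT t|lborel. norm (h (x, t))) \<le> norm (\<psi> x * (LINT t|lborel. norm (g' t)))"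
      proof (intro AE_I2)
        fix x
        have "(LINT t|lborel. norm (h (x, t))) \<le> (LINT t|lborel. \<bar>\<psi> x\<bar> * norm (g' t))"
          using integrable_norm[OF ig] integrable_norm[OF i2[of x]]
          by (intro integral_mono integrable_mult_right) (auto simp: h_def indicator_def abs_mult)
        also have "\<dots> = \<bar>\<psi> x\<bar> * (LINT t|lborel. norm (g' t))" by simp
        finally show "norm (LINT t|lborel. norm (h (x, t))) \<le> norm (\<psi> x * (LINT t|lborel. norm (g' t)))"
          by (simp add: abs_mult)
      qed
    qed measurable
  qed (use i2 in auto)
  then have F: "(LINT t|lborel. (LINT x|lborel. h (x, t))) = (LINT x|lborel. (LINT t|lborel. h (x, t)))"
    using lborel_pair.Fubini_integral[of "\<lambda>x t. h (x, t)"] by (simp add: case_prod_beta')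
  have "(LINT t|lborel. h (x, t)) = indicator {0..N} x *\<^sub>R ((LINT t:{0..x}|lborel. g t) * \<phi>' x)" for x
  proof (cases "x \<in> {0..N}")
    case True
    have "(LINT t|lborel. h (x, t)) = (LINT t|lborel. \<phi>' x * (indicator {0..x} t *\<^sub>R g t))"
      using True by (intro Bochner_Integration.integral_cong) (auto simp: h_def \<psi>_def g'_def indicator_def)
    then show ?thesis using True by (simp add: set_lebesgue_integral_def mult.commute)
  qed (auto simp: h_def \<psi>_def)
  moreover have "(LINT x|lborel. h (x, t)) = indicator {0..N} t *\<^sub>R - (g t * \<phi> t)" for t
  proof (cases "t \<in> {0..N}")
    case True
    have "(LINT x|lborel. h (x, t)) = (LINT x|lborel. g t * (indicator {t..N} x *\<^sub>R \<phi>' x))"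
      using True by (intro Bochner_Integration.integral_cong) (auto simp: h_def \<psi>_def g'_def indicator_def)
    also have "\<dots> = g t * (LINT x|lborel. indicator {t..N} x *\<^sub>R \<phi>' x)" by simp
    also have "(LINT x|lborel. indicator {t..N} x *\<^sub>R \<phi>' x) = \<phi> N - \<phi> t"
      using True by (intro integral_FTC_atLeastAtMost)
        (auto intro!: continuous_on_subset[OF c] has_field_derivative_at_within[OF d] simp flip: has_real_derivative_iff_has_vector_derivative)
    finally show ?thesis using True z[of N] by simp
  qed (auto simp: h_def g'_def)
  ultimately show ?thesis using F unfolding set_lebesgue_integral_def by simp
qed

text \<open>On each bounded piece the positive and the negative part have the same integral over
  every half-line, so they define the same measure and their densities agree almost
  everywhere.\<close>

lemma AE_zero_if_interval_integrals_zero: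
  fixes k :: "real \<Rightarrow> real"
  assumes k: "loc_int k" and 0: "\<And>s t. 0 \<le> s \<Longrightarrow> s < t \<Longrightarrow> (LINT x:{s<..<t}|lborel. k x) = 0"
  shows "AE x in lborel. 0 \<le> x \<longrightarrow> k x = 0"
proof -
  have "AE x in lborel. indicator {0..real N} x * k x = 0" for N :: nat
  proof -
    define h where "h x = indicator {0..real N} x * k x" for x
    have ih: "integrable lborel h" unfolding h_def by (rule loc_int_integrable[OF k])
    then have [measurable]: "h \<in> borel_measurable borel" by (auto dest: borel_measurable_integrable)
    have tail: "(\<integral>\<^sup>+x. ennreal (h x) * indicator {a<..} x \<partial>lborel) = (\<integral>\<^sup>+x. ennreal (- h x) * indicator {a<..} x \<partial>lborel)"
      and fin: "(\<integral>\<^sup>+x. ennreal (h x) * indicator {a<..} x \<partial>lborel) < \<infinity>" for a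
    proof -
      have ia: "integrable lborel (\<lambda>x. indicator {a<..} x * h x)"
        using integrable_mult_indicator[of "{a<..}" lborel h] ih by simp
      have z: "(LINT x|lborel. indicator {a<..} x * h x) = 0"
      proof (cases "max a 0 < real N")
        case True
        have "AE x in lborel. indicator {a<..} x * h x = indicator {max a 0<..<real N} x *\<^sub>R k x"
          using AE_lborel_singleton[of 0] AE_lborel_singleton[of "real N"]
          by eventually_elim (auto simp: h_def indicator_def)
        then have "(LINT x|lborel. indicator {a<..} x * h x) = (LINT x|lborel. indicator {max a 0<..<real N} x *\<^sub>R k x)"
        proof (intro integral_cong_AE)
          have "integrable lborel (\<lambda>x. indicator {max a 0<..<real N} x *\<^sub>R k x)"
            using k unfolding set_integrable_def[symmetric] loc_int_def
            by (intro set_integrable_subset[of lborel "{0..real N}" k "{max a 0<..<real N}"]) auto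
          then show "(\<lambda>x. indicator {max a 0<..<real N} x *\<^sub>R k x) \<in> borel_measurable lborel"
            by (rule borel_measurable_integrable)
        qed (use ia in \<open>auto dest: borel_measurable_integrable\<close>)
        also have "\<dots> = 0" using 0[of "max a 0" "real N"] True by (simp add: set_lebesgue_integral_def)
        finally show ?thesis .
      next
        case False
        have "AE x in lborel. indicator {a<..} x * h x = 0"
          using AE_lborel_singleton[of 0] AE_lborel_singleton[of "real N"]
          by eventually_elim (use False in \<open>auto simp: h_def indicator_def\<close>)
        then show ?thesis by (rule integral_eq_zero_AE)
      qed
      have e1: "(\<integral>\<^sup>+x. ennreal (indicator {a<..} x * h x) \<partial>lborel) = (\<integral>\<^sup>+x. ennreal (h x) * indicator {a<..} x \<partial>lborel)"
        by (intro nn_integral_cong) (auto simp: indicator_def)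
      have e2: "(\<integral>\<^sup>+x. ennreal (- (indicator {a<..} x * h x)) \<partial>lborel) = (\<integral>\<^sup>+x. ennreal (- h x) * indicator {a<..} x \<partial>lborel)"
        by (intro nn_integral_cong) (auto simp: indicator_def)
      note f = ia[unfolded real_integrable_def, THEN conjunct2, unfolded e1 e2]
      then show "(\<integral>\<^sup>+x. ennreal (h x) * indicator {a<..} x \<partial>lborel) < \<infinity>" by (auto simp: top.not_eq_extremum)
      have *: "A = B" if AB: "A \<noteq> \<infinity>" "B \<noteq> \<infinity>" "enn2real A - enn2real B = 0" for A B :: ennreal
      proof -
        obtain a' b' where "A = ennreal a'" "a' \<ge> 0" "B = ennreal b'" "b' \<ge> 0"
          using AB(1,2) by (cases A; cases B) auto
        then show ?thesis using AB(3) by simp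
      qed
      show "(\<integral>\<^sup>+x. ennreal (h x) * indicator {a<..} x \<partial>lborel) = (\<integral>\<^sup>+x. ennreal (- h x) * indicator {a<..} x \<partial>lborel)"
        by (rule *) (use f z[unfolded real_lebesgue_integral_def[OF ia] e1 e2] in auto)
    qed
    have "density lborel (\<lambda>x. ennreal (h x)) = density lborel (\<lambda>x. ennreal (- h x))"
      by (rule measure_eqI_lessThan) (use tail fin in \<open>auto simp: emeasure_density\<close>)
    then have "AE x in lborel. ennreal (h x) = ennreal (- h x)" by (intro sigma_finite_measure.density_unique[OF sigma_finite_lborel]) auto
    then show ?thesis
    proof eventually_elim
      case (elim x)
      then have "h x = 0" by (cases "h x \<ge> 0") (auto simp: ennreal_neg ennreal_eq_0_iff)
      then show ?case by (simp add: h_def)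
    qed
  qed
  then have "AE x in lborel. \<forall>N::nat. indicator {0..real N} x * k x = 0" unfolding AE_all_countable by blast
  then show ?thesis
  proof eventually_elim
    case (elim x)
    show ?case
    proof
      assume "0 \<le> x"
      obtain N :: nat where "x \<le> real N" using real_arch_simple by blast
      then show "k x = 0" using elim[rule_format, of N] \<open>0 \<le> x\<close> by (simp add: indicator_def)
    qed
  qed
qed

lemma bump_bounds_integral:
  fixes h :: "real \<Rightarrow> real"
  assumes h: "loc_int h" and s: "0 \<le> s"
  shows "integrable lborel (\<lambda>x. h x * bump s t n x)"
    and "(\<lambda>n. LINT x|lborel. h x * bump s t n x) \<longlonglongrightarrow> (LINT x:{s<..<t}|lborel. h x)"
proof -
  have ih: "integrable lborel (\<lambda>x. indicator {0..t} x * h x)" by (rule loc_int_integrable[OF h])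
  have eq: "h x * bump s t n x = (indicator {0..t} x * h x) * bump s t n x" for n x
  proof (cases "n = 0")
    case True then show ?thesis by (simp add: bump_def exp_inv_def)
  next
    case n: False
    then have "0 < 1 / real n" by simp
    show ?thesis
    proof (cases "bump s t n x = 0")
      case False
      then have "s + 1 / real n < x" "x < t - 1 / real n" using bump_support[of n s t x] n by auto
      then have "x \<in> {0..t}" using s \<open>0 < 1 / real n\<close> unfolding atLeastAtMost_iff by linarith
      then show ?thesis by simp
    qed auto
  qed
  have bm: "bump s t n \<in> borel_measurable borel" for n
    by (rule borel_measurable_continuous_onI[OF continuous_on_bump])
  have le: "norm (h x * bump s t n x) \<le> norm (indicator {0..t} x * h x)" for n x
    unfolding eq using bump_bounds[of s t n x] by (simp add: abs_mult mult_left_le)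
  have m: "(\<lambda>x. h x * bump s t n x) \<in> borel_measurable borel" for n
    unfolding eq using borel_measurable_times[OF borel_measurable_integrable[OF ih], of "bump s t n"] bm[of n] by simp
  show "integrable lborel (\<lambda>x. h x * bump s t n x)" for n
    by (rule Bochner_Integration.integrable_bound[OF ih]) (use m le in auto)
  have lim: "(\<lambda>n. (indicator {0..t} x * h x) * bump s t n x) \<longlonglongrightarrow> (indicator {0..t} x * h x) * indicator {s<..<t} x" for x
    by (intro tendsto_intros bump_LIMSEQ)
  have e: "(indicator {0..t} x * h x) * indicator {s<..<t} x = indicator {s<..<t} x *\<^sub>R h x" for x
    using s by (auto simp: indicator_def)
  show "(\<lambda>n. LINT x|lborel. h x * bump s t n x) \<longlonglongrightarrow> (LINT x:{s<..<t}|lborel. h x)"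
    unfolding set_lebesgue_integral_def
  proof (rule integral_dominated_convergence[where w = "\<lambda>x. norm (indicator {0..t} x * h x)"])
    show "(\<lambda>x. indicator {s<..<t} x *\<^sub>R h x) \<in> borel_measurable lborel"
      unfolding e[symmetric] using borel_measurable_integrable[OF ih] by measurable
    show "AE x in lborel. (\<lambda>n. h x * bump s t n x) \<longlonglongrightarrow> indicator {s<..<t} x *\<^sub>R h x"
      using lim unfolding eq[symmetric] e by (intro AE_I2)
  qed (use ih m le in auto)
qed

text \<open>The lemma of du Bois-Reymond. The difference \<open>h\<close> of \<open>f\<close> and
  the primitive of \<open>g\<close> annihilates derivatives of test functions, that is, test
  functions of integral zero. Every bump becomes one of these after subtraction of a multiple of a
  fixed bump \<open>b0\<close>, so \<open>h\<close> is the constant given by its mean with weight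
  \<open>b0\<close>.\<close>

lemma weak_deriv_primitive:
  assumes "weak_deriv f g"
  shows "\<exists>C. AE x in lborel. 0 \<le> x \<longrightarrow> f x = C + (LINT t:{0..x}|lborel. g t)"
proof -
  have f: "loc_int f" and g: "loc_int g" and wd: "\<And>\<phi>. test_fun \<phi> \<Longrightarrow>
        (LINT x:{0<..}|lborel. f x * deriv \<phi> x) = - (LINT x:{0<..}|lborel. g x * \<phi> x)"
    using assms unfolding weak_deriv_def by auto
  define G where "G x = (LINT t:{0..x}|lborel. g t)" for x
  have cG: "continuous_on {0..} G" unfolding G_def by (rule continuous_on_loc_integral[OF g])
  have G: "loc_int G" using cG by (rule loc_int_continuous)
  define h where "h x = f x - G x" for x
  have h: "loc_int h" using f G unfolding loc_int_def h_def by (auto intro: set_integral_diff)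
  have test0: "(LINT x|lborel. h x * \<eta> x) = 0"
    if sm: "\<And>n. smooth_upto n \<eta>" and c: "continuous_on UNIV \<eta>"
      and d: "\<And>x. (\<phi> has_real_derivative \<eta> x) (at x)"
      and ab: "0 < a" "a \<le> b" "\<And>x. x \<notin> {a..b} \<Longrightarrow> \<phi> x = 0" "\<And>x. x \<notin> {a..b} \<Longrightarrow> \<eta> x = 0"
    for \<eta> \<phi> a b
  proof -
    have t: "test_fun \<phi>" by (rule test_funI[OF d sm ab(1,2,3)])
    have dd: "deriv \<phi> = \<eta>" using d by (auto intro: DERIV_imp_deriv)
    have r: "(LINT x:{0<..}|lborel. w x * \<eta> x) = (LINT x:{0..b+1}|lborel. w x * \<eta> x)"
       "(LINT x:{0<..}|lborel. w x * \<phi> x) = (LINT x:{0..b+1}|lborel. w x * \<phi> x)" for w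
    proof -
      have "(LINT x:{0<..}|lborel. w x * u x) = (LINT x:{0..b+1}|lborel. w x * u x)"
        if u: "\<And>x. x \<notin> {a..b} \<Longrightarrow> u x = 0" for u :: "real \<Rightarrow> real"
        unfolding set_lebesgue_integral_def
      proof (intro Bochner_Integration.integral_cong refl)
        fix x show "indicator {0<..} x *\<^sub>R (w x * u x) = indicator {0..b+1} x *\<^sub>R (w x * u x)"
        proof (cases "x \<in> {a..b}")
          case True then show ?thesis using ab(1,2) by (auto simp: indicator_def)
        next
          case False then show ?thesis using u[OF False] by simp
        qed
      qed
      from this[OF ab(4)] this[OF ab(3)] show "(LINT x:{0<..}|lborel. w x * \<eta> x) = (LINT x:{0..b+1}|lborel. w x * \<eta> x)"
       "(LINT x:{0<..}|lborel. w x * \<phi> x) = (LINT x:{0..b+1}|lborel. w x * \<phi> x)" by auto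
    qed
    have "(LINT x:{0..b+1}|lborel. G x * \<eta> x) = - (LINT x:{0..b+1}|lborel. g x * \<phi> x)"
      unfolding G_def using ab by (intro integral_by_parts_primitive[OF g d c]) auto
    moreover have "(LINT x:{0..b+1}|lborel. f x * \<eta> x) = - (LINT x:{0..b+1}|lborel. g x * \<phi> x)"
      using wd[OF t] unfolding dd r .
    moreover have "(LINT x|lborel. h x * \<eta> x) = (LINT x:{0..b+1}|lborel. f x * \<eta> x - G x * \<eta> x)"
      unfolding set_lebesgue_integral_def
    proof (intro Bochner_Integration.integral_cong refl)
      fix x show "h x * \<eta> x = indicator {0..b+1} x *\<^sub>R (f x * \<eta> x - G x * \<eta> x)"
      proof (cases "x \<in> {a..b}")
        case True then show ?thesis using ab(1,2) by (auto simp: indicator_def h_def algebra_simps)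
      next
        case False then show ?thesis using ab(4)[OF False] by simp
      qed
    qed
    moreover have "(LINT x:{0..b+1}|lborel. f x * \<eta> x - G x * \<eta> x) = (LINT x:{0..b+1}|lborel. f x * \<eta> x) - (LINT x:{0..b+1}|lborel. G x * \<eta> x)"
    proof (rule set_integral_diff)
      obtain C where C: "\<And>x. x \<in> {0..b+1} \<Longrightarrow> \<bar>\<eta> x\<bar> \<le> C"
        using compact_imp_bounded[OF compact_continuous_image[OF continuous_on_subset[OF c] compact_Icc], of 0 "b+1"]
        unfolding bounded_iff by fastforce
      have m: "\<eta> \<in> borel_measurable borel" using c by (rule borel_measurable_continuous_onI)
      have "set_integrable lborel {0..b+1} (\<lambda>x. w x * \<eta> x)" if w: "loc_int w" for w
        unfolding set_integrable_def
      proof (rule Bochner_Integration.integrable_bound[OF integrable_mult_right[OF loc_int_integrable[OF w, of "b+1"], of C]])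
        have "(\<lambda>x. (indicator {0..b + 1} x * w x) * \<eta> x) \<in> borel_measurable lborel"
          using borel_measurable_times[OF borel_measurable_integrable[OF loc_int_integrable[OF w, of "b+1"]], of \<eta>] m by simp
        then show "(\<lambda>x. indicator {0..b + 1} x *\<^sub>R (w x * \<eta> x)) \<in> borel_measurable lborel" by (simp add: mult.assoc)
        show "AE x in lborel. norm (indicator {0..b + 1} x *\<^sub>R (w x * \<eta> x)) \<le> norm (C * (indicator {0..b + 1} x * w x))"
        proof (intro AE_I2)
          fix x
          have "\<bar>\<eta> x\<bar> * \<bar>w x\<bar> \<le> \<bar>C\<bar> * \<bar>w x\<bar>" if "x \<in> {0..b+1}" using C[OF that] by (intro mult_right_mono) auto
          then show "norm (indicator {0..b + 1} x *\<^sub>R (w x * \<eta> x)) \<le> norm (C * (indicator {0..b + 1} x * w x))"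
            by (auto simp: indicator_def abs_mult mult.commute)
        qed
      qed
      then show "set_integrable lborel {0..b + 1} (\<lambda>x. f x * \<eta> x)" "set_integrable lborel {0..b + 1} (\<lambda>x. G x * \<eta> x)"
        using f G by auto
    qed
    ultimately show ?thesis by simp
  qed
  \<comment> \<open>A reference bump supported in \<open>[5/4, 7/4]\<close> and positive at
    \<open>3/2\<close>.\<close>
  define b0 where "b0 = bump 1 2 4"
  define m where "m = (LINT x|lborel. b0 x)"
  have int_cont: "integrable lborel (\<lambda>x. bump s t n x)" if "0 \<le> s" for s t n
    using bump_bounds_integral(1)[of "\<lambda>_. 1" s t n] loc_int_continuous[of "\<lambda>_. 1"] that by simp
  have m: "m > 0"
  proof -
    have nz: "b0 (3/2) > 0" by (simp add: b0_def bump_def exp_inv_def)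
    have "m \<noteq> 0"
    proof
      assume "m = 0"
      then have "AE x in lborel. b0 x = 0"
        using integral_nonneg_eq_0_iff_AE[of lborel b0] int_cont[of 1 2 4] bump_bounds(1) unfolding m_def b0_def by simp
      then have "AE x \<in> UNIV in lebesgue. x \<in> {x. b0 x = 0}" by (simp add: AE_completion)
      moreover have "closed {x. b0 x = 0}" unfolding b0_def by (intro closed_Collect_eq continuous_on_bump continuous_intros)
      ultimately have "3/2 \<in> {x. b0 x = 0}" by (intro mem_closed_if_AE_lebesgue) auto
      with nz show False by simp
    qed
    moreover have "m \<ge> 0" unfolding m_def b0_def by (intro integral_nonneg_AE AE_I2 bump_bounds)
    ultimately show ?thesis by simp
  qed
  define C where "C = (LINT x|lborel. h x * b0 x) / m"
  define k where "k x = h x - C" for x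
  have k: "loc_int k" using h loc_int_continuous[of "\<lambda>_. C"] unfolding loc_int_def k_def by (auto intro: set_integral_diff)
  have testk: "(LINT x|lborel. k x * bump s t n x) = 0" if st: "0 \<le> s" "s < t" and n: "n > 0" for s t n
  proof -
    \<comment> \<open>With this multiple of \<open>b0\<close> subtracted, \<open>\<eta>\<close> has
      integral zero, so its primitive \<open>\<phi>\<close> vanishes again to the right of the
      support and is a test function.\<close>
    define \<kappa> where "\<kappa> = (LINT x|lborel. bump s t n x) / m"
    define \<eta> where "\<eta> x = bump s t n x + - \<kappa> * b0 x" for x
    define a where "a = min (s + 1 / real n) (1 + 1 / 4)"
    define b where "b = max t 2"
    have "0 < 1 / real n" using n by simp
    then have "0 < s + 1 / real n" using st by linarith
    then have ab: "0 < a" "a \<le> b" by (auto simp: a_def b_def)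
    have c: "continuous_on UNIV \<eta>" unfolding \<eta>_def b0_def by (intro continuous_intros continuous_on_bump)
    have e0: "\<eta> x = 0" if "x \<notin> {a..b}" for x
    proof -
      have "bump s t n x = 0"
      proof (rule ccontr)
        assume "bump s t n x \<noteq> 0"
        then have "s + 1 / real n < x" "x < t - 1 / real n" using bump_support[OF n] by auto
        moreover from this have "x < t" using \<open>0 < 1 / real n\<close> by linarith
        ultimately show False using that by (auto simp: a_def b_def)
      qed
      moreover have "b0 x = 0"
      proof (rule ccontr)
        assume "b0 x \<noteq> 0"
        then have "1 + 1 / 4 < x" "x < 2" using bump_support[of 4 1 2 x] by (auto simp: b0_def)
        then show False using that by (auto simp: a_def b_def)
      qed
      ultimately show ?thesis by (simp add: \<eta>_def)
    qed
    have sm: "smooth_upto n \<eta>" for n unfolding \<eta>_def b0_def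
      by (intro smooth_upto_add smooth_upto_mult smooth_upto_bump smooth_upto_const)
    have ie: "(LINT x|lborel. \<eta> x) = 0"
      unfolding \<eta>_def using int_cont[of 1 2 4] int_cont[of s t n] st m by (simp add: b0_def[symmetric] \<kappa>_def m_def[symmetric])
    define \<phi> where "\<phi> x = (if x \<le> 0 then 0 else integral {0..x} \<eta>)" for x
    have d: "(\<phi> has_real_derivative \<eta> x) (at x)" for x
    proof (cases "x < a")
      case True
      have "\<phi> y = 0" if "y < a" for y
      proof -
        have "integral {0..y} \<eta> = integral {0..y} (\<lambda>_. 0)" using that e0 by (intro integral_cong) auto
        then show ?thesis by (simp add: \<phi>_def)
      qed
      then have "eventually (\<lambda>y. \<phi> y = 0) (nhds x)" using True unfolding eventually_nhds by (intro exI[of _ "{..<a}"]) auto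
      then have "(\<phi> has_real_derivative 0) (at x)" using DERIV_cong_ev[of x x \<phi> "\<lambda>_. 0" 0 0] by auto
      then show ?thesis using e0[of x] True by auto
    next
      case False
      then have "x > 0" using ab by auto
      have "((\<lambda>y. integral {0..y} \<eta>) has_real_derivative \<eta> x) (at x within {0..x+1})"
        using \<open>x > 0\<close> by (intro integral_has_real_derivative continuous_on_subset[OF c]) auto
      then have "((\<lambda>y. integral {0..y} \<eta>) has_real_derivative \<eta> x) (at x)"
        using \<open>x > 0\<close> by (simp add: at_within_Icc_at)
      moreover have "eventually (\<lambda>y. \<phi> y = integral {0..y} \<eta>) (nhds x)"
        using \<open>x > 0\<close> unfolding eventually_nhds by (intro exI[of _ "{0<..}"]) (auto simp: \<phi>_def)
      ultimately show ?thesis by (rule DERIV_eventually_eq)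
    qed
    have p0: "\<phi> x = 0" if "x \<notin> {a..b}" for x
    proof (cases "x < a")
      case True
      have "integral {0..x} \<eta> = integral {0..x} (\<lambda>_. 0)" using True e0 by (intro integral_cong) auto
      then show ?thesis by (simp add: \<phi>_def)
    next
      case False
      then have x: "x > b" "x > 0" using that ab by auto
      have si: "set_integrable lborel {0..x} \<eta>" by (intro borel_integrable_atLeastAtMost' continuous_on_subset[OF c]) auto
      have "integral {0..x} \<eta> = (LINT y:{0..x}|lborel. \<eta> y)" using set_borel_integral_eq_integral(2)[OF si] by simp
      also have "\<dots> = (LINT y|lborel. \<eta> y)"
        unfolding set_lebesgue_integral_def
      proof (intro Bochner_Integration.integral_cong refl)
        fix y show "indicator {0..x} y *\<^sub>R \<eta> y = \<eta> y"
        proof (cases "y \<in> {0..x}")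
          case False
          then have "y \<notin> {a..b}" using ab x by auto
          then show ?thesis using e0 by simp
        qed simp
      qed
      finally show ?thesis using ie x by (simp add: \<phi>_def)
    qed
    have "(LINT x|lborel. h x * \<eta> x) = 0" by (rule test0[OF sm c d ab p0 e0])
    moreover have "(LINT x|lborel. h x * \<eta> x) = (LINT x|lborel. h x * bump s t n x) - \<kappa> * (LINT x|lborel. h x * b0 x)"
    proof -
      have "(LINT x|lborel. h x * \<eta> x) = (LINT x|lborel. h x * bump s t n x - \<kappa> * (h x * b0 x))"
        by (intro Bochner_Integration.integral_cong) (auto simp: \<eta>_def algebra_simps)
      then show ?thesis using bump_bounds_integral(1)[OF h, of s t n] bump_bounds_integral(1)[OF h, of 1 2 4] st
        by (simp add: b0_def)
    qed
    moreover have "(LINT x|lborel. k x * bump s t n x) = (LINT x|lborel. h x * bump s t n x) - C * (LINT x|lborel. bump s t n x)"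
    proof -
      have "(LINT x|lborel. k x * bump s t n x) = (LINT x|lborel. h x * bump s t n x - C * bump s t n x)"
        by (intro Bochner_Integration.integral_cong) (auto simp: k_def algebra_simps)
      then show ?thesis using bump_bounds_integral(1)[OF h, of s t n] int_cont[of s t n] st by simp
    qed
    ultimately show ?thesis unfolding \<kappa>_def C_def by (simp add: mult.commute)
  qed
  have "(LINT x:{s<..<t}|lborel. k x) = 0" if "0 \<le> s" "s < t" for s t
  proof (rule LIMSEQ_unique)
    show "(\<lambda>n. LINT x|lborel. k x * bump s t n x) \<longlonglongrightarrow> (LINT x:{s<..<t}|lborel. k x)"
      by (rule bump_bounds_integral(2)[OF k that(1)])
    show "(\<lambda>n. LINT x|lborel. k x * bump s t n x) \<longlonglongrightarrow> 0"
      by (rule tendsto_eventually) (use testk that in \<open>auto simp: eventually_sequentially intro!: exI[of _ 1]\<close>)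
  qed
  then have "AE x in lborel. 0 \<le> x \<longrightarrow> k x = 0" by (rule AE_zero_if_interval_integrals_zero[OF k])
  then have "AE x in lborel. 0 \<le> x \<longrightarrow> f x = C + (LINT t:{0..x}|lborel. g t)"
    by eventually_elim (auto simp: k_def h_def G_def)
  then show ?thesis by blast
qed

lemma continuous_eq_if_AE_eq:
  fixes f g :: "real \<Rightarrow> real"
  assumes "continuous_on {0..} f" "continuous_on {0..} g" "AE x in lborel. 0 \<le> x \<longrightarrow> f x = g x" "0 \<le> x"
  shows "f x = g x"
proof -
  define u where "u y = f (max 0 y) - g (max 0 y)" for y
  have cu: "continuous_on UNIV u" unfolding u_def
    by (intro continuous_intros continuous_on_compose2[OF assms(1)] continuous_on_compose2[OF assms(2)]) auto
  have eq: "u y = 0" if "y > 0" for y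
  proof -
    have "AE y \<in> {0<..} in lebesgue. y \<in> {y. u y = 0}"
      using assms(3) by (intro AE_completion) (auto elim!: eventually_mono simp: u_def)
    moreover have "closed {y. u y = 0}" by (intro closed_Collect_eq cu continuous_intros)
    ultimately show ?thesis using mem_closed_if_AE_lebesgue_open[of "{0<..}" "{y. u y = 0}" y] that by auto
  qed
  \<comment> \<open>The density argument covers the open half-line only; the value at 0 follows by
    continuity from the right.\<close>
  have "isCont u 0" using cu by (simp add: continuous_on_eq_continuous_at)
  then have "(u \<longlongrightarrow> u 0) (at_right 0)" by (simp add: isCont_def filterlim_at_split)
  moreover have "(u \<longlongrightarrow> 0) (at_right 0)"
    by (rule tendsto_eventually) (use eq in \<open>auto simp: eventually_at_filter\<close>)
  ultimately have "u 0 = 0" by (rule tendsto_unique[OF trivial_limit_at_right_real])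
  then show ?thesis using eq[of x] assms(4) by (cases "x = 0") (auto simp: u_def)
qed

text \<open>An arbitrary solution is known only through weak derivatives. Two applications of the du
  Bois-Reymond lemma provide a continuous classical slope \<open>P\<close> whose increments are
  integrals of \<open>f2\<close>, and with it pointwise arguments at a maximum.\<close>

lemma weak_deriv_twice_representation:
  assumes w: "continuous_on {0..} w" and d1: "weak_deriv w f1" and d2: "weak_deriv f1 f2"
  obtains P where "continuous_on {0..} P" "\<And>x. 0 < x \<Longrightarrow> (w has_real_derivative P x) (at x)"
    "AE x in lborel. 0 \<le> x \<longrightarrow> f1 x = P x"
    "\<And>x y. 0 \<le> x \<Longrightarrow> x \<le> y \<Longrightarrow> P y - P x = (LINT t:{x..y}|lborel. f2 t)"
    "\<And>x y. 0 \<le> x \<Longrightarrow> set_integrable lborel {x..y} f2"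
proof -
  have l1: "loc_int f1" and l2: "loc_int f2" using d1 d2 by (auto simp: weak_deriv_def)
  obtain C1 where C1: "AE x in lborel. 0 \<le> x \<longrightarrow> f1 x = C1 + (LINT t:{0..x}|lborel. f2 t)"
    using weak_deriv_primitive[OF d2] by blast
  obtain C0 where C0: "AE x in lborel. 0 \<le> x \<longrightarrow> w x = C0 + (LINT t:{0..x}|lborel. f1 t)"
    using weak_deriv_primitive[OF d1] by blast
  define P where "P x = C1 + (LINT t:{0..x}|lborel. f2 t)" for x
  have cP: "continuous_on {0..} P" unfolding P_def by (intro continuous_intros continuous_on_loc_integral l2)
  have lP: "loc_int P" by (rule loc_int_continuous[OF cP])
  have si: "set_integrable lborel {x..y} f2" if "0 \<le> x" for x y
  proof -
    have "set_integrable lborel {0..y} f2" using l2 unfolding loc_int_def by blast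
    then show ?thesis by (rule set_integrable_subset) (use that in auto)
  qed
  have f1P: "(LINT t:{0..x}|lborel. f1 t) = integral {0..x} P" for x
  proof -
    have "(LINT t:{0..x}|lborel. f1 t) = (LINT t:{0..x}|lborel. P t)"
      unfolding set_lebesgue_integral_def
    proof (rule integral_cong_AE)
      show "(\<lambda>t. indicator {0..x} t *\<^sub>R f1 t) \<in> borel_measurable lborel" "(\<lambda>t. indicator {0..x} t *\<^sub>R P t) \<in> borel_measurable lborel"
        using borel_measurable_integrable[OF loc_int_integrable[OF l1]]
          borel_measurable_integrable[OF loc_int_integrable[OF lP]] by simp_all
      show "AE t in lborel. indicator {0..x} t *\<^sub>R f1 t = indicator {0..x} t *\<^sub>R P t"
        using C1 by eventually_elim (auto simp: indicator_def P_def)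
    qed
    also have "\<dots> = integral {0..x} P"
      by (rule set_borel_integral_eq_integral(2)) (use lP in \<open>unfold loc_int_def, blast\<close>)
    finally show ?thesis .
  qed
  have c2: "continuous_on {0..} (\<lambda>x. C0 + integral {0..x} P)"
    using continuous_on_loc_integral[OF l1] unfolding f1P by (intro continuous_intros)
  have wP: "w x = C0 + integral {0..x} P" if "0 \<le> x" for x
    using continuous_eq_if_AE_eq[OF w c2 _ that] C0 unfolding f1P by simp
  show ?thesis
  proof
    show "continuous_on {0..} P" by (rule cP)
    show "AE x in lborel. 0 \<le> x \<longrightarrow> f1 x = P x" using C1 by (simp add: P_def)
    show "(w has_real_derivative P x) (at x)" if "0 < x" for x
    proof -
      have "((\<lambda>y. C0 + integral {0..y} P) has_real_derivative 0 + P x) (at x within {0..x+1})"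
        using that by (intro DERIV_add DERIV_const integral_has_real_derivative continuous_on_subset[OF cP]) auto
      then have "((\<lambda>y. C0 + integral {0..y} P) has_real_derivative P x) (at x)"
        using that by (simp add: at_within_Icc_at)
      moreover have "eventually (\<lambda>y. w y = C0 + integral {0..y} P) (nhds x)"
        using that wP unfolding eventually_nhds by (intro exI[of _ "{0<..}"]) auto
      ultimately show ?thesis by (rule DERIV_eventually_eq)
    qed
    show "P y - P x = (LINT t:{x..y}|lborel. f2 t)" if "0 \<le> x" "x \<le> y" for x y
    proof -
      have e: "(LINT t:{a..c}|lborel. f2 t) = integral {a..c} f2" "f2 integrable_on {a..c}" if "0 \<le> a" for a c
        using set_borel_integral_eq_integral[OF si[OF that]] by auto
      have "integral {0..x} f2 + integral {x..y} f2 = integral {0..y} f2"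
        using that e(2)[of 0 y] by (intro Henstock_Kurzweil_Integration.integral_combine) auto
      then show ?thesis unfolding P_def using e that by simp
    qed
    show "set_integrable lborel {x..y} f2" if "0 \<le> x" for x y using si[OF that] .
  qed
qed

section \<open>The equation at a fixed rate\<close>

locale ratcheting =
  fixes \<mu> \<sigma> r cb b :: real
  assumes sigma: "\<sigma> > 0" and r: "r > 0" and cb: "0 < cb" and cb_mu: "cb \<le> \<mu>"
    and b0: "0 \<le> b" and b1: "b \<le> 1" and profit: "2 * \<mu> * cb > \<sigma>\<^sup>2 * r"
begin

definition T :: "real \<Rightarrow> real" where
  "T p = b * (1 - p) + (1 - b) * max (1 - p) 0"

text \<open>The equation \<open>- \<L> v - c \<T> v = 0\<close> solved for the second derivative.\<close>
definition F :: "real \<Rightarrow> real \<Rightarrow> real \<Rightarrow> real" where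
  "F c u p = 2 / \<sigma>\<^sup>2 * (r * u - \<mu> * p - c * T p)"

text \<open>\<open>\<rho>\<close> is the exact rate of growth of \<open>F c u p\<close> in
  \<open>u\<close>, and \<open>B\<close> a Lipschitz constant in \<open>p\<close> valid for all
  rates, since \<open>T\<close> is 1-Lipschitz and the rate is at most \<open>cb\<close>.\<close>

definition \<rho> :: real where "\<rho> = 2 * r / \<sigma>\<^sup>2"
definition B :: real where "B = 2 * (\<mu> + cb) / \<sigma>\<^sup>2"

lemma mu: "\<mu> > 0" using cb cb_mu by simp
lemma rho_pos: "\<rho> > 0" using r sigma by (simp add: \<rho>_def)
lemma B_pos: "B > 0" using mu cb sigma by (simp add: B_def)

lemma T_le1: "p \<le> 1 \<Longrightarrow> T p = 1 - p" by (simp add: T_def max_def algebra_simps)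
lemma T_ge1: "1 \<le> p \<Longrightarrow> T p = b * (1 - p)" by (simp add: T_def max_def algebra_simps)

lemma T_lipschitz: "\<bar>T p - T q\<bar> \<le> \<bar>p - q\<bar>"
proof -
  have *: "\<bar>T p - T q\<bar> \<le> \<bar>p - q\<bar>" if "p \<le> q" for p q
  proof -
    consider "q \<le> 1" | "1 \<le> p" | "p \<le> 1" "1 \<le> q" by linarith
    then show ?thesis
    proof cases
      case 1 then show ?thesis using that by (simp add: T_le1)
    next
      case 2
      have "b * (q - p) \<le> 1 * (q - p)" using that b1 by (intro mult_right_mono) auto
      moreover have "0 \<le> b * (q - p)" using that b0 by simp
      moreover have "T p - T q = b * (q - p)" using 2 that by (simp add: T_ge1 algebra_simps)
      ultimately show ?thesis using that by simp
    next
      case 3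
      have "b * (q - 1) \<le> 1 * (q - 1)" using 3 b1 by (intro mult_right_mono) auto
      moreover have "0 \<le> b * (q - 1)" using 3 b0 by simp
      moreover have "T p - T q = (1 - p) + b * (q - 1)" using 3 by (simp add: T_ge1 T_le1 algebra_simps)
      ultimately show ?thesis using 3 by simp
    qed
  qed
  show ?thesis using *[of p q] *[of q p] by (cases "p \<le> q") auto
qed

lemma F_diff_level: "F c u p - F c' u p = 2 / \<sigma>\<^sup>2 * ((c' - c) * T p)"
proof -
  have "F c u p - F c' u p = 2 / \<sigma>\<^sup>2 * ((r * u - \<mu> * p - c * T p) - (r * u - \<mu> * p - c' * T p))"
    unfolding F_def by (simp only: right_diff_distrib)
  then show ?thesis by (simp add: left_diff_distrib)
qed

text \<open>The one-sided bound is the form required by the maximum principle, the two-sided one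
  that of Picard iteration.\<close>

lemma F_diff:
  assumes "0 \<le> c" "c \<le> cb"
  shows "\<rho> * (u - u') - B * \<bar>p - p'\<bar> \<le> F c u p - F c u' p'"
    and "\<bar>F c u p - F c u' p'\<bar> \<le> \<rho> * \<bar>u - u'\<bar> + B * \<bar>p - p'\<bar>"
proof -
  define e where "e = 2 / \<sigma>\<^sup>2 * (- \<mu> * (p - p') - c * (T p - T p'))"
  have eq: "F c u p - F c u' p' = \<rho> * (u - u') + e"
    unfolding F_def \<rho>_def e_def using sigma by (simp add: field_simps)
  have "\<bar>- \<mu> * (p - p') - c * (T p - T p')\<bar> \<le> \<mu> * \<bar>p - p'\<bar> + cb * \<bar>p - p'\<bar>"
  proof -
    have "c * \<bar>T p - T p'\<bar> \<le> cb * \<bar>p - p'\<bar>" using assms T_lipschitz cb by (intro mult_mono) auto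
    moreover have "\<bar>- \<mu> * (p - p') - c * (T p - T p')\<bar> \<le> \<bar>- \<mu> * (p - p')\<bar> + \<bar>c * (T p - T p')\<bar>" by linarith
    ultimately show ?thesis using mu assms by (simp add: abs_mult)
  qed
  then have "2 / \<sigma>\<^sup>2 * \<bar>- \<mu> * (p - p') - c * (T p - T p')\<bar> \<le> 2 / \<sigma>\<^sup>2 * ((\<mu> + cb) * \<bar>p - p'\<bar>)"
    by (intro mult_left_mono) (auto simp: algebra_simps)
  moreover have "\<bar>e\<bar> = 2 / \<sigma>\<^sup>2 * \<bar>- \<mu> * (p - p') - c * (T p - T p')\<bar>"
    unfolding e_def abs_mult by simp
  moreover have "B * \<bar>p - p'\<bar> = 2 / \<sigma>\<^sup>2 * ((\<mu> + cb) * \<bar>p - p'\<bar>)" unfolding B_def by simp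
  ultimately have e: "\<bar>e\<bar> \<le> B * \<bar>p - p'\<bar>" by simp
  show "\<rho> * (u - u') - B * \<bar>p - p'\<bar> \<le> F c u p - F c u' p'" using e eq by simp
  have "\<bar>\<rho> * (u - u')\<bar> = \<rho> * \<bar>u - u'\<bar>" using rho_pos by (simp add: abs_mult)
  then show "\<bar>F c u p - F c u' p'\<bar> \<le> \<rho> * \<bar>u - u'\<bar> + B * \<bar>p - p'\<bar>"
    unfolding eq using abs_triangle_ineq[of "\<rho> * (u - u')" e] e by linarith
qed

lemma continuous_on_T [continuous_intros]: "continuous_on S p \<Longrightarrow> continuous_on S (\<lambda>t. T (p t))"
  unfolding T_def by (intro continuous_intros)

lemma continuous_on_F [continuous_intros]:
  "continuous_on S f \<Longrightarrow> continuous_on S p \<Longrightarrow> continuous_on S (\<lambda>t. F c (f t) (p t))"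
  unfolding F_def by (intro continuous_intros)

text \<open>Profiles live on the whole line, so that derivatives at 0 are two-sided; the equation is
  imposed on the half-line only.\<close>

definition primitive :: "(real \<Rightarrow> real) \<Rightarrow> (real \<Rightarrow> real) \<Rightarrow> bool" where
  "primitive f p \<longleftrightarrow> f 0 = 0 \<and> (\<forall>x. (f has_real_derivative p x) (at x)) \<and> continuous_on UNIV p"

text \<open>The differential inequality and the equation are integrated once, since solutions have second derivatives
  only almost everywhere.\<close>
definition supersol :: "real \<Rightarrow> (real \<Rightarrow> real) \<Rightarrow> (real \<Rightarrow> real) \<Rightarrow> bool" where
  "supersol c f p \<longleftrightarrow> (\<forall>x y. 0 \<le> x \<and> x \<le> y \<longrightarrow> p y - p x \<le> integral {x..y} (\<lambda>t. F c (f t) (p t)))"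

definition solves :: "real \<Rightarrow> (real \<Rightarrow> real) \<Rightarrow> (real \<Rightarrow> real) \<Rightarrow> real \<Rightarrow> bool" where
  "solves c f p z \<longleftrightarrow> (\<forall>x y. 0 \<le> x \<and> x \<le> y \<and> y \<le> z \<longrightarrow> p y - p x = integral {x..y} (\<lambda>t. F c (f t) (p t)))"

lemma primitiveD:
  assumes "primitive f p"
  shows "f 0 = 0" "(f has_real_derivative p x) (at x)" "continuous_on S p" "continuous_on S f"
  using assms unfolding primitive_def
  by (auto intro: continuous_on_subset continuous_at_imp_continuous_on DERIV_isCont)

lemma primitive_integrable: "primitive f p \<Longrightarrow> (\<lambda>t. F c (f t) (p t)) integrable_on {x..y}"
  by (intro integrable_continuous_real continuous_intros primitiveD)

lemma solvesD: "solves c f p z \<Longrightarrow> 0 \<le> x \<Longrightarrow> x \<le> y \<Longrightarrow> y \<le> z \<Longrightarrow> p y - p x = integral {x..y} (\<lambda>t. F c (f t) (p t))"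
  unfolding solves_def by blast

lemma supersolD: "supersol c f p \<Longrightarrow> 0 \<le> x \<Longrightarrow> x \<le> y \<Longrightarrow> p y - p x \<le> integral {x..y} (\<lambda>t. F c (f t) (p t))"
  unfolding supersol_def by blast

lemma solves_mono: "solves c f p z \<Longrightarrow> z' \<le> z \<Longrightarrow> solves c f p z'"
  unfolding solves_def by (meson order_trans)

lemma solves_DERIV:
  assumes fp: "primitive f p" and s: "solves c f p z" and x: "0 < x" "x < z"
  shows "(p has_real_derivative F c (f x) (p x)) (at x)"
proof -
  have "((\<lambda>y. integral {0..y} (\<lambda>t. F c (f t) (p t))) has_real_derivative F c (f x) (p x)) (at x within {0..z})"
    using x by (intro integral_has_real_derivative continuous_intros primitiveD[OF fp]) auto
  then have "((\<lambda>y. integral {0..y} (\<lambda>t. F c (f t) (p t))) has_real_derivative F c (f x) (p x)) (at x)"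
    using x by (simp add: at_within_Icc_at)
  then have D: "((\<lambda>y. p 0 + integral {0..y} (\<lambda>t. F c (f t) (p t))) has_real_derivative 0 + F c (f x) (p x)) (at x)"
    by (intro DERIV_add DERIV_const)
  have ev: "eventually (\<lambda>y. p y = p 0 + integral {0..y} (\<lambda>t. F c (f t) (p t))) (nhds x)"
    unfolding eventually_nhds using x
    by (intro exI[of _ "{0<..<z}"]) (auto simp: solvesD[OF s, of 0, simplified, symmetric])
  show ?thesis using D by (simp add: DERIV_cong_ev[OF refl ev refl])
qed

text \<open>The finite set \<open>S\<close> admits points where the formula for the slope changes,
  such as \<open>y\<^sub>0\<close> for \<open>gp\<close>.\<close>

lemma solves_if_DERIV:
  assumes p: "continuous_on UNIV p" and S: "finite S"
    and d: "\<And>x. 0 < x \<Longrightarrow> x < z \<Longrightarrow> x \<notin> S \<Longrightarrow> (p has_real_derivative F c (f x) (p x)) (at x)"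
  shows "solves c f p z"
  unfolding solves_def
proof (intro allI impI)
  fix x y assume xy: "0 \<le> x \<and> x \<le> y \<and> y \<le> z"
  have "((\<lambda>t. F c (f t) (p t)) has_integral p y - p x) {x..y}"
    using xy d by (intro fundamental_theorem_of_calculus_interior_strong[OF S] continuous_on_subset[OF p])
      (auto simp flip: has_real_derivative_iff_has_vector_derivative)
  then show "p y - p x = integral {x..y} (\<lambda>t. F c (f t) (p t))" by (simp add: integral_unique)
qed

section \<open>Solutions with prescribed initial slope\<close>

lemma flow_exists:
  assumes c: "0 \<le> c" "c \<le> cb"
  obtains W P :: "real \<Rightarrow> real \<Rightarrow> real" and M :: real where
    "\<And>a. primitive (W a) (P a)" "\<And>a x. x \<le> 0 \<Longrightarrow> P a x = a" "\<And>a z. solves c (W a) (P a) z"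
    "\<And>a a' x. 0 \<le> x \<Longrightarrow> \<bar>P a x - P a' x\<bar> \<le> 2 * \<bar>a - a'\<bar> * exp (M * x)"
proof -
  define L where "L = \<rho> + B"
  have L: "L > 0" using rho_pos B_pos by (simp add: L_def)
  have lip: "\<bar>F c u p - F c u' p'\<bar> \<le> L * (\<bar>u - u'\<bar> + \<bar>p - p'\<bar>)" for u p u' p'
  proof -
    have "\<rho> * \<bar>u - u'\<bar> + B * \<bar>p - p'\<bar> \<le> L * \<bar>u - u'\<bar> + L * \<bar>p - p'\<bar>"
      using rho_pos B_pos by (intro add_mono mult_right_mono) (auto simp: L_def)
    then show ?thesis using F_diff(2)[OF c, of u p u' p'] by (simp add: algebra_simps)
  qed
  obtain P where P: "\<And>a. continuous_on UNIV (P a)" "\<And>a x. x \<le> 0 \<Longrightarrow> P a x = a"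
    "\<And>a x. 0 \<le> x \<Longrightarrow> P a x = a + integral {0..x} (\<lambda>t. F c (integral {0..t} (P a)) (P a t))"
    "\<And>a a' x. 0 \<le> x \<Longrightarrow> \<bar>P a x - P a' x\<bar> \<le> 2 * \<bar>a - a'\<bar> * exp ((4 * L + 1) * x)"
    using picard_second_order[OF L lip] by blast
  have "\<forall>a. \<exists>f. f 0 = 0 \<and> (\<forall>x. (f has_real_derivative P a x) (at x))"
    using antiderivative_exists[OF P(1)] by blast
  then obtain W where W: "\<And>a. W a 0 = 0" "\<And>a x. (W a has_real_derivative P a x) (at x)" by metis
  have Wi: "integral {0..t} (P a) = W a t" if "0 \<le> t" for a t
    using C1_integral[OF W(2) that] by (simp add: integral_unique W)
  have pr: "primitive (W a) (P a)" for a using W P(1) by (simp add: primitive_def)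
  have 0: "P a x = a + integral {0..x} (\<lambda>t. F c (W a t) (P a t))" if "0 \<le> x" for a x
    unfolding P(3)[OF that, of a] by (intro arg_cong2[where f = "(+)"] refl integral_cong) (simp add: Wi)
  have "solves c (W a) (P a) z" for a z
    unfolding solves_def
  proof (intro allI impI)
    fix x y assume xy: "0 \<le> x \<and> x \<le> y \<and> y \<le> z"
    have "integral {0..x} (\<lambda>t. F c (W a t) (P a t)) + integral {x..y} (\<lambda>t. F c (W a t) (P a t)) = integral {0..y} (\<lambda>t. F c (W a t) (P a t))"
      using xy by (intro Henstock_Kurzweil_Integration.integral_combine primitive_integrable[OF pr]) auto
    then show "P a y - P a x = integral {x..y} (\<lambda>t. F c (W a t) (P a t))" using 0[of x a] 0[of y a] xy by simp
  qed
  then show ?thesis using pr P(2,4) by (intro that[of W P "4 * L + 1"]) auto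
qed

text \<open>The weight \<open>exp (B * t)\<close> absorbs the first-order term, and the term
  \<open>\<rho> * (f - h)\<close> is positive as long as the slopes have been ordered. Hence the
  weighted difference \<open>E\<close> cannot fall below its initial value. This bounds a very steep
  solution from below on a given interval.\<close>

lemma solution_ordering:
  assumes c: "0 \<le> c" "c \<le> cb" and f: "primitive f p" "\<And>z. solves c f p z"
    and h: "primitive h q" "\<And>z. solves c h q z" and 0: "q 0 < p 0" and x: "0 \<le> x"
  shows "(p 0 - q 0) * exp (- B * x) \<le> p x - q x"
proof -
  define E where "E t = (p t - q t) * exp (B * t)" for t
  define E' where "E' t = (F c (f t) (p t) - F c (h t) (q t)) * exp (B * t) + (p t - q t) * (B * exp (B * t))" for t
  have dE: "(E has_real_derivative E' t) (at t)" if "t > 0" for t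
    unfolding E_def E'_def
    using solves_DERIV[OF f(1) f(2)[of "t+1"], of t] solves_DERIV[OF h(1) h(2)[of "t+1"], of t] that
    by (auto intro!: derivative_eq_intros)
  \<comment> \<open>The crossing argument needs a start strictly above the level, so it is run for
    every \<open>k\<close> below \<open>p 0 - q 0\<close>.\<close>
  have *: "k < E x" if k: "0 < k" "k < p 0 - q 0" for k
  proof (rule stays_above[where f = E and X = 0 and Y = x and k = k and x = x])
    show "continuous_on {0..x} E" unfolding E_def by (intro continuous_intros primitiveD[OF f(1)] primitiveD[OF h(1)])
    show "k < E 0" using k by (simp add: E_def)
    show "0 \<le> x" "x \<le> x" using x by auto
    fix t assume t: "0 < t" "E t = k" and above: "\<And>y. 0 \<le> y \<Longrightarrow> y < t \<Longrightarrow> k < E y"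
    have pos: "0 \<le> p s - q s" if "0 \<le> s" "s \<le> t" for s
    proof -
      have "0 < E s" using above[of s] t k that by (cases "s = t") auto
      then show ?thesis unfolding E_def by (simp add: zero_less_mult_iff)
    qed
    have "0 < E t" using t k by simp
    then have "0 < p t - q t" unfolding E_def by (simp add: zero_less_mult_iff)
    have "((\<lambda>s. p s - q s) has_integral (f t - h t) - (f 0 - h 0)) {0..t}"
      using t by (intro C1_integral) (auto intro!: derivative_intros primitiveD[OF f(1)] primitiveD[OF h(1)])
    then have I: "((\<lambda>s. p s - q s) has_integral (f t - h t)) {0..t}" by (simp add: primitiveD[OF f(1)] primitiveD[OF h(1)])
    have "0 \<le> f t - h t" by (rule has_integral_nonneg[OF I]) (use pos in auto)
    moreover have "f t - h t \<noteq> 0"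
    proof
      assume "f t - h t = 0"
      then have "integral {0..t} (\<lambda>s. p s - q s) = 0" using I by (simp add: integral_unique)
      then have "\<forall>s\<in>{0..t}. p s - q s = 0"
        using t pos by (subst (asm) integral_eq_0_iff) (auto intro!: continuous_intros primitiveD[OF f(1)] primitiveD[OF h(1)])
      then show False using \<open>0 < p t - q t\<close> t by auto
    qed
    ultimately have "0 < \<rho> * (f t - h t)" using rho_pos by simp
    then have "0 < (F c (f t) (p t) - F c (h t) (q t)) + B * (p t - q t)"
      using F_diff(1)[OF c, of "f t" "h t" "p t" "q t"] \<open>0 < p t - q t\<close> by simp
    then have "0 < ((F c (f t) (p t) - F c (h t) (q t)) + B * (p t - q t)) * exp (B * t)" by simp
    then have "0 < E' t" by (simp add: E'_def algebra_simps)
    then show "\<exists>D>0. (E has_real_derivative D) (at t)" using dE[OF t(1)] by blast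
  qed
  have "p 0 - q 0 \<le> E x"
  proof (rule ccontr)
    assume "\<not> p 0 - q 0 \<le> E x"
    then have "max (E x) ((p 0 - q 0) / 2) < p 0 - q 0" using 0 by auto
    then have "max (E x) ((p 0 - q 0) / 2) < E x" using 0 by (intro *) (auto simp: less_max_iff_disj)
    then show False by simp
  qed
  then have "(p 0 - q 0) * exp (- B * x) \<le> E x * exp (- B * x)" by (intro mult_right_mono) auto
  also have "\<dots> = p x - q x" by (simp add: E_def mult.assoc flip: exp_add)
  finally show ?thesis .
qed

end

section \<open>The profile at the top rate\<close>

text \<open>The exponents \<open>\<gamma>\<close>, \<open>l1\<close> and \<open>l2\<close> are all
  of this form, with \<open>d\<close> equal to \<open>\<mu> - cb\<close>,
  \<open>- (\<mu> - b * cb)\<close> and \<open>\<mu> - b * cb\<close>.\<close>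

lemma quadratic_root:
  fixes S r d :: real
  assumes "S > 0" "r > 0"
  defines "x \<equiv> (sqrt (d\<^sup>2 + 2 * S * r) + d) / S"
  shows "x > 0" "S / 2 * x\<^sup>2 - d * x = r"
proof -
  define R where "R = sqrt (d\<^sup>2 + 2 * S * r)"
  have "0 < 2 * S * r" using assms by simp
  then have R: "R\<^sup>2 = d\<^sup>2 + 2 * S * r" unfolding R_def by simp
  have "sqrt (d\<^sup>2) < R" unfolding R_def using \<open>0 < 2 * S * r\<close> by (intro real_sqrt_less_mono) simp
  then have "\<bar>d\<bar> < R" by simp
  then show "x > 0" using assms unfolding x_def R_def[symmetric] by simp
  have "S * (S / 2 * x\<^sup>2 - d * x) = (R + d)\<^sup>2 / 2 - d * (R + d)"
    using assms(1) unfolding x_def R_def[symmetric] by (simp add: power2_eq_square right_diff_distrib)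
  also have "\<dots> = (R\<^sup>2 - d\<^sup>2) / 2" by (simp add: power2_eq_square algebra_simps)
  also have "\<dots> = S * r" using R by simp
  finally show "S / 2 * x\<^sup>2 - d * x = r" using assms(1) by simp
qed

context ratcheting begin

abbreviation "\<gamma> \<equiv> gam \<mu> \<sigma> r cb"
abbreviation "l1 \<equiv> lam1 \<mu> \<sigma> r cb b"
abbreviation "l2 \<equiv> lam2 \<mu> \<sigma> r cb b"
abbreviation "k1 \<equiv> kk1 \<mu> \<sigma> r cb b"
abbreviation "k2 \<equiv> kk2 \<mu> \<sigma> r cb b"
abbreviation "y\<^sub>0 \<equiv> y0 \<mu> \<sigma> r cb b"

lemma exponents:
  shows "\<gamma> > 0" "\<sigma>\<^sup>2 / 2 * \<gamma>\<^sup>2 - (\<mu> - cb) * \<gamma> = r"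
    and "l1 > 0" "\<sigma>\<^sup>2 / 2 * l1\<^sup>2 + (\<mu> - b * cb) * l1 = r"
    and "l2 > 0" "\<sigma>\<^sup>2 / 2 * l2\<^sup>2 - (\<mu> - b * cb) * l2 = r"
proof -
  have S: "\<sigma>\<^sup>2 > 0" using sigma by simp
  show "\<gamma> > 0" "\<sigma>\<^sup>2 / 2 * \<gamma>\<^sup>2 - (\<mu> - cb) * \<gamma> = r"
    using quadratic_root[OF S r, of "\<mu> - cb"] by (simp_all add: gam_def)
  show "l1 > 0" "\<sigma>\<^sup>2 / 2 * l1\<^sup>2 + (\<mu> - b * cb) * l1 = r"
  proof -
    define d where "d = \<mu> - b * cb"
    show "l1 > 0" "\<sigma>\<^sup>2 / 2 * l1\<^sup>2 + (\<mu> - b * cb) * l1 = r"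
      using quadratic_root[OF S r, of "- d"] unfolding lam1_def d_def[symmetric] by simp_all
  qed
  show "l2 > 0" "\<sigma>\<^sup>2 / 2 * l2\<^sup>2 - (\<mu> - b * cb) * l2 = r"
    using quadratic_root[OF S r, of "\<mu> - b * cb"] by (simp_all add: lam2_def)
qed

text \<open>The hypothesis on \<open>2 * \<mu> * cb\<close> enters here. It amounts to
  \<open>root_fun\<close> being positive at 0, which places the root at a positive
  \<open>y\<^sub>0\<close>.\<close>

lemma gamma_gt: "1 / \<gamma> < cb / r"
proof -
  have "r < \<gamma> * cb"
  proof (rule ccontr)
    assume "\<not> r < \<gamma> * cb"
    then have "\<sigma>\<^sup>2 * (\<gamma> * cb) \<le> \<sigma>\<^sup>2 * r" by (intro mult_left_mono) auto
    also have "\<dots> < 2 * \<mu> * cb" by (rule profit)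
    finally have "(\<sigma>\<^sup>2 * \<gamma>) * cb < (2 * \<mu>) * cb" by (simp add: mult.assoc)
    then have "\<sigma>\<^sup>2 * \<gamma> < 2 * \<mu>" using cb by (simp add: mult_less_cancel_right)
    then have "\<gamma> * (\<sigma>\<^sup>2 / 2 * \<gamma>) < \<gamma> * \<mu>" using exponents(1) by (intro mult_strict_left_mono) auto
    then have "r < \<gamma> * cb" using exponents(2) by (simp add: power2_eq_square algebra_simps)
    with \<open>\<not> r < \<gamma> * cb\<close> show False by simp
  qed
  then show ?thesis using r exponents(1) by (simp add: field_simps)
qed

definition D :: real where "D = (1 - b) * cb / r - 1 / \<gamma>"

text \<open>The two identities are the matching conditions at \<open>y\<^sub>0\<close>: equal values
  of the two branches of \<open>g\<close>, and slope 1, where \<open>T\<close> has its corner.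
  Positivity of \<open>k2\<close> comes from \<open>cb \<le> \<mu>\<close>.\<close>

lemma k_eqs: "k1 - k2 = D" "l1 * k1 + l2 * k2 = 1" "k2 > 0"
proof -
  have l: "l1 + l2 > 0" using exponents by simp
  have k: "k1 = (1 + l2 * D) / (l1 + l2)" "k2 = (1 - l1 * D) / (l1 + l2)" by (simp_all add: kk1_def kk2_def D_def)
  have "k1 - k2 = ((l1 + l2) * D) / (l1 + l2)" unfolding k by (simp add: algebra_simps flip: diff_divide_distrib)
  then show "k1 - k2 = D" using l by simp
  have "l1 * k1 + l2 * k2 = (l1 + l2) / (l1 + l2)" unfolding k by (simp add: algebra_simps flip: add_divide_distrib)
  then show "l1 * k1 + l2 * k2 = 1" using l by simp
  have "l1 * ((1 - b) * cb) \<le> l1 * (\<mu> - b * cb)"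
    using exponents(3) cb_mu by (intro mult_left_mono) (auto simp: algebra_simps)
  also have "\<dots> < r" using exponents(3,4) sigma by (smt (verit) mult.commute mult_pos_pos zero_less_divide_iff zero_less_power)
  finally have "l1 * ((1 - b) * cb / r) < 1" using r by (simp add: field_simps)
  moreover have "l1 * D \<le> l1 * ((1 - b) * cb / r)" unfolding D_def using exponents(1,3) by (intro mult_left_mono) auto
  ultimately show "k2 > 0" using l unfolding k by simp
qed

definition root_fun :: "real \<Rightarrow> real" where
  "root_fun y = k1 * exp (- l1 * y) - k2 * exp (l2 * y) + b * cb / r"

lemma root_fun_deriv:
  "(root_fun has_real_derivative - (l1 * k1 * exp (- l1 * y) + l2 * k2 * exp (l2 * y))) (at y)"
  unfolding root_fun_def by (auto intro!: derivative_eq_intros simp: algebra_simps)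

text \<open>For \<open>k1 < 0\<close> the bracket in the derivative is at least
  \<open>l1 * k1 + l2 * k2 = 1\<close>; for \<open>k1 \<ge> 0\<close> its terms are nonnegative and
  the second one is positive.\<close>

lemma root_fun_decreasing:
  assumes "0 \<le> x" "x < y"
  shows "root_fun y < root_fun x"
proof (rule DERIV_neg_imp_decreasing[OF assms(2)])
  fix t assume t: "x \<le> t" "t \<le> y"
  have 2: "l2 * k2 * 1 \<le> l2 * k2 * exp (l2 * t)"
    using k_eqs(3) exponents(5) t assms by (intro mult_left_mono) auto
  have "0 < l1 * k1 * exp (- l1 * t) + l2 * k2 * exp (l2 * t)"
  proof (cases "k1 \<ge> 0")
    case True
    then show ?thesis using exponents(3,5) k_eqs(3) by (intro add_nonneg_pos) auto
  next
    case False
    then have "l1 * k1 * 1 \<le> l1 * k1 * exp (- l1 * t)"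
      using exponents(3) t assms by (intro mult_left_mono_neg) (auto simp: mult_nonneg_nonpos)
    then show ?thesis using 2 k_eqs(2) by linarith
  qed
  then show "\<exists>d. (root_fun has_real_derivative d) (at t) \<and> d < 0"
    using root_fun_deriv[of t] by (intro exI[of _ "- (l1 * k1 * exp (- l1 * t) + l2 * k2 * exp (l2 * t))"]) auto
qed

lemma y0_root: "y\<^sub>0 > 0" "root_fun y\<^sub>0 = 0"
proof -
  have at0: "root_fun 0 > 0" using k_eqs(1) gamma_gt r by (simp add: root_fun_def D_def field_simps)
  \<comment> \<open>By \<open>exp t \<ge> t\<close>, the term with \<open>k2\<close> at
    \<open>Y\<close> already outweighs the other two.\<close>
  define Y where "Y = (\<bar>k1\<bar> + b * cb / r) / (k2 * l2)"
  have Y: "Y \<ge> 0" unfolding Y_def using k_eqs(3) exponents(5) b0 cb r by auto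
  have "root_fun Y \<le> 0"
  proof -
    have "k2 * (l2 * Y) \<le> k2 * exp (l2 * Y)" using k_eqs(3) exp_ge_add_one_self[of "l2 * Y"] by (intro mult_left_mono; linarith)
    moreover have "k2 * (l2 * Y) = \<bar>k1\<bar> + b * cb / r" unfolding Y_def using k_eqs(3) exponents(5) by simp
    moreover have "k1 * exp (- l1 * Y) \<le> \<bar>k1\<bar> * 1"
      using Y exponents(3) by (intro mult_mono) auto
    ultimately show ?thesis by (simp add: root_fun_def)
  qed
  then obtain y where y: "0 \<le> y" "y \<le> Y" "root_fun y = 0"
    using IVT2'[of root_fun Y 0 0] Y at0 DERIV_isCont[OF root_fun_deriv] by (auto intro!: continuous_at_imp_continuous_on)
  have "y \<noteq> 0" using y at0 by auto
  then have "0 < y \<and> root_fun y = 0" using y by simp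
  then have "\<exists>!y. 0 < y \<and> root_fun y = 0"
    using root_fun_decreasing by (metis less_imp_le linorder_neqE_linordered_idom less_irrefl)
  from theI'[OF this] show "y\<^sub>0 > 0" "root_fun y\<^sub>0 = 0"
    unfolding y0_def root_fun_def by auto
qed

definition g0 :: "real \<Rightarrow> real" where
  "g0 x = k1 * exp (l1 * (x - y\<^sub>0)) - k2 * exp (- l2 * (x - y\<^sub>0)) + b * cb / r"
definition g0' :: "real \<Rightarrow> real" where
  "g0' x = l1 * k1 * exp (l1 * (x - y\<^sub>0)) + l2 * k2 * exp (- l2 * (x - y\<^sub>0))"
definition g0'' :: "real \<Rightarrow> real" where
  "g0'' x = l1\<^sup>2 * k1 * exp (l1 * (x - y\<^sub>0)) - l2\<^sup>2 * k2 * exp (- l2 * (x - y\<^sub>0))"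
definition g1 :: "real \<Rightarrow> real" where "g1 x = - (1 / \<gamma>) * exp (- \<gamma> * (x - y\<^sub>0)) + cb / r"
definition g1' :: "real \<Rightarrow> real" where "g1' x = exp (- \<gamma> * (x - y\<^sub>0))"

text \<open>To the left of 0 the function runs along its tangent, so that it is differentiable
  everywhere and \<open>gp\<close> is constant there.\<close>

definition g :: "real \<Rightarrow> real" where
  "g x = (if x \<le> 0 then g0' 0 * x else if x \<le> y\<^sub>0 then g0 x else g1 x)"
definition gp :: "real \<Rightarrow> real" where
  "gp x = (if x \<le> 0 then g0' 0 else if x \<le> y\<^sub>0 then g0' x else g1' x)"

lemma g_derivs:
  "(g0 has_real_derivative g0' x) (at x)" "(g0' has_real_derivative g0'' x) (at x)"
  "(g1 has_real_derivative g1' x) (at x)" "(g1' has_real_derivative - \<gamma> * g1' x) (at x)"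
  unfolding g0_def g0'_def g0''_def g1_def g1'_def using exponents(1)
  by (auto intro!: derivative_eq_intros simp: power2_eq_square algebra_simps)

lemma g_matching: "g0 y\<^sub>0 = g1 y\<^sub>0" "g0' y\<^sub>0 = 1" "g1' y\<^sub>0 = 1" "g0 0 = 0"
proof -
  show "g0 y\<^sub>0 = g1 y\<^sub>0" using k_eqs(1) r unfolding g0_def g1_def D_def by (simp add: field_simps)
  show "g0' y\<^sub>0 = 1" using k_eqs(2) by (simp add: g0'_def)
  show "g1' y\<^sub>0 = 1" by (simp add: g1'_def)
  show "g0 0 = 0" using y0_root(2) by (simp add: g0_def root_fun_def)
qed

lemma g0_ode: "\<sigma>\<^sup>2 / 2 * g0'' x = r * g0 x - (\<mu> - b * cb) * g0' x - b * cb"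
proof -
  define E1 E2 where "E1 = exp (l1 * (x - y\<^sub>0))" and "E2 = exp (- l2 * (x - y\<^sub>0))"
  have "\<sigma>\<^sup>2 / 2 * g0'' x = k1 * E1 * (\<sigma>\<^sup>2 / 2 * l1\<^sup>2) - k2 * E2 * (\<sigma>\<^sup>2 / 2 * l2\<^sup>2)"
    by (simp add: g0''_def E1_def E2_def algebra_simps)
  also have "\<dots> = k1 * E1 * (r - (\<mu> - b * cb) * l1) - k2 * E2 * (r + (\<mu> - b * cb) * l2)"
    using exponents(4,6) by (metis add_diff_cancel_right' diff_add_cancel)
  also have "\<dots> = r * (k1 * E1 - k2 * E2 + b * cb / r) - (\<mu> - b * cb) * (l1 * k1 * E1 + l2 * k2 * E2) - b * cb"
    using r by (simp add: algebra_simps)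
  finally show ?thesis by (simp add: g0_def g0'_def E1_def E2_def)
qed

text \<open>At \<open>y\<^sub>0\<close> the sign is read off from the equation, with
  \<open>cb \<le> \<mu>\<close>. Towards the left the negative exponential term grows in size, while
  the other one decays.\<close>

lemma g0''_neg:
  assumes "x \<le> y\<^sub>0"
  shows "g0'' x < 0"
proof -
  have "\<sigma>\<^sup>2 / 2 * g0'' y\<^sub>0 = r * g1 y\<^sub>0 - (\<mu> - b * cb) - b * cb"
    using g0_ode[of "y\<^sub>0"] g_matching by simp
  also have "\<dots> = - (r / \<gamma> + (\<mu> - cb))" using r by (simp add: g1_def algebra_simps)
  also have "\<dots> < 0"
  proof -
    have "0 < r / \<gamma>" using r exponents(1) by simp
    then show ?thesis using cb_mu by linarith
  qed
  finally have 0: "l1\<^sup>2 * k1 < l2\<^sup>2 * k2" using sigma by (simp add: g0''_def mult_less_0_iff)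
  have 2: "l2\<^sup>2 * k2 * 1 \<le> l2\<^sup>2 * k2 * exp (- l2 * (x - y\<^sub>0))"
    using k_eqs(3) exponents(5) assms by (intro mult_left_mono) (auto simp: mult_nonneg_nonpos)
  show ?thesis
  proof (cases "k1 \<ge> 0")
    case True
    then have "l1\<^sup>2 * k1 * exp (l1 * (x - y\<^sub>0)) \<le> l1\<^sup>2 * k1 * 1"
      using exponents(3) assms by (intro mult_left_mono) (auto simp: mult_nonneg_nonpos)
    then show ?thesis using 0 2 unfolding g0''_def by linarith
  next
    case False
    then have "l1\<^sup>2 * k1 \<le> 0" by (intro mult_nonneg_nonpos) auto
    then have "l1\<^sup>2 * k1 * exp (l1 * (x - y\<^sub>0)) \<le> 0" by (rule mult_nonpos_nonneg) simp
    moreover have "0 < l2\<^sup>2 * k2" using k_eqs(3) exponents(5) by simp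
    ultimately show ?thesis using 2 unfolding g0''_def by linarith
  qed
qed

lemma g0'_antimono: "x \<le> y \<Longrightarrow> y \<le> y\<^sub>0 \<Longrightarrow> g0' y \<le> g0' x"
  by (rule DERIV_nonpos_imp_nonincreasing[of x y g0']) (auto intro!: exI[of _ "g0'' _"] g_derivs less_imp_le[OF g0''_neg])

lemma primitive_g: "primitive g gp"
proof -
  have inner: "((\<lambda>x. if x \<le> y\<^sub>0 then g0 x else g1 x) has_real_derivative (if x \<le> y\<^sub>0 then g0' x else g1' x)) (at x)" for x
    by (rule DERIV_glue) (use g_derivs g_matching in auto)
  have "(g has_real_derivative gp x) (at x)" for x
    unfolding g_def[abs_def] gp_def
    by (rule DERIV_glue[OF _ inner]) (use g_matching y0_root in \<open>auto intro!: derivative_eq_intros\<close>)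
  moreover have "continuous_on UNIV gp"
  proof -
    have c: "continuous_on S g0'" "continuous_on S g1'" for S
      using g_derivs(2,4) by (meson DERIV_isCont continuous_at_imp_continuous_on)+
    have *: "continuous_on S (\<lambda>x. if x \<le> y\<^sub>0 then g0' x else g1' x)" for S
      by (rule continuous_on_cases_le) (use c g_matching in \<open>auto intro!: continuous_intros\<close>)
    show ?thesis unfolding gp_def[abs_def]
      by (rule continuous_on_cases_le[OF _ *]) (use y0_root in \<open>auto intro!: continuous_intros\<close>)
  qed
  ultimately show ?thesis by (simp add: primitive_def g_def)
qed

lemma gp_antimono:
  assumes "0 \<le> x" "x \<le> y" shows "gp y \<le> gp x"
proof -
  have 0: "gp t = (if t \<le> y\<^sub>0 then g0' t else g1' t)" if "0 \<le> t" for t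
    using that y0_root by (cases "t = 0") (auto simp: gp_def)
  have 1: "g1' t \<le> 1" if "y\<^sub>0 \<le> t" for t using that exponents(1) by (simp add: g1'_def)
  have 2: "1 \<le> g0' t" if "t \<le> y\<^sub>0" for t using g0'_antimono[OF that] g_matching by simp
  consider "y \<le> y\<^sub>0" | "x \<le> y\<^sub>0" "y\<^sub>0 < y" | "y\<^sub>0 < x" by linarith
  then show ?thesis
  proof cases
    case 1 then show ?thesis using g0'_antimono[of x y] assms 0 by simp
  next
    case 2 then show ?thesis using 1[of y] 2(1) \<open>\<And>t. t \<le> y\<^sub>0 \<Longrightarrow> 1 \<le> g0' t\<close>[of x] 0[of x] 0[of y] assms by simp
  next
    case 3 then show ?thesis using assms exponents(1) 0[of x] 0[of y] by (simp add: g1'_def)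
  qed
qed

text \<open>The slope is at least 1 to the left of \<open>y\<^sub>0\<close> and at most 1 to the
  right, so on each side \<open>T\<close> is affine in the slope and the equation linear.\<close>

lemma solves_g: "solves cb g gp z"
proof (rule solves_if_DERIV[of gp "{y\<^sub>0}"])
  show "continuous_on UNIV gp" by (rule primitiveD[OF primitive_g])
  fix x assume x: "0 < x" "x \<notin> {y\<^sub>0}"
  show "(gp has_real_derivative F cb (g x) (gp x)) (at x)"
  proof (cases "x < y\<^sub>0")
    case True
    have ev: "eventually (\<lambda>y. gp y = g0' y) (nhds x)"
      unfolding eventually_nhds using True x by (intro exI[of _ "{0<..<y\<^sub>0}"]) (auto simp: gp_def)
    have "1 \<le> gp x" using g0'_antimono[of x "y\<^sub>0"] True x g_matching by (simp add: gp_def)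
    then have "F cb (g x) (gp x) = 2 / \<sigma>\<^sup>2 * (r * g0 x - (\<mu> - b * cb) * g0' x - b * cb)"
      using True x by (simp add: F_def T_ge1) (simp add: g_def gp_def algebra_simps)
    also have "\<dots> = g0'' x" unfolding g0_ode[symmetric] using sigma by simp
    finally show ?thesis using g_derivs(2)[of x] by (simp add: DERIV_cong_ev[OF refl ev refl])
  next
    case False
    then have x': "y\<^sub>0 < x" using x by simp
    have ev: "eventually (\<lambda>y. gp y = g1' y) (nhds x)"
      unfolding eventually_nhds using x' y0_root by (intro exI[of _ "{y\<^sub>0<..}"]) (auto simp: gp_def)
    have "gp x \<le> 1" using x' x exponents(1) by (simp add: gp_def g1'_def)
    then have "F cb (g x) (gp x) = 2 / \<sigma>\<^sup>2 * (r * g1 x - (\<mu> - cb) * g1' x - cb)"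
      using x' x by (simp add: F_def T_le1) (simp add: g_def gp_def algebra_simps)
    also have "r * g1 x - (\<mu> - cb) * g1' x - cb = - (r / \<gamma> + (\<mu> - cb)) * g1' x"
      using r by (simp add: g1_def g1'_def algebra_simps)
    also have "r / \<gamma> + (\<mu> - cb) = \<sigma>\<^sup>2 / 2 * \<gamma>"
    proof -
      have "\<gamma> * (r / \<gamma> + (\<mu> - cb)) = \<gamma> * (\<sigma>\<^sup>2 / 2 * \<gamma>)"
        using exponents(1,2) by (simp add: power2_eq_square algebra_simps)
      then show ?thesis using exponents(1) by simp
    qed
    finally have "F cb (g x) (gp x) = - \<gamma> * g1' x" using sigma by simp
    then show ?thesis using g_derivs(4)[of x] by (simp add: DERIV_cong_ev[OF refl ev refl])
  qed
qed auto

lemma gp_pos: "0 \<le> x \<Longrightarrow> 0 < gp x"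
proof -
  assume x: "0 \<le> x"
  have "gp (max x (y\<^sub>0 + 1)) \<le> gp x" using x by (intro gp_antimono) auto
  moreover have "gp (max x (y\<^sub>0 + 1)) > 0" using y0_root by (auto simp: gp_def g1'_def)
  ultimately show ?thesis by simp
qed

lemma gp_0: "1 < gp 0"
proof -
  have "g0' y\<^sub>0 < g0' 0"
    by (rule DERIV_neg_imp_decreasing[OF y0_root(1)]) (use g_derivs(2) g0''_neg in blast)
  then show ?thesis using g_matching by (simp add: gp_def)
qed

lemma g_tendsto: "(g \<longlongrightarrow> cb / r) at_top"
proof -
  have "((\<lambda>x. - (1 / \<gamma>) * exp (- \<gamma> * (x - y\<^sub>0)) + cb / r) \<longlongrightarrow> - (1 / \<gamma>) * 0 + cb / r) at_top"
  proof (intro tendsto_intros)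
    have "filterlim (\<lambda>x. \<gamma> * (x + - y\<^sub>0)) at_top at_top"
      by (intro filterlim_tendsto_pos_mult_at_top[OF tendsto_const exponents(1)])
        (subst add.commute, intro filterlim_tendsto_add_at_top[OF tendsto_const] filterlim_ident)
    then have "filterlim (\<lambda>x. - (\<gamma> * (x - y\<^sub>0))) at_bot at_top"
      by (simp add: filterlim_uminus_at_bot)
    then show "((\<lambda>x. exp (- \<gamma> * (x - y\<^sub>0))) \<longlongrightarrow> 0) at_top"
      by (intro filterlim_compose[OF exp_at_bot]) simp
  qed
  then have L: "(g1 \<longlongrightarrow> cb / r) at_top" by (simp add: g1_def[abs_def])
  show ?thesis
    by (rule Lim_transform_eventually[OF L])
      (use y0_root in \<open>auto intro!: eventually_mono[OF eventually_gt_at_top[of "y\<^sub>0"]] simp: g_def\<close>)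
qed

lemma g_le: "0 \<le> x \<Longrightarrow> g x \<le> cb / r"
proof -
  assume x: "0 \<le> x"
  have "g x \<le> g y" if "x \<le> y" for y
    by (rule DERIV_nonneg_imp_nondecreasing[OF that])
      (use x in \<open>meson gp_pos less_imp_le order_trans primitiveD(2)[OF primitive_g]\<close>)
  then have "eventually (\<lambda>y. g x \<le> g y) at_top" by (intro eventually_mono[OF eventually_ge_at_top[of x]])
  then show ?thesis by (intro tendsto_lowerbound[OF g_tendsto]) auto
qed

lemma g_eq_gfun: "0 \<le> x \<Longrightarrow> g x = gfun \<mu> \<sigma> r cb b x"
  using y0_root g_matching(4) by (cases "x = 0") (auto simp: gfun_def Let_def g_def g0_def g1_def)

section \<open>Lowering the rate by one step\<close>

text \<open>\<open>K1\<close> is the threshold at which \<open>slope_at_0_bound\<close> produces a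
  contradiction. \<open>K2\<close> bounds \<open>F\<close>, hence the second derivative where the
  equation holds: its terms account for \<open>F c 0 0\<close>, the largest value
  \<open>cb / r\<close> and the largest slope \<open>K1\<close>.\<close>

definition K1 :: real where "K1 = exp 1 * max 1 (B * cb / r)"
definition K2 :: real where "K2 = 2 * cb / \<sigma>\<^sup>2 + \<rho> * (cb / r) + B * K1"

lemma K1_ge: "exp 1 \<le> K1" "B * cb / r * exp 1 \<le> K1" "1 < K1"
proof -
  have "exp 1 * 1 \<le> exp 1 * max 1 (B * cb / r)" by (intro mult_left_mono) auto
  then show "exp 1 \<le> K1" by (simp add: K1_def)
  have "exp 1 * (B * cb / r) \<le> exp 1 * max 1 (B * cb / r)" by (intro mult_left_mono) auto
  then show "B * cb / r * exp 1 \<le> K1" by (simp add: K1_def mult.commute)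
  have "(1::real) < exp 1" by simp
  with \<open>exp 1 \<le> K1\<close> show "1 < K1" by linarith
qed

lemma F_bound:
  assumes "0 \<le> c" "c \<le> cb" "0 \<le> u" "u \<le> cb / r" "0 \<le> p" "p \<le> K1"
  shows "\<bar>F c u p\<bar> \<le> K2"
proof -
  have "\<bar>F c u p - F c 0 0\<bar> \<le> \<rho> * u + B * p" using F_diff(2)[OF assms(1,2), of u p 0 0] assms by simp
  moreover have "\<rho> * u \<le> \<rho> * (cb / r)" "B * p \<le> B * K1" using rho_pos B_pos assms by (auto intro!: mult_left_mono simp del: times_divide_eq_right)
  moreover have "F c 0 0 = - (2 * c / \<sigma>\<^sup>2)" by (simp add: F_def T_le1)
  moreover have "2 * c / \<sigma>\<^sup>2 \<le> 2 * cb / \<sigma>\<^sup>2" "0 \<le> 2 * c / \<sigma>\<^sup>2" using assms by (auto intro: divide_right_mono)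
  ultimately show ?thesis unfolding K2_def by linarith
qed

lemma K2_nonneg: "0 \<le> K2" using F_bound[of 0 0 0] cb r K1_ge by simp

lemma primitive_nonneg:
  assumes fp: "primitive f p" and p: "\<And>x. 0 \<le> x \<Longrightarrow> 0 \<le> p x" and x: "0 \<le> x" "x \<le> y"
  shows "f x \<le> f y"
  by (rule DERIV_nonneg_imp_nondecreasing[OF x(2)]) (use p x primitiveD(2)[OF fp] in force)

text \<open>While the slope exceeds 1 the equation holds and the weighted slope
  \<open>p t * exp (B * t)\<close> increases. A start above \<open>K1\<close> therefore keeps the
  slope above \<open>K1 / exp 1\<close> on \<open>[0, 1 / B]\<close>, which lifts
  \<open>f (1 / B)\<close> beyond \<open>cb / r\<close>.\<close>

lemma slope_at_0_bound:
  assumes fp: "primitive f p" and p: "\<And>x. 0 \<le> x \<Longrightarrow> 0 \<le> p x" and f: "\<And>x. 0 \<le> x \<Longrightarrow> f x \<le> cb / r"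
    and s: "\<And>x. 0 \<le> x \<Longrightarrow> 1 < p x \<Longrightarrow> solves c f p x" and c: "0 \<le> c" "c \<le> cb"
  shows "p 0 \<le> K1"
proof (rule ccontr)
  assume "\<not> p 0 \<le> K1"
  define k where "k = (K1 + p 0) / 2"
  have k: "K1 < k" "k < p 0" using \<open>\<not> p 0 \<le> K1\<close> by (auto simp: k_def)
  define E where "E t = p t * exp (B * t)" for t
  have cE: "continuous_on S E" for S unfolding E_def by (intro continuous_intros primitiveD[OF fp])
  have f0: "0 \<le> f t" if "0 \<le> t" for t using primitive_nonneg[OF fp p _ that] primitiveD(1)[OF fp] by simp
  have E: "k < E x" if x: "0 \<le> x" "x \<le> 1 / B" for x
  proof (rule stays_above[where f = E and X = 0 and Y = "1 / B" and k = k and x = x])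
    show "k < E 0" using k by (simp add: E_def)
    fix t assume t: "0 < t" "t \<le> 1 / B" "E t = k"
    \<comment> \<open>The factor \<open>exp 1\<close> in \<open>K1\<close> is used here: over
      \<open>[0, 1 / B]\<close> the weight is at most \<open>exp 1\<close>, so a weighted slope
      above \<open>K1\<close> means a slope above 1.\<close>
    have "B * t \<le> 1" using t B_pos by (simp add: field_simps)
    then have "exp (B * t) \<le> exp 1" by simp
    also have "\<dots> < p t * exp (B * t)" using K1_ge k t by (simp add: E_def)
    finally have pt: "1 < p t" by simp
    have "isCont p t" using primitiveD(3)[OF fp, of UNIV] by (simp add: continuous_on_eq_continuous_at)
    then obtain d where d: "d > 0" "\<And>y. \<bar>y - t\<bar> < d \<Longrightarrow> \<bar>p y - p t\<bar> < p t - 1"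
      unfolding continuous_at_eps_delta dist_real_def using pt by (metis diff_gt_0_iff_gt)
    \<comment> \<open>The equation is needed slightly beyond \<open>t\<close>, so that
      \<open>p\<close> has a two-sided derivative at \<open>t\<close>.\<close>
    have "1 < p (t + d / 2)" using d(2)[of "t + d/2"] d(1) by auto
    then have "solves c f p (t + d / 2)" using s t d by auto
    then have dp: "(p has_real_derivative F c (f t) (p t)) (at t)" using t d by (intro solves_DERIV[OF fp]) auto
    have "(E has_real_derivative F c (f t) (p t) * exp (B * t) + p t * (B * exp (B * t))) (at t)"
      unfolding E_def using dp by (auto intro!: derivative_eq_intros)
    moreover have "0 < F c (f t) (p t) + p t * B"
    proof -
      have "c * T (p t) \<le> 0" using c pt b0 by (simp add: T_ge1 mult_nonneg_nonpos)
      moreover have "0 \<le> r * f t" using f0[of t] t r by simp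
      ultimately have "- \<mu> * p t \<le> r * f t - \<mu> * p t - c * T (p t)" by linarith
      then have "2 / \<sigma>\<^sup>2 * (- \<mu> * p t) \<le> F c (f t) (p t)" unfolding F_def by (intro mult_left_mono) auto
      moreover have "2 / \<sigma>\<^sup>2 * (- \<mu> * p t) + p t * B = 2 * cb / \<sigma>\<^sup>2 * p t"
        by (simp add: B_def algebra_simps add_divide_distrib)
      moreover have "0 < 2 * cb / \<sigma>\<^sup>2 * p t" using pt cb sigma by simp
      ultimately show ?thesis by linarith
    qed
    then have "0 < (F c (f t) (p t) + p t * B) * exp (B * t)" by simp
    then have "0 < F c (f t) (p t) * exp (B * t) + p t * (B * exp (B * t))" by (simp add: algebra_simps)
    ultimately show "\<exists>D>0. (E has_real_derivative D) (at t)" by blast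
  qed (use x cE in auto)
  have pk: "k / exp 1 \<le> p x" if "0 \<le> x" "x \<le> 1 / B" for x
  proof -
    have "B * x \<le> 1" using that B_pos by (simp add: field_simps)
    then have "p x * exp (B * x) \<le> p x * exp 1" using p that by (intro mult_left_mono) auto
    with E[OF that] show ?thesis by (simp add: E_def field_simps)
  qed
  obtain \<xi> where \<xi>: "0 < \<xi>" "\<xi> < 1 / B" "f (1 / B) - f 0 = (1 / B - 0) * p \<xi>"
    using MVT2[of 0 "1 / B" f p] primitiveD(2)[OF fp] B_pos by auto
  have "k / exp 1 \<le> p \<xi>" using pk \<xi> by simp
  also have "p \<xi> = B * f (1 / B)" using \<xi>(3) primitiveD(1)[OF fp] B_pos by (simp add: field_simps)
  also have "\<dots> \<le> B * (cb / r)" using B_pos by (intro mult_left_mono f) auto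
  finally have "k \<le> B * cb / r * exp 1" by (simp add: field_simps)
  with K1_ge k show False by simp
qed

text \<open>The invariant of the scheme. The inequality with \<open>max (p x) 1\<close> keeps slopes
  at most 1 once they are so; \<open>1 < p 0\<close> rules out a tangential start of the next step;
  solving the equation at slopes above 1 drives the bound \<open>K1\<close> and the contact
  argument; the lower bound \<open>g\<close> makes solutions above the profile eventually exceed
  \<open>cb / r\<close>.\<close>

definition profile :: "real \<Rightarrow> (real \<Rightarrow> real) \<Rightarrow> (real \<Rightarrow> real) \<Rightarrow> bool" where
  "profile c f p \<longleftrightarrow> primitive f p \<and> (\<forall>x\<ge>0. 0 \<le> p x) \<and> (\<forall>x\<ge>0. f x \<le> cb / r) \<and>
     (\<forall>x y. 0 \<le> x \<and> x \<le> y \<longrightarrow> p y \<le> max (p x) 1) \<and> 1 < p 0 \<and> supersol c f p \<and>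
     (\<forall>x\<ge>0. 1 < p x \<longrightarrow> solves c f p x) \<and> K2-lipschitz_on UNIV p \<and> (\<forall>x\<ge>0. g x \<le> f x)"

lemma profileD:
  assumes "profile c f p"
  shows "primitive f p" "\<And>x. 0 \<le> x \<Longrightarrow> 0 \<le> p x" "\<And>x. 0 \<le> x \<Longrightarrow> f x \<le> cb / r"
    "\<And>x y. 0 \<le> x \<Longrightarrow> x \<le> y \<Longrightarrow> p y \<le> max (p x) 1" "1 < p 0" "supersol c f p"
    "\<And>x. 0 \<le> x \<Longrightarrow> 1 < p x \<Longrightarrow> solves c f p x" "K2-lipschitz_on UNIV p" "\<And>x. 0 \<le> x \<Longrightarrow> g x \<le> f x"
  using assms unfolding profile_def by auto

lemma profile_slope_le:
  assumes "profile c f p" "0 \<le> c" "c \<le> cb" "0 \<le> x"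
  shows "p x \<le> K1"
proof -
  have "p 0 \<le> K1" using slope_at_0_bound[of f p c] profileD[OF assms(1)] assms by blast
  then show ?thesis using profileD(4)[OF assms(1), of 0 x] assms K1_ge by auto
qed

lemma profile_nonneg: "profile c f p \<Longrightarrow> 0 \<le> x \<Longrightarrow> 0 \<le> f x"
proof -
  assume *: "profile c f p" "0 \<le> x"
  have "f 0 \<le> f x" using *(2) by (intro primitive_nonneg[OF profileD(1,2)[OF *(1)]]) auto
  then show ?thesis using primitiveD(1)[OF profileD(1)[OF *(1)]] by simp
qed

lemma lipschitz_from_halfline:
  fixes p :: "real \<Rightarrow> real"
  assumes neg: "\<And>x. x \<le> 0 \<Longrightarrow> p x = p 0" and K: "0 \<le> K"
    and le: "\<And>x y. 0 \<le> x \<Longrightarrow> x \<le> y \<Longrightarrow> \<bar>p y - p x\<bar> \<le> K * (y - x)"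
  shows "K-lipschitz_on UNIV p"
proof (rule lipschitz_onI)
  have *: "\<bar>p y - p x\<bar> \<le> K * (y - x)" if "x \<le> y" for x y
  proof -
    have e: "p x = p (max 0 x)" "p y = p (max 0 y)" using neg[of x] neg[of y] by (auto simp: max_def)
    have "\<bar>p y - p x\<bar> \<le> K * (max 0 y - max 0 x)" unfolding e using that by (intro le) auto
    also have "\<dots> \<le> K * (y - x)" using K that by (intro mult_left_mono) auto
    finally show ?thesis .
  qed
  show "dist (p x) (p y) \<le> K * dist x y" for x y
    using *[of x y] *[of y x] by (cases "x \<le> y") (auto simp: dist_real_def abs_minus_commute)
qed (fact K)

lemma solves_lipschitz:
  assumes fp: "primitive f p" and s: "solves c f p z" and c: "0 \<le> c" "c \<le> cb"
    and b: "\<And>x. 0 \<le> x \<Longrightarrow> x \<le> z \<Longrightarrow> 0 \<le> f x \<and> f x \<le> cb / r \<and> 0 \<le> p x \<and> p x \<le> K1"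
    and x: "0 \<le> x" "x \<le> y" "y \<le> z"
  shows "\<bar>p y - p x\<bar> \<le> K2 * (y - x)"
proof -
  have "norm (integral {x..y} (\<lambda>t. F c (f t) (p t))) \<le> K2 * (y - x)"
    using x b c by (intro integral_bound continuous_intros primitiveD[OF fp]) (auto intro!: F_bound)
  then show ?thesis using solvesD[OF s x] by simp
qed

lemma profile_g: "profile cb g gp"
  unfolding profile_def
proof (intro conjI allI impI)
  have pos: "0 \<le> gp x" if "0 \<le> x" for x using gp_pos[OF that] by simp
  have K: "gp 0 \<le> K1" using primitive_g pos g_le solves_g cb by (intro slope_at_0_bound[of g gp cb]) auto
  show "K2-lipschitz_on UNIV gp"
  proof (rule lipschitz_from_halfline[OF _ K2_nonneg])
    show "gp x = gp 0" if "x \<le> 0" for x using that by (simp add: gp_def)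
    fix x y :: real assume xy: "0 \<le> x" "x \<le> y"
    show "\<bar>gp y - gp x\<bar> \<le> K2 * (y - x)"
    proof (rule solves_lipschitz[OF primitive_g solves_g[of y]])
      fix t :: real assume "0 \<le> t"
      then show "0 \<le> g t \<and> g t \<le> cb / r \<and> 0 \<le> gp t \<and> gp t \<le> K1"
        using g_le pos gp_antimono[of 0 t] K primitive_nonneg[OF primitive_g pos, of 0 t] primitiveD(1)[OF primitive_g] by auto
    qed (use xy cb in auto)
  qed
  show "supersol cb g gp" unfolding supersol_def using solvesD[OF solves_g] by force
  show "gp y \<le> max (gp x) 1" if "0 \<le> x \<and> x \<le> y" for x y using gp_antimono[of x y] that by simp
qed (use primitive_g gp_pos g_le gp_0 solves_g in \<open>auto intro: less_imp_le\<close>)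

section \<open>Contact of solutions with the obstacle\<close>

lemma F_level_mono:
  assumes "c \<le> c'" "0 \<le> T p"
  shows "F c' u p \<le> F c u p"
proof -
  have "0 \<le> 2 / \<sigma>\<^sup>2 * ((c' - c) * T p)" using assms by simp
  then show ?thesis using F_diff_level[of c u p c'] by simp
qed

lemma profile_solves_right:
  assumes "profile c f p" "0 \<le> z" "1 < p z"
  shows "\<exists>d>0. solves c f p (z + d)"
proof -
  have "isCont p z" using primitiveD(3)[OF profileD(1)[OF assms(1)], of UNIV] by (simp add: continuous_on_eq_continuous_at)
  then obtain d where d: "d > 0" "\<And>y. \<bar>y - z\<bar> < d \<Longrightarrow> \<bar>p y - p z\<bar> < p z - 1"
    unfolding continuous_at_eps_delta dist_real_def using assms(3) by (metis diff_gt_0_iff_gt)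
  have "1 < p (z + d / 2)" using d(2)[of "z + d/2"] d(1) by auto
  then have "solves c f p (z + d / 2)" using profileD(7)[OF assms(1)] assms(2) d(1) by simp
  then show ?thesis using d(1) by (intro exI[of _ "d / 2"]) simp
qed

text \<open>Where the slope of the obstacle exceeds 1, lowering the rate makes the solution more concave, so
  it drops below the obstacle right after a tangential contact.\<close>
lemma no_contact_above_1:
  assumes h: "profile c' h q" and c: "c < c'" and b: "b > 0"
    and w: "primitive w p" "\<And>z. solves c w p z" and z: "0 \<le> z" "w z = h z" "p z = q z" "1 < q z"
  shows "\<exists>x>z. w x < h x"
proof -
  obtain d where d: "d > 0" "solves c' h q (z + d)" using profile_solves_right[OF h z(1,4)] by blast
  note hp = profileD(1)[OF h]
  \<comment> \<open>The right side for the second derivative of \<open>h - w\<close>; at the contact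
    it equals a positive multiple of \<open>(c - c') * T (q z)\<close>, a product of two negative
    numbers.\<close>
  define G where "G t = F c' (h t) (q t) - F c (w t) (p t)" for t
  have cG: "continuous_on S G" for S unfolding G_def by (intro continuous_intros primitiveD[OF hp] primitiveD[OF w(1)])
  have "\<exists>\<delta>>0. \<delta> \<le> d \<and> (\<forall>y. z < y \<and> y \<le> z + \<delta> \<longrightarrow> q z - p z < q y - p y \<and> (h z - w z) + (q z - p z) * (y - z) < h y - w y)"
  proof (rule local_convex_right[where u = "\<lambda>x. h x - w x" and up = "\<lambda>x. q x - p x" and G = G])
    show "((\<lambda>x. h x - w x) has_real_derivative q x - p x) (at x)" for x
      by (intro DERIV_diff primitiveD(2)[OF hp] primitiveD(2)[OF w(1)])
    have "T (q z) < 0" using z(4) b by (simp add: T_ge1 mult_pos_neg)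
    then have "0 < 2 / \<sigma>\<^sup>2 * ((c - c') * T (q z))" using c sigma by (simp add: mult_neg_neg)
    then show "0 < G z" using F_diff_level[of c' "h z" "q z" c] z by (simp add: G_def)
    fix x y assume xy: "z \<le> x" "x \<le> y" "y \<le> z + d"
    have "integral {x..y} G = (q y - q x) - (p y - p x)"
      unfolding G_def using solvesD[OF d(2), of x y] solvesD[OF w(2)[of y], of x y] xy z
      by (simp add: Henstock_Kurzweil_Integration.integral_diff primitive_integrable[OF hp] primitive_integrable[OF w(1)])
    then show "integral {x..y} G \<le> q y - p y - (q x - p x)" by simp
  qed (use d cG in auto)
  then obtain \<delta> where "\<delta> > 0" "\<And>y. z < y \<Longrightarrow> y \<le> z + \<delta> \<Longrightarrow> (h z - w z) + (q z - p z) * (y - z) < h y - w y" by blast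
  from this(2)[of "z + \<delta>"] this(1) z show ?thesis by (intro exI[of _ "z + \<delta>"]) auto
qed

text \<open>Above the level \<open>c / r\<close> a zero of the slope would have second derivative
  \<open>2 / \<sigma>\<^sup>2 * (r * w t - c) > 0\<close>, so a positive slope cannot come down to
  zero.\<close>

lemma stays_increasing:
  assumes w: "primitive w p" "\<And>z. solves c w p z" and X: "0 \<le> X" "c / r \<le> w X" "0 < p X" and x: "X \<le> x"
  shows "0 < p x"
proof (rule stays_above[where f = p and X = X and Y = x and k = 0 and x = x])
  fix t assume t: "X < t" "p t = 0" and pos: "\<And>y. X \<le> y \<Longrightarrow> y < t \<Longrightarrow> 0 < p y"
  have "w X < w t"
    by (rule DERIV_pos_imp_increasing_open[OF t(1)]) (use pos primitiveD[OF w(1)] in \<open>auto intro!: exI\<close>)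
  then have "c < r * w t" using X r by (simp add: field_simps) (smt (verit) mult.commute mult_less_cancel_right_pos)
  then have "0 < F c (w t) (p t)" unfolding F_def t(2) using sigma by (simp add: T_le1)
  moreover have "(p has_real_derivative F c (w t) (p t)) (at t)" using t X by (intro solves_DERIV[OF w(1) w(2)[of "t+1"]]) auto
  ultimately show "\<exists>D>0. (p has_real_derivative D) (at t)" by blast
qed (use assms primitiveD[OF w(1)] in auto)

text \<open>Since \<open>g\<close> tends to \<open>cb / r > c / r\<close>, a solution above
  \<open>g\<close> eventually stays away from the equilibrium \<open>c / r\<close>, where a small
  slope is forced to grow; so it grows at least linearly. Beyond such an \<open>X\<close> the
  solution is above every profile, and the comparison with an obstacle reduces to a compact
  interval.\<close>

lemma eventually_exceeds:
  assumes w: "primitive w p" "\<And>z. solves c w p z" and c: "0 \<le> c" "c < cb" and wg: "\<And>x. 0 \<le> x \<Longrightarrow> g x \<le> w x"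
  shows "\<exists>X>0. cb / r < w X \<and> 0 < p X"
proof -
  define \<delta> where "\<delta> = (cb - c) / (2 * r)"
  have \<delta>: "\<delta> > 0" "c / r + \<delta> < cb / r" using c r by (auto simp: \<delta>_def field_simps)
  have "eventually (\<lambda>x. c / r + \<delta> < g x) at_top" using order_tendstoD(1)[OF g_tendsto \<delta>(2)] .
  then obtain X0 where X0: "\<And>x. X0 \<le> x \<Longrightarrow> c / r + \<delta> < g x" unfolding eventually_at_top_linorder by blast
  define X1 where "X1 = max X0 1"
  have W1: "c + r * \<delta> \<le> r * w x" if "X1 \<le> x" for x
  proof -
    have "c / r + \<delta> \<le> w x" using X0[of x] wg[of x] that by (auto simp: X1_def)
    then have "r * (c / r + \<delta>) \<le> r * w x" using r by simp
    then show ?thesis using r by (simp add: distrib_left)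
  qed
  \<comment> \<open>For slopes up to \<open>\<kappa>\<close> the drift term uses up at most half of
    the gain \<open>r * \<delta>\<close>, and \<open>T\<close> is still in its branch
    \<open>1 - p\<close>.\<close>
  define \<kappa> where "\<kappa> = min 1 (r * \<delta> / (2 * \<mu>))"
  have \<kappa>: "\<kappa> > 0" "\<kappa> \<le> 1" "\<mu> * \<kappa> \<le> r * \<delta> / 2"
  proof -
    show "\<kappa> > 0" "\<kappa> \<le> 1" using r \<delta> mu by (auto simp: \<kappa>_def)
    have "\<mu> * \<kappa> \<le> \<mu> * (r * \<delta> / (2 * \<mu>))" using mu by (intro mult_left_mono) (auto simp: \<kappa>_def)
    then show "\<mu> * \<kappa> \<le> r * \<delta> / 2" using mu by simp
  qed
  define e where "e = r * \<delta> / \<sigma>\<^sup>2"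
  have e: "e > 0" using r \<delta> sigma by (simp add: e_def)
  have Fe: "e \<le> F c (w x) (p x)" if "X1 \<le> x" "p x \<le> \<kappa>" for x
  proof -
    have "(\<mu> - c) * p x \<le> r * \<delta> / 2"
    proof (cases "p x \<ge> 0")
      case True
      have "(\<mu> - c) * p x \<le> \<mu> * \<kappa>" using True that c cb_mu mu by (intro mult_mono) auto
      then show ?thesis using \<kappa> by simp
    next
      case False
      then have "(\<mu> - c) * p x \<le> 0" using c cb_mu by (intro mult_nonneg_nonpos) auto
      moreover have "0 \<le> r * \<delta> / 2" using r \<delta> by simp
      ultimately show ?thesis by linarith
    qed
    then have "r * \<delta> / 2 \<le> r * w x - \<mu> * p x - c * T (p x)"
      using W1[OF that(1)] that(2) \<kappa>(2) by (simp add: T_le1 algebra_simps)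
    then have "2 / \<sigma>\<^sup>2 * (r * \<delta> / 2) \<le> F c (w x) (p x)" unfolding F_def by (intro mult_left_mono) auto
    then show ?thesis by (simp add: e_def)
  qed
  have dp: "(p has_real_derivative F c (w x) (p x)) (at x)" if "X1 \<le> x" for x
    using that by (intro solves_DERIV[OF w(1) w(2)[of "x+1"]]) (auto simp: X1_def)
  have "\<exists>X2\<ge>X1. \<kappa> \<le> p X2"
  proof (rule ccontr)
    assume no: "\<not> (\<exists>X2\<ge>X1. \<kappa> \<le> p X2)"
    \<comment> \<open>Long enough for a slope growing at rate \<open>e\<close> to climb from
      \<open>p X1\<close> to \<open>\<kappa>\<close>.\<close>
    define y where "y = X1 + (\<bar>p X1\<bar> + \<kappa>) / e"
    have "0 < (\<bar>p X1\<bar> + \<kappa>) / e" using e \<kappa> by simp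
    then have "X1 < y" by (simp add: y_def)
    then obtain t where t: "X1 < t" "t < y" "p y - p X1 = (y - X1) * F c (w t) (p t)"
      using MVT2[of X1 y p "\<lambda>t. F c (w t) (p t)"] dp by auto
    have "\<not> \<kappa> \<le> p t" using no t by (meson less_imp_le)
    then have "e \<le> F c (w t) (p t)" using t by (intro Fe) auto
    then have "(y - X1) * e \<le> p y - p X1" unfolding t(3) using \<open>X1 < y\<close> by (intro mult_left_mono) auto
    also have "(y - X1) * e = \<bar>p X1\<bar> + \<kappa>" using e by (simp add: y_def)
    finally have "\<kappa> \<le> p y" by linarith
    then show False using no \<open>X1 < y\<close> by auto
  qed
  then obtain X2 where X2: "X1 \<le> X2" "\<kappa> \<le> p X2" by blast
  have above: "\<kappa> / 2 < p x" if x: "X2 \<le> x" for x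
  proof (rule stays_above[where f = p and X = X2 and Y = x and k = "\<kappa> / 2" and x = x])
    fix t assume t: "X2 < t" "p t = \<kappa> / 2"
    have "0 < F c (w t) (p t)" using Fe[of t] t X2 \<kappa> e by auto
    then show "\<exists>D>0. (p has_real_derivative D) (at t)" using dp[of t] t X2 by auto
  qed (use x X2 \<kappa> primitiveD[OF w(1)] in auto)
  define X where "X = X2 + (\<bar>w X2\<bar> + cb / r) / (\<kappa> / 2)"
  have "0 < (\<bar>w X2\<bar> + cb / r) / (\<kappa> / 2)" using \<kappa> cb r by (intro divide_pos_pos add_nonneg_pos) auto
  then have XX: "X2 < X" by (simp add: X_def)
  then obtain t where t: "X2 < t" "t < X" "w X - w X2 = (X - X2) * p t"
    using MVT2[of X2 X w p] primitiveD(2)[OF w(1)] by auto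
  have "(X - X2) * (\<kappa> / 2) < (X - X2) * p t" using above[of t] t XX by (intro mult_strict_left_mono) auto
  moreover have "(X - X2) * (\<kappa> / 2) = \<bar>w X2\<bar> + cb / r" using \<kappa> by (simp add: X_def)
  ultimately have "cb / r < w X" using t(3) by linarith
  moreover have "0 < p X" using above[of X] XX \<kappa> by auto
  moreover have "X > 0" using XX X2 by (auto simp: X1_def)
  ultimately show ?thesis by blast
qed

text \<open>At a critical point of \<open>p\<close> the second derivative of \<open>p\<close> has the sign of \<open>p\<close>, since \<open>T\<close> is Lipschitz.\<close>
lemma critical_slope:
  assumes fp: "primitive f p" and d: "(p has_real_derivative 0) (at x)"
  shows "((\<lambda>t. F c (f t) (p t)) has_real_derivative \<rho> * p x) (at x)"
proof -
  have "((\<lambda>t. T (p t)) has_real_derivative 0) (at x)"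
    unfolding has_field_derivative_iff
  proof (rule Lim_null_comparison)
    show "((\<lambda>t. \<bar>(p t - p x) / (t - x)\<bar>) \<longlongrightarrow> 0) (at x)"
      using d unfolding has_field_derivative_iff by (intro tendsto_rabs_zero)
    show "\<forall>\<^sub>F t in at x. norm ((T (p t) - T (p x)) / (t - x)) \<le> \<bar>(p t - p x) / (t - x)\<bar>"
      by (intro always_eventually allI) (simp add: abs_divide divide_right_mono T_lipschitz)
  qed
  moreover have "(f has_real_derivative p x) (at x)" by (rule primitiveD[OF fp])
  ultimately have "((\<lambda>t. F c (f t) (p t)) has_real_derivative 2 / \<sigma>\<^sup>2 * (r * p x - \<mu> * 0 - c * 0)) (at x)"
    unfolding F_def by (intro DERIV_cmult DERIV_diff d)
  then show ?thesis by (simp add: \<rho>_def mult.assoc)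
qed

text \<open>At an extremum of the slope the second derivative \<open>G\<close> vanishes, and its
  derivative there is \<open>\<rho> * p z\<close>. So the slope moves away from zero to the right of
  \<open>z\<close>: upwards from a positive maximum, downwards from a negative minimum.\<close>

lemma no_interior_extremum:
  assumes w: "primitive w p" "\<And>z. solves c w p z" and z: "0 < z"
  shows "0 < p z \<Longrightarrow> \<exists>d>0. \<forall>y. \<bar>z - y\<bar> < d \<longrightarrow> p y \<le> p z \<Longrightarrow> False"
    and "p z < 0 \<Longrightarrow> \<exists>d>0. \<forall>y. \<bar>z - y\<bar> < d \<longrightarrow> p z \<le> p y \<Longrightarrow> False"
proof -
  have dp: "(p has_real_derivative F c (w x) (p x)) (at x)" if "0 < x" for x
    using that by (intro solves_DERIV[OF w(1) w(2)[of "x+1"]]) auto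
  define G where "G t = F c (w t) (p t)" for t
  note dp' = dp[folded G_def]
  {
    assume p: "0 < p z" and "\<exists>d>0. \<forall>y. \<bar>z - y\<bar> < d \<longrightarrow> p y \<le> p z"
    then obtain d where d: "d > 0" "\<And>y. \<bar>z - y\<bar> < d \<Longrightarrow> p y \<le> p z" by blast
    have G0: "G z = 0" by (rule DERIV_local_max[OF dp'[OF z] d(1)]) (use d in auto)
    have "(G has_real_derivative \<rho> * p z) (at z)"
      unfolding G_def by (rule critical_slope[OF w(1)]) (use dp'[OF z] G0 in simp)
    then obtain e where e: "e > 0" "\<And>h. 0 < h \<Longrightarrow> h < e \<Longrightarrow> G z < G (z + h)"
      using DERIV_pos_inc_right[of G "\<rho> * p z" z] rho_pos p by auto
    define y where "y = z + min (d / 2) (e / 2)"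
    have y: "z < y" "y < z + e" "\<bar>z - y\<bar> < d" using d e by (auto simp: y_def)
    obtain t where "z < t" "t < y" "p y - p z = (y - z) * G t"
      using MVT2[of z y p G] dp' y z by auto
    moreover have "0 < G t" using e(2)[of "t - z"] calculation y G0 by auto
    ultimately have "p z < p y" using y by (metis diff_gt_0_iff_gt mult_pos_pos)
    with d(2)[OF y(3)] show False by simp
  next
    assume p: "p z < 0" and "\<exists>d>0. \<forall>y. \<bar>z - y\<bar> < d \<longrightarrow> p z \<le> p y"
    then obtain d where d: "d > 0" "\<And>y. \<bar>z - y\<bar> < d \<Longrightarrow> p z \<le> p y" by blast
    have G0: "G z = 0" by (rule DERIV_local_min[OF dp'[OF z] d(1)]) (use d in auto)
    have "(G has_real_derivative \<rho> * p z) (at z)"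
      unfolding G_def by (rule critical_slope[OF w(1)]) (use dp'[OF z] G0 in simp)
    then obtain e where e: "e > 0" "\<And>h. 0 < h \<Longrightarrow> h < e \<Longrightarrow> G (z + h) < G z"
      using DERIV_neg_dec_right[of G "\<rho> * p z" z] rho_pos p by (auto simp: mult_pos_neg)
    define y where "y = z + min (d / 2) (e / 2)"
    have y: "z < y" "y < z + e" "\<bar>z - y\<bar> < d" using d e by (auto simp: y_def)
    obtain t where "z < t" "t < y" "p y - p z = (y - z) * G t"
      using MVT2[of z y p G] dp' y z by auto
    moreover have "G t < 0" using e(2)[of "t - z"] calculation y G0 by auto
    ultimately have "p y < p z" using y by (metis diff_gt_0_iff_gt diff_less_0_iff_less mult_pos_neg)
    with d(2)[OF y(3)] show False by simp
  }
qed

text \<open>For \<open>b = 0\<close> the function \<open>T\<close> is nonnegative, so supersolutions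
  survive a lower rate, and it vanishes at slopes above 1, so that the equation there does not see
  the rate.\<close>

lemma profile_lower_level_degenerate:
  assumes h: "profile c' h q" and c: "0 \<le> c" "c < c'" "c' \<le> cb" and b: "b = 0"
  shows "profile c h q"
  unfolding profile_def
proof (intro conjI allI impI)
  note hp = profileD(1)[OF h]
  have Tb: "T p = max (1 - p) 0" for p
  proof -
    have "T p = b * (1 - p) + (1 - b) * max (1 - p) 0" by (rule T_def)
    also have "\<dots> = max (1 - p) 0" using b by simp
    finally show ?thesis .
  qed
  then have T0: "0 \<le> T p" for p by simp
  show "supersol c h q"
    unfolding supersol_def
  proof (intro allI impI)
    fix x y :: real assume xy: "0 \<le> x \<and> x \<le> y"
    have "q y - q x \<le> integral {x..y} (\<lambda>t. F c' (h t) (q t))" using supersolD[OF profileD(6)[OF h]] xy by simp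
    also have "\<dots> \<le> integral {x..y} (\<lambda>t. F c (h t) (q t))"
      using T0 c by (intro integral_le primitive_integrable[OF hp] F_level_mono) auto
    finally show "q y - q x \<le> integral {x..y} (\<lambda>t. F c (h t) (q t))" .
  qed
  show "solves c h q x" if x: "0 \<le> x" "1 < q x" for x
    unfolding solves_def
  proof (intro allI impI)
    fix s t assume st: "0 \<le> s \<and> s \<le> t \<and> t \<le> x"
    have "integral {s..t} (\<lambda>t. F c (h t) (q t)) = integral {s..t} (\<lambda>t. F c' (h t) (q t))"
    proof (intro integral_cong)
      fix y assume "y \<in> {s..t}"
      then have "1 < q y" using profileD(4)[OF h, of y x] st x by auto
      then have "T (q y) = 0" unfolding Tb by simp
      then show "F c (h y) (q y) = F c' (h y) (q y)" unfolding F_def by simp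
    qed
    then show "q t - q s = integral {s..t} (\<lambda>t. F c (h t) (q t))"
      using solvesD[OF profileD(7)[OF h x]] st by simp
  qed
qed (use profileD[OF h] in auto)

text \<open>If the solution with the least slope \<open>a\<close> did not touch \<open>h\<close> at
  a positive point, \<open>a\<close> could be lowered a little: on \<open>[0, X]\<close> by the
  positive minimum of the quotient \<open>N\<close>, and beyond \<open>X\<close> because the
  solution keeps increasing above \<open>cb / r\<close>. Touching from above makes the contact
  tangential.\<close>

lemma contact_point_exists:
  assumes h: "profile c' h q" and c: "0 \<le> c" "c < c'" "c' \<le> cb" and b: "b > 0"
  obtains w p z where "primitive w p" "\<And>z. solves c w p z" "\<And>x. x \<le> 0 \<Longrightarrow> p x = p 0"
    "\<And>x. 0 \<le> x \<Longrightarrow> h x \<le> w x" "0 < z" "w z = h z" "p z = q z" "q z \<le> 1" "1 < p 0"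
proof -
  have ccb: "c \<le> cb" "c < cb" using c by auto
  note hp = profileD(1)[OF h]
  obtain W P :: "real \<Rightarrow> real \<Rightarrow> real" and M where
    pr: "\<And>a. primitive (W a) (P a)" and P0: "\<And>a x. x \<le> 0 \<Longrightarrow> P a x = a" and so: "\<And>a z. solves c (W a) (P a) z"
    and dep: "\<And>a a' x. 0 \<le> x \<Longrightarrow> \<bar>P a x - P a' x\<bar> \<le> 2 * \<bar>a - a'\<bar> * exp (M * x)"
    using flow_exists[OF c(1) ccb(1)] by metis
  have depP: "\<bar>P a x - P a' x\<bar> \<le> 2 * \<bar>a - a'\<bar> * exp (\<bar>M\<bar> * X)" if "0 \<le> x" "x \<le> X" for a a' x X
  proof -
    have "M * x \<le> \<bar>M\<bar> * X" using that by (intro mult_mono) auto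
    then have "2 * \<bar>a - a'\<bar> * exp (M * x) \<le> 2 * \<bar>a - a'\<bar> * exp (\<bar>M\<bar> * X)" by (intro mult_left_mono) auto
    with dep[OF that(1), of a a'] show ?thesis by linarith
  qed
  have depW: "\<bar>W a x - W a' x\<bar> \<le> 2 * \<bar>a - a'\<bar> * exp (\<bar>M\<bar> * X) * x" if x: "0 \<le> x" "x \<le> X" for a a' x X
  proof (cases "x = 0")
    case False
    then obtain t where t: "0 < t" "t < x" "(W a x - W a' x) - (W a 0 - W a' 0) = (x - 0) * (P a t - P a' t)"
      using MVT2[of 0 x "\<lambda>x. W a x - W a' x" "\<lambda>t. P a t - P a' t", OF _ DERIV_diff[OF primitiveD(2)[OF pr] primitiveD(2)[OF pr]]] x
      by auto
    have "\<bar>P a t - P a' t\<bar> * x \<le> 2 * \<bar>a - a'\<bar> * exp (\<bar>M\<bar> * X) * x" using t x by (intro mult_right_mono depP) auto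
    moreover have "\<bar>W a x - W a' x\<bar> = \<bar>P a t - P a' t\<bar> * x"
      using t(3) x by (simp add: primitiveD(1)[OF pr] abs_mult mult.commute)
    ultimately show ?thesis by simp
  qed (simp add: primitiveD(1)[OF pr])
  define S where "S = {a. \<forall>x\<ge>0. h x \<le> W a x}"
  \<comment> \<open>At \<open>a = q 0\<close> the curves would be tangent at 0 with slope above 1,
    which is excluded. The strict inequality gives \<open>N 0 > 0\<close> below.\<close>
  have S_gt: "q 0 < a" if "a \<in> S" for a
  proof (rule ccontr)
    assume "\<not> q 0 < a"
    have "\<exists>x>0. W a x < h x"
    proof (cases "a = q 0")
      case True
      show ?thesis
        by (rule no_contact_above_1[OF h c(2) b pr so, of 0]) (use True profileD(5)[OF h] P0 in \<open>auto simp: primitiveD(1)[OF pr] primitiveD(1)[OF hp]\<close>)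
    next
      case False
      then have "a - q 0 < 0" using \<open>\<not> q 0 < a\<close> by simp
      moreover have "((\<lambda>x. W a x - h x) has_real_derivative a - q 0) (at 0)"
        using DERIV_diff[OF primitiveD(2)[OF pr, of a 0] primitiveD(2)[OF hp, of 0]] P0[of 0 a] by simp
      ultimately obtain d where d: "d > 0" "\<And>y. 0 < y \<Longrightarrow> y < d \<Longrightarrow> W a (0 + y) - h (0 + y) < W a 0 - h 0"
        using DERIV_neg_dec_right by blast
      show ?thesis using d(1) d(2)[of "d/2"] by (intro exI[of _ "d / 2"]) (auto simp: primitiveD(1)[OF pr] primitiveD(1)[OF hp])
    qed
    then obtain x where "0 < x" "W a x < h x" by blast
    moreover have "h x \<le> W a x" using that \<open>0 < x\<close> unfolding S_def by simp
    ultimately show False by simp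
  qed
  have member: "a \<in> S" if X: "0 \<le> X" "cb / r \<le> W a X" "0 < P a X" and le: "\<And>x. 0 \<le> x \<Longrightarrow> x \<le> X \<Longrightarrow> h x \<le> W a x" for a X
    unfolding S_def
  proof safe
    fix x :: real assume x: "0 \<le> x"
    show "h x \<le> W a x"
    proof (cases "x \<le> X")
      case False
      have "c / r \<le> cb / r" using ccb r by (intro divide_right_mono) auto
      then have "0 < P a t" if "X \<le> t" for t using stays_increasing[OF pr so X(1) _ X(3) that] X(2) by simp
      then have "W a X \<le> W a x"
        using False by (intro DERIV_nonneg_imp_nondecreasing[of X x "W a"]) (auto intro: less_imp_le primitiveD(2)[OF pr])
      then show ?thesis using X(2) profileD(3)[OF h x] by simp
    qed (use le x in auto)
  qed
  have "S \<noteq> {}"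
  proof -
    obtain m where m: "\<And>x. x \<in> {0..1} \<Longrightarrow> \<bar>P 0 x\<bar> \<le> m"
      using compact_imp_bounded[OF compact_continuous_image[OF primitiveD(3)[OF pr] compact_Icc], of 0 0 1]
      unfolding bounded_iff by fastforce
    have m0: "0 \<le> m" using m[of 0] by simp
    \<comment> \<open>Over \<open>[0, 1]\<close> the steep solution loses at most the factor
      \<open>exp (- B)\<close> of its lead over the solution with slope 0, whose slope is at least
      \<open>- m\<close>. What remains is \<open>K1\<close>, to dominate the slope of
      \<open>h\<close>, and \<open>cb / r\<close>, to reach that value at 1.\<close>
    define l where "l = K1 + cb / r + m"
    have "0 < cb / r" using cb r by simp
    then have l: "0 < l" using K1_ge m0 by (simp add: l_def add_pos_nonneg)
    define a where "a = l * exp B"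
    have a: "0 < a" using l by (simp add: a_def)
    have big: "K1 + cb / r \<le> P a x" if "0 \<le> x" "x \<le> 1" for x
    proof -
      have "(P a 0 - P 0 0) * exp (- B * x) \<le> P a x - P 0 x"
        using P0[of 0] a by (intro solution_ordering[OF c(1) ccb(1) pr so pr so] that) auto
      moreover have "l * 1 \<le> l * exp (B - B * x)"
        using l that B_pos by (intro mult_left_mono) auto
      moreover have "(P a 0 - P 0 0) * exp (- B * x) = l * exp (B - B * x)"
        using P0[of 0] by (simp add: a_def exp_diff exp_minus field_simps)
      moreover have "- m \<le> P 0 x" using m[of x] that by auto
      ultimately show ?thesis by (simp add: l_def)
    qed
    have W1: "cb / r * x \<le> W a x \<and> h x \<le> W a x" if "0 \<le> x" "x \<le> 1" for x
    proof -
      have "W a 0 - cb / r * 0 \<le> W a x - cb / r * x"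
      proof (rule DERIV_nonneg_imp_nondecreasing[OF that(1)])
        fix t assume t: "0 \<le> t" "t \<le> x"
        then have "0 \<le> P a t - cb / r" using big[of t] K1_ge that by auto
        moreover have "((\<lambda>x. W a x - cb / r * x) has_real_derivative P a t - cb / r) (at t)"
          by (rule DERIV_diff[OF primitiveD(2)[OF pr] DERIV_cmult_Id])
        ultimately show "\<exists>y. ((\<lambda>x. W a x - cb / r * x) has_real_derivative y) (at t) \<and> 0 \<le> y" by blast
      qed
      moreover have "W a 0 - h 0 \<le> W a x - h x"
      proof (rule DERIV_nonneg_imp_nondecreasing[OF that(1)])
        fix t assume t: "0 \<le> t" "t \<le> x"
        then have "0 \<le> P a t - q t" using big[of t] profile_slope_le[OF h, of t] that c \<open>0 < cb / r\<close> by auto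
        then show "\<exists>y. ((\<lambda>x. W a x - h x) has_real_derivative y) (at t) \<and> 0 \<le> y"
          using DERIV_diff[OF primitiveD(2)[OF pr, of a t] primitiveD(2)[OF hp, of t]] by blast
      qed
      ultimately show ?thesis by (simp add: primitiveD(1)[OF pr] primitiveD(1)[OF hp])
    qed
    have "a \<in> S"
    proof (rule member[of 1])
      show "0 < P a 1" using big[of 1] K1_ge \<open>0 < cb / r\<close> by auto
    qed (use W1 W1[of 1] in auto)
    then show ?thesis by blast
  qed
  have bdd: "bdd_below S" using S_gt by (intro bdd_belowI[of _ "q 0"]) (auto intro: less_imp_le)
  define a where "a = Inf S"
  have aS: "a \<in> S"
    unfolding S_def
  proof safe
    fix x :: real assume x: "0 \<le> x"
    define C where "C = 2 * exp (\<bar>M\<bar> * x) * x + 1"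
    have C: "C > 0" using x by (simp add: C_def add_nonneg_pos)
    show "h x \<le> W a x"
    proof (rule field_le_epsilon)
      fix e :: real assume e: "0 < e"
      then have "Inf S < a + e / C" using C by (simp add: a_def)
      then obtain a' where a': "a' \<in> S" "a' < a + e / C" using cInf_lessD \<open>S \<noteq> {}\<close> by blast
      have "a \<le> a'" unfolding a_def using a'(1) bdd by (rule cInf_lower)
      have "\<bar>W a' x - W a x\<bar> \<le> 2 * \<bar>a' - a\<bar> * exp (\<bar>M\<bar> * x) * x" by (rule depW) (use x in auto)
      also have "\<dots> = \<bar>a' - a\<bar> * (2 * exp (\<bar>M\<bar> * x) * x)" by simp
      also have "\<dots> \<le> (e / C) * C"
        using a' \<open>a \<le> a'\<close> x e C by (intro mult_mono) (auto simp: C_def)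
      also have "\<dots> = e" using C by simp
      finally show "h x \<le> W a x + e" using a'(1) x unfolding S_def by force
    qed
  qed
  then have aq: "q 0 < a" by (rule S_gt)
  have ah: "h x \<le> W a x" if "0 \<le> x" for x using aS that by (simp add: S_def)
  obtain X where X: "0 < X" "cb / r < W a X" "0 < P a X"
    using eventually_exceeds[OF pr so c(1) ccb(2), of a] profileD(9)[OF h] ah by (meson order_trans)
  \<comment> \<open>the contact point minimises the difference quotient of \<open>W a - h\<close> at 0; dividing by x keeps it away from 0\<close>
  define N where "N x = (if x = 0 then a - q 0 else (W a x - h x) / x)" for x
  have "continuous_on {0..X} N"
  proof (rule continuous_on_eq_continuous_within[THEN iffD2], rule ballI)
    fix x assume x: "x \<in> {0..X}"
    have cWh: "isCont (\<lambda>y. W a y - h y) x"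
      by (rule DERIV_isCont[OF DERIV_diff[OF primitiveD(2)[OF pr] primitiveD(2)[OF hp]]])
    have "isCont N x"
    proof (cases "x = 0")
      case True
      have "((\<lambda>y. W a y - h y) has_real_derivative a - q 0) (at 0)"
        using DERIV_diff[OF primitiveD(2)[OF pr, of a 0] primitiveD(2)[OF hp, of 0]] P0[of 0 a] by simp
      then have D: "((\<lambda>y. (W a y - h y) / y) \<longlongrightarrow> a - q 0) (at 0)"
        by (simp add: has_field_derivative_iff primitiveD(1)[OF pr] primitiveD(1)[OF hp])
      have "(N \<longlongrightarrow> a - q 0) (at 0)"
        by (rule Lim_transform_eventually[OF D]) (auto simp: eventually_at_filter N_def)
      then show ?thesis using True by (simp add: isCont_def N_def)
    next
      case False
      have "isCont (\<lambda>y. (W a y - h y) / y) x" by (rule isCont_divide[OF cWh continuous_ident False])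
      moreover have "eventually (\<lambda>y. N y = (W a y - h y) / y) (nhds x)"
        unfolding eventually_nhds using False by (intro exI[of _ "- {0}"]) (auto simp: N_def)
      ultimately show ?thesis using isCont_cong by fast
    qed
    then show "continuous (at x within {0..X}) N" by (rule continuous_at_imp_continuous_at_within)
  qed
  then obtain z where z: "z \<in> {0..X}" "\<And>y. y \<in> {0..X} \<Longrightarrow> N z \<le> N y"
    using continuous_attains_inf[of "{0..X}" N] X by auto
  have Nz: "N z = 0"
  proof (rule ccontr)
    assume "N z \<noteq> 0"
    moreover have "0 \<le> N z" using z(1) aq ah[of z] by (auto simp: N_def)
    ultimately have Npos: "0 < N z" by simp
    define C where "C = 2 * exp (\<bar>M\<bar> * X)"
    have C: "C > 0" by (simp add: C_def)
    \<comment> \<open>The three bounds preserve, for the slope \<open>a - e\<close>: the ordering on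
      \<open>[0, X]\<close>, the value at \<open>X\<close> being at least \<open>cb / r\<close>, and
      a positive slope at \<open>X\<close>.\<close>
    define e where "e = min (N z / C) (min ((W a X - cb / r) / (C * X)) (P a X / (2 * C)))"
    have e: "0 < e" unfolding e_def using Npos X C by simp
    have eC: "e * C \<le> N z" "e * (C * X) \<le> W a X - cb / r" "e * C < P a X"
    proof -
      have "e \<le> N z / C" "e \<le> (W a X - cb / r) / (C * X)" "e \<le> P a X / (2 * C)" by (auto simp: e_def)
      then show "e * C \<le> N z" "e * (C * X) \<le> W a X - cb / r" using C X by (simp_all add: field_simps)
      have "e * C \<le> P a X / 2" using \<open>e \<le> P a X / (2 * C)\<close> C by (simp add: field_simps)
      then show "e * C < P a X" using X by simp
    qed
    have low: "W a x - e * C * x \<le> W (a - e) x" if "0 \<le> x" "x \<le> X" for x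
    proof -
      have "\<bar>W (a - e) x - W a x\<bar> \<le> 2 * \<bar>(a - e) - a\<bar> * exp (\<bar>M\<bar> * X) * x" by (rule depW[OF that])
      moreover have "2 * \<bar>(a - e) - a\<bar> * exp (\<bar>M\<bar> * X) * x = e * C * x" using e by (simp add: C_def)
      ultimately show ?thesis by linarith
    qed
    have "a - e \<in> S"
    proof (rule member[of X])
      show "0 \<le> X" using X by simp
      show "cb / r \<le> W (a - e) X" using low[of X] eC X by (simp add: mult.assoc)
      have "\<bar>P (a - e) X - P a X\<bar> \<le> 2 * \<bar>(a - e) - a\<bar> * exp (\<bar>M\<bar> * X)" by (rule depP) (use X in auto)
      moreover have "2 * \<bar>(a - e) - a\<bar> * exp (\<bar>M\<bar> * X) = e * C" using e by (simp add: C_def)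
      ultimately have "P a X - e * C \<le> P (a - e) X" by linarith
      then show "0 < P (a - e) X" using eC by linarith
      fix x assume x: "0 \<le> x" "x \<le> X"
      show "h x \<le> W (a - e) x"
      proof (cases "x = 0")
        case True then show ?thesis by (simp add: primitiveD(1)[OF pr] primitiveD(1)[OF hp])
      next
        case False
        have "e * C \<le> (W a x - h x) / x" using eC(1) z(2)[of x] x False by (simp add: N_def)
        then have "e * C * x \<le> W a x - h x" using x False by (simp add: field_simps)
        then show ?thesis using low[OF x] by linarith
      qed
    qed
    then have "a \<le> a - e" unfolding a_def using bdd by (intro cInf_lower)
    then show False using e by simp
  qed
  have z0: "0 < z" using z(1) Nz aq by (cases "z = 0") (auto simp: N_def)
  have Wz: "W a z = h z" using Nz z0 by (simp add: N_def)
  have "P a z - q z = 0"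
  proof (rule DERIV_local_min[OF DERIV_diff[OF primitiveD(2)[OF pr] primitiveD(2)[OF hp]] z0])
    show "\<forall>y. \<bar>z - y\<bar> < z \<longrightarrow> W a z - h z \<le> W a y - h y" using ah by (auto simp: Wz)
  qed
  then have Pz: "P a z = q z" by simp
  have "q z \<le> 1"
  proof (rule ccontr)
    assume "\<not> q z \<le> 1"
    then obtain x where "z < x" "W a x < h x"
      using no_contact_above_1[OF h c(2) b pr so, of z] z0 Wz Pz by auto
    then show False using ah[of x] z0 by simp
  qed
  then show ?thesis using pr so P0 ah z0 Wz Pz aq profileD(5)[OF h]
    by (intro that[of "W a" "P a" z]) auto
qed

text \<open>Values and slopes agree at the contact point, so the glued function is continuously
  differentiable. The estimates on the new stretch come from the absence of interior extrema of its
  slope, the boundary slopes being above 1 at 0 and between 0 and 1 at the contact.\<close>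

lemma step_exists:
  assumes h: "profile c' h q" and c: "0 \<le> c" "c < c'" "c' \<le> cb"
  shows "\<exists>f p. profile c f p \<and> (\<forall>x\<ge>0. h x \<le> f x) \<and> (\<exists>z\<ge>0. solves c f p z \<and> (\<forall>x\<ge>z. f x = h x))"
proof (cases "b = 0")
  case True
  \<comment> \<open>For \<open>b = 0\<close> the step changes nothing: the stretch is the degenerate
    interval \<open>[0, 0]\<close>.\<close>
  have "solves c h q 0" unfolding solves_def using order_antisym by force
  then show ?thesis using profile_lower_level_degenerate[OF h c True] by (intro exI[of _ h] exI[of _ q]) auto
next
  case False
  then have b: "b > 0" using b0 by simp
  note hp = profileD(1)[OF h]
  obtain w P z where w: "primitive w P" and sw: "\<And>z. solves c w P z" and P0: "\<And>x. x \<le> 0 \<Longrightarrow> P x = P 0"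
    and hw: "\<And>x. 0 \<le> x \<Longrightarrow> h x \<le> w x" and z: "0 < z" "w z = h z" "P z = q z" "q z \<le> 1" and P1: "1 < P 0"
    by (rule contact_point_exists[OF h c b]) blast
  define f where "f x = (if x \<le> z then w x else h x)" for x
  define p where "p x = (if x \<le> z then P x else q x)" for x
  have prim: "primitive f p"
    unfolding primitive_def
  proof (intro conjI allI)
    show "f 0 = 0" using z by (simp add: f_def primitiveD(1)[OF w])
    show "(f has_real_derivative p x) (at x)" for x
      unfolding f_def[abs_def] p_def
      by (rule DERIV_glue) (use z primitiveD(2)[OF w] primitiveD(2)[OF hp] in auto)
    show "continuous_on UNIV p" unfolding p_def[abs_def]
      by (rule continuous_on_cases_le) (use z primitiveD(3)[OF w] primitiveD(3)[OF hp] in auto)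
  qed
  have q1: "q x \<le> 1" if "z \<le> x" for x using profileD(4)[OF h, of z x] z that by auto
  have pq: "p x = q x" if "z \<le> x" for x using that z by (cases "x = z") (auto simp: p_def)
  have left: "integral {x..y} (\<lambda>t. F c (f t) (p t)) = integral {x..y} (\<lambda>t. F c (w t) (P t))" if "y \<le> z" for x y
    using that by (intro integral_cong) (auto simp: f_def p_def)
  have right: "integral {x..y} (\<lambda>t. F c (f t) (p t)) = integral {x..y} (\<lambda>t. F c (h t) (q t))" if "z \<le> x" for x y
  proof (intro integral_cong)
    fix t assume "t \<in> {x..y}"
    then have "f t = h t" "p t = q t" using that z by (cases "t = z"; simp add: f_def p_def)+
    then show "F c (f t) (p t) = F c (h t) (q t)" by simp
  qed
  have sf: "solves c f p z"
    unfolding solves_def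
  proof (intro allI impI)
    fix x y assume "0 \<le> x \<and> x \<le> y \<and> y \<le> z"
    then show "p y - p x = integral {x..y} (\<lambda>t. F c (f t) (p t))"
      using solvesD[OF sw[of z], of x y] left[of y x] by (simp add: p_def)
  qed
  have Ppos: "0 \<le> P x" if x: "0 \<le> x" "x \<le> z" for x
  proof (rule ccontr)
    assume "\<not> 0 \<le> P x"
    obtain t where t: "t \<in> {0..z}" "\<And>y. y \<in> {0..z} \<Longrightarrow> P t \<le> P y"
      using continuous_attains_inf[of "{0..z}" P] primitiveD(3)[OF w] z by auto
    have neg: "P t < 0" using t(2)[of x] x \<open>\<not> 0 \<le> P x\<close> by auto
    \<comment> \<open>The minimum is interior, because the slope exceeds 1 at 0 and is
      \<open>q z \<ge> 0\<close> at the contact.\<close>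
    then have ti: "0 < t" "t < z" using t(1) P1 z profileD(2)[OF h, of z] by (auto simp: less_le)
    have "\<exists>d>0. \<forall>y. \<bar>t - y\<bar> < d \<longrightarrow> P t \<le> P y"
      using ti by (intro exI[of _ "min t (z - t)"]) (auto intro!: t(2))
    then show False using no_interior_extremum(2)[OF w sw ti(1) neg] by blast
  qed
  have Pmax: "P y \<le> max (P x) 1" if xy: "0 \<le> x" "x \<le> y" "y \<le> z" for x y
  proof (rule ccontr)
    assume gt: "\<not> P y \<le> max (P x) 1"
    obtain t where t: "t \<in> {x..z}" "\<And>y. y \<in> {x..z} \<Longrightarrow> P y \<le> P t"
      using continuous_attains_sup[of "{x..z}" P] primitiveD(3)[OF w] xy by auto
    have big: "P x < P t" "1 < P t" using t(2)[of y] xy gt by auto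
    then have ti: "x < t" "t < z" using t(1) z by (auto simp: less_le)
    have "\<exists>d>0. \<forall>y. \<bar>t - y\<bar> < d \<longrightarrow> P y \<le> P t"
      using ti by (intro exI[of _ "min (t - x) (z - t)"]) (auto intro!: t(2))
    then show False using no_interior_extremum(1)[OF w sw _ _] ti big xy by (metis le_less_trans less_trans zero_less_one)
  qed
  have ppos: "0 \<le> p x" if "0 \<le> x" for x using Ppos[OF that] profileD(2)[OF h that] by (simp add: p_def)
  have fle: "f x \<le> cb / r" if "0 \<le> x" for x
  proof (cases "x \<le> z")
    case True
    have "f x \<le> f z" by (rule primitive_nonneg[OF prim ppos that True])
    then show ?thesis using z profileD(3)[OF h, of z] by (simp add: f_def)
  qed (use profileD(3)[OF h that] in \<open>simp add: f_def\<close>)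
  have f0: "0 \<le> f x" if "0 \<le> x" for x using primitive_nonneg[OF prim ppos _ that] primitiveD(1)[OF prim] by simp
  have solv: "solves c f p x" if "0 \<le> x" "1 < p x" for x
  proof -
    have "x \<le> z" using q1[of x] that(2) by (auto simp: p_def split: if_splits)
    then show ?thesis by (rule solves_mono[OF sf])
  qed
  have pmax: "p y \<le> max (p x) 1" if xy: "0 \<le> x \<and> x \<le> y" for x y
  proof (cases "y \<le> z")
    case True then show ?thesis using Pmax[of x y] xy by (simp add: p_def)
  next
    case False then show ?thesis using q1[of y] by (simp add: p_def)
  qed
  \<comment> \<open>The bound is derived afresh from the invariant instead of being inherited from
    \<open>h\<close>, so it does not deteriorate from step to step.\<close>
  have K: "p 0 \<le> K1" using slope_at_0_bound[OF prim ppos fle solv] c by simp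
  have pK: "p x \<le> K1" if "0 \<le> x" for x using pmax[of 0 x] that K K1_ge by auto
  have "profile c f p"
    unfolding profile_def
  proof (intro conjI allI impI prim)
    show "1 < p 0" using z P1 by (simp add: p_def)
    show "p y \<le> max (p x) 1" if "0 \<le> x \<and> x \<le> y" for x y by (rule pmax[OF that])
    show "supersol c f p"
      unfolding supersol_def
    proof (intro allI impI)
      fix x y :: real assume xy: "0 \<le> x \<and> x \<le> y"
      have R: "p t - p s \<le> integral {s..t} (\<lambda>t. F c (f t) (p t))" if "z \<le> s" "s \<le> t" for s t
      proof -
        have "p t - p s = q t - q s" using pq[of s] pq[of t] that by simp
        also have "\<dots> \<le> integral {s..t} (\<lambda>t. F c' (h t) (q t))" using supersolD[OF profileD(6)[OF h]] that z by simp
        also have "\<dots> \<le> integral {s..t} (\<lambda>t. F c (h t) (q t))"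
        proof (intro integral_le primitive_integrable[OF hp] F_level_mono)
          fix x assume "x \<in> {s..t}"
          then have "q x \<le> 1" using q1[of x] that by auto
          then show "0 \<le> T (q x)" by (simp add: T_le1)
        qed (use c in auto)
        finally show ?thesis using right[OF that(1)] by simp
      qed
      consider "y \<le> z" | "z \<le> x" | "x \<le> z" "z \<le> y" by linarith
      then show "p y - p x \<le> integral {x..y} (\<lambda>t. F c (f t) (p t))"
      proof cases
        case 1 then show ?thesis using solvesD[OF sf, of x y] xy by simp
      next
        case 2 then show ?thesis using R xy by simp
      next
        case 3
        have "integral {x..z} (\<lambda>t. F c (f t) (p t)) + integral {z..y} (\<lambda>t. F c (f t) (p t)) = integral {x..y} (\<lambda>t. F c (f t) (p t))"
          using 3 by (intro Henstock_Kurzweil_Integration.integral_combine primitive_integrable[OF prim])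
        then show ?thesis using R[of z y] solvesD[OF sf, of x z] 3 xy by simp
      qed
    qed
    show "K2-lipschitz_on UNIV p"
    proof (rule lipschitz_from_halfline[OF _ K2_nonneg])
      show "p x = p 0" if "x \<le> 0" for x using that z P0[of x] by (simp add: p_def)
      fix x y :: real assume xy: "0 \<le> x" "x \<le> y"
      have L: "\<bar>p t - p s\<bar> \<le> K2 * (t - s)" if "0 \<le> s" "s \<le> t" "t \<le> z" for s t
        by (rule solves_lipschitz[OF prim sf]) (use that c fle f0 ppos pK in auto)
      have R: "\<bar>p t - p s\<bar> \<le> K2 * (t - s)" if "z \<le> s" "s \<le> t" for s t
      proof -
        have "p t - p s = q t - q s" using pq[of s] pq[of t] that by simp
        then show ?thesis using lipschitz_onD[OF profileD(8)[OF h], of t s] that by (simp add: dist_real_def)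
      qed
      consider "y \<le> z" | "z \<le> x" | "x \<le> z" "z \<le> y" by linarith
      then show "\<bar>p y - p x\<bar> \<le> K2 * (y - x)"
      proof cases
        case 3
        have "\<bar>p y - p x\<bar> \<le> \<bar>p y - p z\<bar> + \<bar>p z - p x\<bar>" by simp
        also have "\<dots> \<le> K2 * (y - z) + K2 * (z - x)" using L[of x z] R[of z y] 3 xy by simp
        finally show ?thesis by (simp add: algebra_simps)
      qed (use L R xy in auto)
    qed
    show "g x \<le> f x" if "0 \<le> x" for x
      using profileD(9)[OF h that] hw[OF that] by (auto simp: f_def)
  qed (use ppos fle solv in auto)
  moreover have "\<forall>x\<ge>0. h x \<le> f x" using hw by (simp add: f_def)
  moreover have "\<exists>z\<ge>0. solves c f p z \<and> (\<forall>x\<ge>z. f x = h x)"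
    using sf z by (intro exI[of _ z]) (auto simp: f_def)
  ultimately show ?thesis by blast
qed

end

text \<open>A Taylor estimate with a fixed constant passes to pointwise limits; this lemma turns it
  back into differentiability of the limit.\<close>

lemma DERIV_if_quadratic:
  fixes f :: "real \<Rightarrow> real"
  assumes d: "0 < d" and K: "0 \<le> K" and le: "\<And>y. \<bar>y - x\<bar> < d \<Longrightarrow> \<bar>f y - f x - D * (y - x)\<bar> \<le> K * (y - x)\<^sup>2"
  shows "(f has_real_derivative D) (at x)"
  unfolding has_field_derivative_def has_derivative_at_alt
proof (intro conjI allI impI)
  show "bounded_linear ((*) D)" by (rule bounded_linear_mult_right)
  fix e :: real assume e: "0 < e"
  show "\<exists>d>0. \<forall>y. norm (y - x) < d \<longrightarrow> norm (f y - f x - D * (y - x)) \<le> e * norm (y - x)"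
  proof (intro exI[of _ "min d (e / (K + 1))"] conjI allI impI)
    fix y assume y: "norm (y - x) < min d (e / (K + 1))"
    have "\<bar>f y - f x - D * (y - x)\<bar> \<le> K * (y - x)\<^sup>2" using le y by simp
    also have "\<dots> = (K * \<bar>y - x\<bar>) * \<bar>y - x\<bar>" by (simp add: power2_eq_square)
    also have "\<dots> \<le> e * \<bar>y - x\<bar>"
    proof (rule mult_right_mono)
      have "K * \<bar>y - x\<bar> \<le> (K + 1) * \<bar>y - x\<bar>" by (intro mult_right_mono) auto
      also have "\<dots> \<le> e" using y K by (simp add: field_simps)
      finally show "K * \<bar>y - x\<bar> \<le> e" .
    qed auto
    finally show "norm (f y - f x - D * (y - x)) \<le> e * norm (y - x)" by simp
  qed (use d e K in auto)
qed

context ratcheting begin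


text \<open>Comparison across different rates: \<open>e\<close> is the defect in the second
  derivative caused by the change of rate. It is 0 for minimality of a step, and proportional to
  \<open>c' - c\<close> for the increment of a step.\<close>

lemma solves_le_supersol:
  assumes f: "primitive f p" "solves c f p z" and h: "primitive h q" "supersol c' h q" and z: "0 \<le> z"
    and pt: "\<And>t. 0 \<le> t \<Longrightarrow> t \<le> z \<Longrightarrow>
      \<rho> * (f t - h t) - B * \<bar>p t - q t\<bar> - e \<le> F c (f t) (p t) - F c' (h t) (q t)"
    and e: "0 \<le> e" "f z - h z \<le> e / \<rho>" and x: "0 \<le> x" "x \<le> z"
  shows "f x - h x \<le> e / \<rho>"
proof (rule maximum_principle[of "\<lambda>x. f x - h x" "\<lambda>x. p x - q x" \<rho> 0 z B])
  show "((\<lambda>x. f x - h x) has_real_derivative p x - q x) (at x)" for x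
    by (intro DERIV_diff primitiveD(2)[OF f(1)] primitiveD(2)[OF h(1)])
  show "continuous_on UNIV (\<lambda>x. p x - q x)" by (intro continuous_intros primitiveD[OF f(1)] primitiveD[OF h(1)])
  show "f 0 - h 0 \<le> e / \<rho>" using e rho_pos by (simp add: primitiveD(1)[OF f(1)] primitiveD(1)[OF h(1)])
  fix s t assume st: "0 \<le> s" "s \<le> t" "t \<le> z"
  have "integral {s..t} (\<lambda>t. \<rho> * (f t - h t) - B * \<bar>p t - q t\<bar> - e) \<le>
      integral {s..t} (\<lambda>t. F c (f t) (p t) - F c' (h t) (q t))"
    using st pt by (intro integral_le integrable_continuous_real continuous_intros primitiveD[OF f(1)] primitiveD[OF h(1)]) auto
  also have "\<dots> = (p t - p s) - integral {s..t} (\<lambda>t. F c' (h t) (q t))"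
    using solvesD[OF f(2) st]
    by (simp add: Henstock_Kurzweil_Integration.integral_diff primitive_integrable[OF f(1)] primitive_integrable[OF h(1)])
  also have "\<dots> \<le> (p t - q t) - (p s - q s)" using supersolD[OF h(2) st(1,2)] by simp
  finally show "integral {s..t} (\<lambda>t. \<rho> * (f t - h t) - B * \<bar>p t - q t\<bar> - e) \<le> (p t - q t) - (p s - q s)" .
qed (use rho_pos e x in auto)

text \<open>Minimality among the profiles above \<open>h\<close> is not part of the definition; it
  follows by comparison from the equation up to \<open>z\<close> and equality with \<open>h\<close>
  beyond.\<close>

definition is_step :: "real \<Rightarrow> (real \<Rightarrow> real) \<Rightarrow> (real \<Rightarrow> real) \<Rightarrow> (real \<Rightarrow> real) \<Rightarrow> bool" where
  "is_step c h f p \<longleftrightarrow> profile c f p \<and> (\<forall>x\<ge>0. h x \<le> f x) \<and> (\<exists>z\<ge>0. solves c f p z \<and> (\<forall>x\<ge>z. f x = h x))"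

text \<open>Up to \<open>z\<close> a solution is compared with a supersolution, and beyond
  \<open>z\<close> the claim is the premise on \<open>u\<close>. Through this lemma refining the
  grid can only raise the profiles.\<close>

lemma step_least:
  assumes s: "is_step c h f p" and c: "0 \<le> c" "c \<le> cb" and u: "profile c u w" and hu: "\<And>x. 0 \<le> x \<Longrightarrow> h x \<le> u x" and x: "0 \<le> x"
  shows "f x \<le> u x"
proof -
  obtain z where z: "0 \<le> z" "solves c f p z" "\<And>x. z \<le> x \<Longrightarrow> f x = h x" and fg: "profile c f p"
    using s unfolding is_step_def by blast
  show ?thesis
  proof (cases "x \<le> z")
    case True
    have "f x - u x \<le> 0 / \<rho>"
    proof (rule solves_le_supersol[OF profileD(1)[OF fg] z(2) profileD(1)[OF u] profileD(6)[OF u] z(1)])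
      show "\<rho> * (f t - u t) - B * \<bar>p t - w t\<bar> - 0 \<le> F c (f t) (p t) - F c (u t) (w t)" for t
        using F_diff(1)[OF c] by simp
      show "f z - u z \<le> 0 / \<rho>" using z hu by simp
    qed (use x True in auto)
    then show ?thesis by simp
  next
    case False
    then show ?thesis using z(3)[of x] hu[OF x] by simp
  qed
qed

text \<open>Slopes of \<open>h\<close> are at most \<open>K1\<close>, so \<open>T\<close> is at
  least \<open>- K1\<close> there, and passing from \<open>c'\<close> to \<open>c\<close> lowers the
  right side of the equation for \<open>h\<close> by at most \<open>e\<close>. The maximum principle
  converts this into \<open>e / \<rho>\<close>, linear in the step size.\<close>

lemma step_increment:
  assumes s: "is_step c h f p" and h: "profile c' h q" and c: "0 \<le> c" "c \<le> c'" "c' \<le> cb" and x: "0 \<le> x"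
  shows "f x - h x \<le> K1 / r * (c' - c)"
proof -
  obtain z where z: "0 \<le> z" "solves c f p z" "\<And>x. z \<le> x \<Longrightarrow> f x = h x" and fg: "profile c f p"
    using s unfolding is_step_def by blast
  define e where "e = 2 / \<sigma>\<^sup>2 * ((c' - c) * K1)"
  have e0: "0 \<le> e" unfolding e_def using c K1_ge by simp
  have e: "e / \<rho> = K1 / r * (c' - c)" using r sigma by (simp add: e_def \<rho>_def field_simps)
  show ?thesis
  proof (cases "x \<le> z")
    case True
    have "f x - h x \<le> e / \<rho>"
    proof (rule solves_le_supersol[OF profileD(1)[OF fg] z(2) profileD(1)[OF h] profileD(6)[OF h] z(1)])
      show "f z - h z \<le> e / \<rho>" using z e0 rho_pos by simp
      fix t assume t: "0 \<le> t" "t \<le> z"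
      have q: "q t \<le> K1" using profile_slope_le[OF h _ _ t(1)] c by simp
      have "- K1 \<le> T (q t)"
      proof (cases "q t \<le> 1")
        case True then show ?thesis using K1_ge by (simp add: T_le1)
      next
        case False
        then have "b * (q t - 1) \<le> 1 * (q t - 1)" using b1 by (intro mult_right_mono) auto
        then show ?thesis using False q by (simp add: T_ge1 algebra_simps)
      qed
      then have "2 / \<sigma>\<^sup>2 * ((c' - c) * - K1) \<le> 2 / \<sigma>\<^sup>2 * ((c' - c) * T (q t))"
        using c by (intro mult_left_mono) auto
      then have "- e \<le> F c (h t) (q t) - F c' (h t) (q t)" unfolding F_diff_level e_def by simp
      then show "\<rho> * (f t - h t) - B * \<bar>p t - q t\<bar> - e \<le> F c (f t) (p t) - F c' (h t) (q t)"
        using F_diff(1)[of c "f t" "h t" "p t" "q t"] c by simp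
    qed (use x True e0 z rho_pos in auto)
    then show ?thesis unfolding e .
  next
    case False
    then show ?thesis using z(3)[of x] c K1_ge r by simp
  qed
qed

section \<open>The dyadic scheme and its limit\<close>

definition level :: "nat \<Rightarrow> nat \<Rightarrow> real" where "level n k = cb * (1 - real k / 2 ^ n)"

text \<open>Meaningful for \<open>k \<le> 2 ^ n\<close> only: afterwards the rate would be negative and the choice is arbitrary.\<close>
primrec V :: "nat \<Rightarrow> nat \<Rightarrow> (real \<Rightarrow> real) \<times> (real \<Rightarrow> real)" where
  "V n 0 = (g, gp)"
| "V n (Suc k) = (SOME s. is_step (level n (Suc k)) (fst (V n k)) (fst s) (snd s))"

lemma level_bounds:
  fixes n k :: nat
  shows "k \<le> 2 ^ n \<Longrightarrow> 0 \<le> level n k" "level n k \<le> cb" "level n (Suc k) < level n k"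
proof -
  show "0 \<le> level n k" if "k \<le> 2 ^ n"
  proof -
    have "real k \<le> 2 ^ n" using that by (metis of_nat_le_iff of_nat_numeral of_nat_power)
    then show ?thesis using cb by (simp add: level_def)
  qed
  show "level n k \<le> cb" "level n (Suc k) < level n k" using cb by (simp_all add: level_def divide_strict_right_mono)
qed

lemma V_profile: "k \<le> 2 ^ n \<Longrightarrow> profile (level n k) (fst (V n k)) (snd (V n k))"
  and V_step: "Suc k \<le> 2 ^ n \<Longrightarrow> is_step (level n (Suc k)) (fst (V n k)) (fst (V n (Suc k))) (snd (V n (Suc k)))"
proof -
  have step: "is_step (level n (Suc k)) (fst (V n k)) (fst (V n (Suc k))) (snd (V n (Suc k)))"
    if k: "Suc k \<le> 2 ^ n" and g: "profile (level n k) (fst (V n k)) (snd (V n k))" for k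
  proof -
    obtain f p where "is_step (level n (Suc k)) (fst (V n k)) f p"
      using step_exists[OF g level_bounds(1)[OF k] level_bounds(3,2)] unfolding is_step_def by blast
    then have "is_step (level n (Suc k)) (fst (V n k)) (fst (f, p)) (snd (f, p))" by simp
    then show ?thesis unfolding V.simps by (rule someI)
  qed
  show *: "k \<le> 2 ^ n \<Longrightarrow> profile (level n k) (fst (V n k)) (snd (V n k))" for k
  proof (induction k)
    case 0 then show ?case using profile_g by (simp add: level_def)
  next
    case (Suc k)
    then show ?case using step[of k] unfolding is_step_def by simp
  qed
  show "Suc k \<le> 2 ^ n \<Longrightarrow> is_step (level n (Suc k)) (fst (V n k)) (fst (V n (Suc k))) (snd (V n (Suc k)))"
    using step *[of k] by simp
qed

lemma V_increment:
  assumes "k + m \<le> 2 ^ n" "0 \<le> x"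
  shows "0 \<le> fst (V n (k + m)) x - fst (V n k) x"
    and "fst (V n (k + m)) x - fst (V n k) x \<le> K1 / r * (level n k - level n (k + m))"
proof -
  have "0 \<le> fst (V n (k + m)) x - fst (V n k) x \<and>
    fst (V n (k + m)) x - fst (V n k) x \<le> K1 / r * (level n k - level n (k + m))"
    using assms(1)
  proof (induction m)
    case (Suc m)
    let ?j = "k + m"
    have s: "is_step (level n (Suc ?j)) (fst (V n ?j)) (fst (V n (Suc ?j))) (snd (V n (Suc ?j)))"
      using Suc.prems by (intro V_step) simp
    have "fst (V n ?j) x \<le> fst (V n (Suc ?j)) x" using s assms(2) unfolding is_step_def by blast
    moreover have "fst (V n (Suc ?j)) x - fst (V n ?j) x \<le> K1 / r * (level n ?j - level n (Suc ?j))"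
      using Suc.prems assms(2) level_bounds[where n = n and k = "Suc ?j"] level_bounds[where n = n and k = ?j]
      by (intro step_increment[OF s V_profile]) auto
    ultimately show ?case using Suc by (simp add: algebra_simps)
  qed simp
  then show "0 \<le> fst (V n (k + m)) x - fst (V n k) x"
    "fst (V n (k + m)) x - fst (V n k) x \<le> K1 / r * (level n k - level n (k + m))" by auto
qed

lemma V_mono: "k \<le> j \<Longrightarrow> j \<le> 2 ^ n \<Longrightarrow> 0 \<le> x \<Longrightarrow> fst (V n k) x \<le> fst (V n j) x"
  using V_increment(1)[of k "j - k" n x] by simp

lemma V_lipschitz:
  "k \<le> j \<Longrightarrow> j \<le> 2 ^ n \<Longrightarrow> 0 \<le> x \<Longrightarrow> fst (V n j) x - fst (V n k) x \<le> K1 / r * (level n k - level n j)"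
  using V_increment(2)[of k "j - k" n x] by simp

lemma level_refine: "level (Suc n) (2 * k) = level n k"
  by (simp add: level_def)

text \<open>By induction the finer profile at the rate \<open>level n (Suc k)\<close> lies above the
  coarse profile at the preceding rate, and the coarse step is the least profile with this
  property.\<close>

lemma V_refine: "k \<le> 2 ^ n \<Longrightarrow> 0 \<le> x \<Longrightarrow> fst (V n k) x \<le> fst (V (Suc n) (2 * k)) x"
proof (induction k arbitrary: x)
  case (Suc k)
  have s: "is_step (level n (Suc k)) (fst (V n k)) (fst (V n (Suc k))) (snd (V n (Suc k)))"
    using Suc.prems by (intro V_step)
  show ?case
  proof (rule step_least[OF s])
    show "profile (level n (Suc k)) (fst (V (Suc n) (2 * Suc k))) (snd (V (Suc n) (2 * Suc k)))"
      using V_profile[of "2 * Suc k" "Suc n"] Suc.prems unfolding level_refine by simp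
    fix y :: real assume y: "0 \<le> y"
    have "fst (V n k) y \<le> fst (V (Suc n) (2 * k)) y" using Suc y by simp
    also have "\<dots> \<le> fst (V (Suc n) (2 * Suc k)) y" using Suc.prems y by (intro V_mono) auto
    finally show "fst (V n k) y \<le> fst (V (Suc n) (2 * Suc k)) y" .
  qed (use Suc.prems level_bounds in auto)
qed simp

text \<open>The number of steps from \<open>cb\<close> down to the lowest grid rate that is still at
  least \<open>c\<close>.\<close>

definition idx :: "nat \<Rightarrow> real \<Rightarrow> nat" where "idx n c = nat \<lfloor>2 ^ n * (1 - c / cb)\<rfloor>"

lemma idx_bounds:
  assumes "0 \<le> c" "c \<le> cb"
  shows "idx n c \<le> 2 ^ n" "c \<le> level n (idx n c)" "level n (idx n c) < c + cb / 2 ^ n"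
proof -
  have t: "0 \<le> 1 - c / cb" "1 - c / cb \<le> 1" using assms cb by auto
  then have "0 \<le> 2 ^ n * (1 - c / cb)" by simp
  then have i: "real (idx n c) \<le> 2 ^ n * (1 - c / cb)" "2 ^ n * (1 - c / cb) < real (idx n c) + 1"
    unfolding idx_def by linarith+
  have "2 ^ n * (1 - c / cb) \<le> 2 ^ n * 1" using t by (intro mult_left_mono) auto
  then have "real (idx n c) \<le> real (2 ^ n)" using i(1) unfolding of_nat_power of_nat_numeral by linarith
  then show "idx n c \<le> 2 ^ n" by (simp only: of_nat_le_iff)
  have 1: "real (idx n c) / 2 ^ n \<le> 1 - c / cb" using i(1) by (simp add: divide_le_eq mult.commute)
  have "cb * (c / cb) \<le> cb * (1 - real (idx n c) / 2 ^ n)" using 1 cb by (intro mult_left_mono) auto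
  then show "c \<le> level n (idx n c)" using cb by (simp add: level_def)
  have "1 - c / cb < (real (idx n c) + 1) / 2 ^ n" using i(2) by (simp add: less_divide_eq mult.commute)
  then have "1 - real (idx n c) / 2 ^ n < c / cb + 1 / 2 ^ n" by (simp add: add_divide_distrib)
  then have "cb * (1 - real (idx n c) / 2 ^ n) < cb * (c / cb + 1 / 2 ^ n)" using cb by (intro mult_strict_left_mono) auto
  then show "level n (idx n c) < c + cb / 2 ^ n" using cb by (simp add: level_def distrib_left)
qed

lemma idx_antimono: "c \<le> c' \<Longrightarrow> idx n c' \<le> idx n c"
  unfolding idx_def using cb by (intro nat_mono floor_mono mult_left_mono) (auto simp: divide_right_mono)

lemma idx_refine: "2 * idx n c \<le> idx (Suc n) c"
proof (cases "0 \<le> 2 ^ n * (1 - c / cb)")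
  case True
  have "2 * \<lfloor>2 ^ n * (1 - c / cb)\<rfloor> \<le> \<lfloor>2 ^ Suc n * (1 - c / cb)\<rfloor>"
  proof (rule le_floor_iff[THEN iffD2])
    have "real_of_int (2 * \<lfloor>2 ^ n * (1 - c / cb)\<rfloor>) \<le> 2 * (2 ^ n * (1 - c / cb))" by simp
    then show "real_of_int (2 * \<lfloor>2 ^ n * (1 - c / cb)\<rfloor>) \<le> 2 ^ Suc n * (1 - c / cb)" by simp
  qed
  then show ?thesis unfolding idx_def by linarith
next
  case False
  then have "\<lfloor>2 ^ n * (1 - c / cb)\<rfloor> < 0" by simp
  then show ?thesis by (simp add: idx_def)
qed

section \<open>Convergence of values and slopes\<close>

definition vn :: "nat \<Rightarrow> real \<Rightarrow> real \<Rightarrow> real" where "vn n c = fst (V n (idx n c))"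
definition pn :: "nat \<Rightarrow> real \<Rightarrow> real \<Rightarrow> real" where "pn n c = snd (V n (idx n c))"

lemma profile_vn: "0 \<le> c \<Longrightarrow> c \<le> cb \<Longrightarrow> profile (level n (idx n c)) (vn n c) (pn n c)"
  unfolding vn_def pn_def by (intro V_profile idx_bounds)

lemma incseq_vn:
  assumes c: "0 \<le> c" "c \<le> cb" and x: "0 \<le> x"
  shows "incseq (\<lambda>n. vn n c x)"
proof (rule incseq_SucI)
  fix n
  have "vn n c x \<le> fst (V (Suc n) (2 * idx n c)) x" unfolding vn_def using idx_bounds(1)[OF c] x by (intro V_refine)
  also have "\<dots> \<le> vn (Suc n) c x" unfolding vn_def using idx_bounds(1)[OF c, of "Suc n"] x idx_refine by (intro V_mono) auto
  finally show "vn n c x \<le> vn (Suc n) c x" .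
qed

definition vlim :: "real \<Rightarrow> real \<Rightarrow> real" where "vlim c x = lim (\<lambda>n. vn n c x)"

lemma vn_LIMSEQ:
  assumes c: "0 \<le> c" "c \<le> cb" and x: "0 \<le> x"
  shows "(\<lambda>n. vn n c x) \<longlonglongrightarrow> vlim c x"
proof -
  have "\<forall>n. vn n c x \<le> cb / r" using profileD(3)[OF profile_vn[OF c] x] by blast
  then have "convergent (\<lambda>n. vn n c x)" using incseq_convergent[OF incseq_vn[OF c x]] convergentI by metis
  then show ?thesis unfolding vlim_def by (rule convergent_LIMSEQ_iff[THEN iffD1])
qed

lemma level_idx_LIMSEQ:
  assumes c: "0 \<le> c" "c \<le> cb"
  shows "(\<lambda>n. level n (idx n c)) \<longlonglongrightarrow> c"
proof (rule tendsto_sandwich[of "\<lambda>_. c" _ _ "\<lambda>n. c + cb * (1 / 2) ^ n"])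
  show "(\<lambda>n. c + cb * (1 / 2) ^ n) \<longlonglongrightarrow> c"
    using tendsto_add[OF tendsto_const tendsto_mult[OF tendsto_const LIMSEQ_realpow_zero[of "1/2"]], of c cb] by simp
  show "eventually (\<lambda>n. level n (idx n c) \<le> c + cb * (1 / 2) ^ n) sequentially"
    using idx_bounds(3)[OF c] by (intro always_eventually allI less_imp_le) (simp add: power_divide)
qed (use idx_bounds(2)[OF c] in auto)

lemma slope_taylor:
  assumes f: "profile c f p" and x: "0 \<le> x" "0 \<le> y"
  shows "\<bar>f y - f x - p x * (y - x)\<bar> \<le> K2 * (y - x)\<^sup>2"
proof -
  have lip: "\<bar>p t - p x\<bar> \<le> K2 * \<bar>t - x\<bar>" for t
    using lipschitz_onD[OF profileD(8)[OF f], of t x] by (simp add: dist_real_def)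
  note d = primitiveD(2)[OF profileD(1)[OF f]]
  have "\<exists>t. \<bar>t - x\<bar> \<le> \<bar>y - x\<bar> \<and> f y - f x = p t * (y - x)"
  proof -
    consider "x < y" | "y < x" | "x = y" by linarith
    then show ?thesis
    proof cases
      case 1
      then obtain t where "x < t" "t < y" "f y - f x = (y - x) * p t" using MVT2[of x y f p] d by auto
      then show ?thesis by (intro exI[of _ t]) (auto simp: mult.commute)
    next
      case 2
      then obtain t where "y < t" "t < x" "f x - f y = (x - y) * p t" using MVT2[of y x f p] d by auto
      then show ?thesis by (intro exI[of _ t]) (auto simp: algebra_simps)
    qed auto
  qed
  then obtain t where t: "\<bar>t - x\<bar> \<le> \<bar>y - x\<bar>" "f y - f x = p t * (y - x)" by blast
  have "\<bar>f y - f x - p x * (y - x)\<bar> = \<bar>p t - p x\<bar> * \<bar>y - x\<bar>" unfolding t(2) by (simp add: abs_mult flip: left_diff_distrib)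
  also have "\<dots> \<le> (K2 * \<bar>y - x\<bar>) * \<bar>y - x\<bar>"
    using lip[of t] t(1) K2_nonneg by (intro mult_right_mono) (auto intro: order_trans mult_left_mono)
  also have "\<dots> = K2 * (y - x)\<^sup>2" by (simp add: power2_eq_square)
  finally show ?thesis .
qed

text \<open>Values that are close at two points a distance \<open>h\<close> apart determine the
  slope up to the curvature error. Balancing the two terms by the choice of \<open>h\<close> turns
  closeness of values into closeness of slopes.\<close>

lemma slope_difference:
  assumes f: "\<bar>f1 y - f1 x - a1 * (y - x)\<bar> \<le> K2 * (y - x)\<^sup>2" "\<bar>f2 y - f2 x - a2 * (y - x)\<bar> \<le> K2 * (y - x)\<^sup>2"
    and h: "0 < h" "y = x + h" and \<delta>: "\<bar>f1 x - f2 x\<bar> \<le> \<delta>" "\<bar>f1 y - f2 y\<bar> \<le> \<delta>"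
  shows "\<bar>a1 - a2\<bar> \<le> 2 * \<delta> / h + 2 * K2 * h"
proof -
  have "\<bar>(a1 - a2) * h\<bar> \<le> 2 * \<delta> + 2 * K2 * h\<^sup>2"
  proof -
    have "\<bar>f1 (x + h) - f1 x - a1 * h\<bar> \<le> K2 * h\<^sup>2" "\<bar>f2 (x + h) - f2 x - a2 * h\<bar> \<le> K2 * h\<^sup>2"
      "\<bar>f1 (x + h) - f2 (x + h)\<bar> \<le> \<delta>" using f \<delta>(2) unfolding h(2) by simp_all
    then show ?thesis using \<delta>(1) unfolding left_diff_distrib by linarith
  qed
  then have "\<bar>a1 - a2\<bar> * h \<le> (2 * \<delta> / h + 2 * K2 * h) * h"
    using h by (simp add: abs_mult power2_eq_square distrib_right)
  then show ?thesis using h by (simp add: mult_le_cancel_right)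
qed

lemma slope_convergent:
  assumes f: "\<And>m. profile (d m) (f m) (p m)" and \<phi>: "\<And>x. 0 \<le> x \<Longrightarrow> (\<lambda>m. f m x) \<longlonglongrightarrow> \<phi> x" and x: "0 \<le> x"
  shows "convergent (\<lambda>m. p m x)"
proof (rule Cauchy_convergent, rule metric_CauchyI)
  fix e :: real assume e: "0 < e"
  \<comment> \<open>The curvature term is below \<open>3 * e / 4\<close>; then
    \<open>\<delta>\<close> is chosen to make the value term \<open>e / 4\<close>.\<close>
  define h where "h = e / (4 * (K2 + 1))"
  have h: "0 < h" "2 * K2 * h < e / 2 + e / 4"
  proof -
    show "0 < h" using e K2_nonneg by (simp add: h_def)
    have "2 * K2 * h \<le> 2 * (K2 + 1) * h" using \<open>0 < h\<close> by (intro mult_right_mono) auto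
    also have "\<dots> = e / 2" using K2_nonneg by (simp add: h_def field_simps)
    finally show "2 * K2 * h < e / 2 + e / 4" using e by simp
  qed
  define \<delta> where "\<delta> = e * h / 8"
  have \<delta>: "0 < \<delta>" "2 * \<delta> / h = e / 4" using e h by (auto simp: \<delta>_def)
  have "Cauchy (\<lambda>m. f m x)" "Cauchy (\<lambda>m. f m (x + h))"
    using \<phi>[OF x] \<phi>[of "x + h"] x h by (simp_all add: LIMSEQ_imp_Cauchy)
  then obtain M1 M2 where M: "\<And>m n. M1 \<le> m \<Longrightarrow> M1 \<le> n \<Longrightarrow> dist (f m x) (f n x) < \<delta>"
      "\<And>m n. M2 \<le> m \<Longrightarrow> M2 \<le> n \<Longrightarrow> dist (f m (x + h)) (f n (x + h)) < \<delta>"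
    using \<delta>(1) unfolding Cauchy_def by meson
  have "dist (p m x) (p n x) < e" if "max M1 M2 \<le> m" "max M1 M2 \<le> n" for m n
  proof -
    have "\<bar>p m x - p n x\<bar> \<le> 2 * \<delta> / h + 2 * K2 * h"
      using that M[of m n] x h by (intro slope_difference[OF slope_taylor[OF f] slope_taylor[OF f], where x = x and y = "x + h"]) (auto simp: dist_real_def)
    then show ?thesis using h \<delta> by (simp add: dist_real_def)
  qed
  then show "\<exists>M. \<forall>m\<ge>M. \<forall>n\<ge>M. dist (p m x) (p n x) < e" by blast
qed

lemma taylor_limit:
  assumes f: "\<And>m. profile (d m) (f m) (p m)" and \<phi>: "\<And>x. 0 \<le> x \<Longrightarrow> (\<lambda>m. f m x) \<longlonglongrightarrow> \<phi> x"
    and \<pi>: "(\<lambda>m. p m x) \<longlonglongrightarrow> \<pi>" and x: "0 \<le> x" "0 \<le> y"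
  shows "\<bar>\<phi> y - \<phi> x - \<pi> * (y - x)\<bar> \<le> K2 * (y - x)\<^sup>2"
proof (rule tendsto_upperbound)
  show "(\<lambda>m. \<bar>f m y - f m x - p m x * (y - x)\<bar>) \<longlonglongrightarrow> \<bar>\<phi> y - \<phi> x - \<pi> * (y - x)\<bar>"
    by (intro tendsto_intros \<phi> \<pi> x)
qed (use slope_taylor[OF f x] in auto)

lemma integral_F_limit:
  assumes f: "\<And>m. profile (d m) (f m) (p m)" and d: "\<And>m. 0 \<le> d m" "\<And>m. d m \<le> cb" "d \<longlonglongrightarrow> c"
    and \<phi>: "\<And>x. 0 \<le> x \<Longrightarrow> (\<lambda>m. f m x) \<longlonglongrightarrow> \<phi> x" and \<pi>: "\<And>x. 0 \<le> x \<Longrightarrow> (\<lambda>m. p m x) \<longlonglongrightarrow> \<pi> x" and x: "0 \<le> x"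
  shows "(\<lambda>m. integral {x..y} (\<lambda>t. F (d m) (f m t) (p m t))) \<longlonglongrightarrow> integral {x..y} (\<lambda>t. F c (\<phi> t) (\<pi> t))"
proof (rule dominated_convergence(2))
  show "(\<lambda>t. F (d m) (f m t) (p m t)) integrable_on {x..y}" for m by (rule primitive_integrable[OF profileD(1)[OF f]])
  show "(\<lambda>t. K2) integrable_on {x..y}" by (intro integrable_continuous_real continuous_intros)
  show "norm (F (d m) (f m t) (p m t)) \<le> K2" if "t \<in> {x..y}" for m t
    using that x profileD(2,3)[OF f, of t m] profile_nonneg[OF f, of t m] profile_slope_le[OF f d(1,2), of t m] d by (auto intro!: F_bound)
  have T: "isCont T u" for u using continuous_on_T[of UNIV "\<lambda>x. x"] by (simp add: continuous_on_eq_continuous_at)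
  show "(\<lambda>m. F (d m) (f m t) (p m t)) \<longlonglongrightarrow> F c (\<phi> t) (\<pi> t)" if "t \<in> {x..y}" for t
    unfolding F_def using that x by (intro tendsto_intros d(3) \<phi> \<pi> isCont_tendsto_compose[OF T]) auto
qed

text \<open>Clamping the argument makes the slope constant to the left of 0, in agreement with the
  linear extension of \<open>vf\<close>.\<close>

definition plim :: "real \<Rightarrow> real \<Rightarrow> real" where "plim c x = lim (\<lambda>n. pn n c (max 0 x))"

lemma pn_LIMSEQ:
  assumes c: "0 \<le> c" "c \<le> cb" and x: "0 \<le> x"
  shows "(\<lambda>n. pn n c x) \<longlonglongrightarrow> plim c x"
proof -
  have "convergent (\<lambda>n. pn n c x)" by (rule slope_convergent[OF profile_vn[OF c] vn_LIMSEQ[OF c] x])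
  then show ?thesis using x unfolding plim_def by (simp add: max_absorb2 convergent_LIMSEQ_iff)
qed

text \<open>The limit value function, extended linearly to negative arguments so that it is differentiable on the whole line.\<close>
definition vf :: "real \<Rightarrow> real \<Rightarrow> real" where "vf c x = (if 0 \<le> x then vlim c x else plim c 0 * x)"

lemma vf_LIMSEQ: "0 \<le> c \<Longrightarrow> c \<le> cb \<Longrightarrow> 0 \<le> x \<Longrightarrow> (\<lambda>n. vn n c x) \<longlonglongrightarrow> vf c x"
  using vn_LIMSEQ by (simp add: vf_def)

lemma vf_taylor:
  assumes c: "0 \<le> c" "c \<le> cb" and "0 \<le> x" "0 \<le> y"
  shows "\<bar>vf c y - vf c x - plim c x * (y - x)\<bar> \<le> K2 * (y - x)\<^sup>2"
  by (rule taylor_limit[OF profile_vn[OF c] vf_LIMSEQ[OF c] pn_LIMSEQ[OF c]]) (use assms in auto)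

lemma vf_cb: "0 \<le> x \<Longrightarrow> vf cb x = g x"
proof -
  assume x: "0 \<le> x"
  have "vn n cb x = g x" for n using cb by (simp add: vn_def idx_def)
  then show ?thesis using vf_LIMSEQ[of cb x] x cb LIMSEQ_unique[OF _ tendsto_const] by simp
qed

lemma vf_levels:
  assumes c: "0 \<le> c1" "c1 \<le> c2" "c2 \<le> cb" and x: "0 \<le> x"
  shows "vf c2 x \<le> vf c1 x" "vf c1 x - vf c2 x \<le> K1 / r * (c2 - c1)"
proof -
  have c': "c1 \<le> cb" "0 \<le> c2" using c by auto
  note b1' = idx_bounds[OF c(1) c'(1)] and b2' = idx_bounds[OF c'(2) c(3)]
  have m: "vn n c2 x \<le> vn n c1 x" for n unfolding vn_def using c x b1' by (intro V_mono idx_antimono) auto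
  show "vf c2 x \<le> vf c1 x"
    by (rule LIMSEQ_le[OF vf_LIMSEQ[OF c'(2) c(3) x] vf_LIMSEQ[OF c(1) c'(1) x]]) (use m in auto)
  have l: "vn n c1 x - vn n c2 x \<le> K1 / r * (level n (idx n c2) - level n (idx n c1))" for n
    unfolding vn_def using c x b1' by (intro V_lipschitz idx_antimono) auto
  show "vf c1 x - vf c2 x \<le> K1 / r * (c2 - c1)"
  proof (rule LIMSEQ_le)
    show "(\<lambda>n. vn n c1 x - vn n c2 x) \<longlonglongrightarrow> vf c1 x - vf c2 x"
      by (intro tendsto_intros vf_LIMSEQ c c' x)
    show "(\<lambda>n. K1 / r * (level n (idx n c2) - level n (idx n c1))) \<longlonglongrightarrow> K1 / r * (c2 - c1)"
      by (intro tendsto_intros level_idx_LIMSEQ c c')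
  qed (use l in auto)
qed

lemma vf_slope_bounds:
  assumes c: "0 \<le> c" "c \<le> cb" and x: "0 \<le> x"
  shows "0 \<le> plim c x" "plim c x \<le> K1" "0 \<le> vf c x" "vf c x \<le> cb / r"
proof -
  note g = profile_vn[OF c]
  show "0 \<le> plim c x" by (rule LIMSEQ_le_const[OF pn_LIMSEQ[OF c x]]) (use profileD(2)[OF g x] in auto)
  have "pn n c x \<le> K1" for n using idx_bounds[OF c, of n] level_bounds[where n = n and k = "idx n c"] by (intro profile_slope_le[OF g] x) auto
  then show "plim c x \<le> K1" by (intro LIMSEQ_le_const2[OF pn_LIMSEQ[OF c x]]) auto
  show "0 \<le> vf c x" by (rule LIMSEQ_le_const[OF vf_LIMSEQ[OF c x]]) (use profile_nonneg[OF g x] in auto)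
  show "vf c x \<le> cb / r" by (rule LIMSEQ_le_const2[OF vf_LIMSEQ[OF c x]]) (use profileD(3)[OF g x] in auto)
qed

lemma vf_slope_max:
  assumes c: "0 \<le> c" "c \<le> cb" and x: "0 \<le> x" "x \<le> y"
  shows "plim c y \<le> max (plim c x) 1"
proof (rule LIMSEQ_le)
  show "(\<lambda>n. pn n c y) \<longlonglongrightarrow> plim c y" using x by (intro pn_LIMSEQ c) auto
  show "(\<lambda>n. max (pn n c x) 1) \<longlonglongrightarrow> max (plim c x) 1" by (intro tendsto_max tendsto_const pn_LIMSEQ c x)
qed (use profileD(4)[OF profile_vn[OF c] x] in auto)

lemma lipschitz_plim:
  assumes c: "0 \<le> c" "c \<le> cb"
  shows "K2-lipschitz_on UNIV (plim c)"
proof (rule lipschitz_from_halfline[OF _ K2_nonneg])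
  show "plim c x = plim c 0" if "x \<le> 0" for x using that by (simp add: plim_def max_absorb1)
  fix x y :: real assume x: "0 \<le> x" "x \<le> y"
  show "\<bar>plim c y - plim c x\<bar> \<le> K2 * (y - x)"
  proof (rule LIMSEQ_le_const2)
    show "(\<lambda>n. \<bar>pn n c y - pn n c x\<bar>) \<longlonglongrightarrow> \<bar>plim c y - plim c x\<bar>"
      using x by (intro tendsto_intros pn_LIMSEQ c) auto
    have "\<bar>pn n c y - pn n c x\<bar> \<le> K2 * (y - x)" for n
      using lipschitz_onD[OF profileD(8)[OF profile_vn[OF c]], of y x] x by (simp add: dist_real_def)
    then show "\<exists>N. \<forall>n\<ge>N. \<bar>pn n c y - pn n c x\<bar> \<le> K2 * (y - x)" by blast
  qed
qed

lemma primitive_vf: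
  assumes c: "0 \<le> c" "c \<le> cb"
  shows "primitive (vf c) (plim c)"
  unfolding primitive_def
proof (intro conjI allI)
  have 0: "vn n c 0 = 0" for n by (rule primitiveD(1)[OF profileD(1)[OF profile_vn[OF c]]])
  show vf0: "vf c 0 = 0" using LIMSEQ_unique[OF vf_LIMSEQ[OF c, of 0]] by (simp add: 0)
  show "continuous_on UNIV (plim c)" by (rule lipschitz_on_continuous_on[OF lipschitz_plim[OF c]])
  fix x
  have neg: "plim c x = plim c 0" if "x \<le> 0" for x using that by (simp add: plim_def max_absorb1)
  show "(vf c has_real_derivative plim c x) (at x)"
  \<comment> \<open>For \<open>x \<noteq> 0\<close> this radius keeps \<open>y\<close> on the same
    side of 0, so either the Taylor bound or the linear formula applies; at 0 each serves one
    side.\<close>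
  proof (rule DERIV_if_quadratic[where K = K2 and d = "if x = 0 then 1 else \<bar>x\<bar>"])
    show "0 \<le> K2" by (rule K2_nonneg)
    show "0 < (if x = 0 then 1 else \<bar>x\<bar>)" by simp
    fix y assume y: "\<bar>y - x\<bar> < (if x = 0 then 1 else \<bar>x\<bar>)"
    show "\<bar>vf c y - vf c x - plim c x * (y - x)\<bar> \<le> K2 * (y - x)\<^sup>2"
    proof (cases "0 \<le> x \<and> 0 \<le> y")
      case True then show ?thesis by (intro vf_taylor c) auto
    next
      case False
      then have "x \<le> 0" "y \<le> 0" using y by (auto split: if_splits)
      then have "vf c x = plim c 0 * x" "vf c y = plim c 0 * y" using vf0 by (cases "x = 0"; cases "y = 0"; simp add: vf_def)+
      then have "vf c y - vf c x - plim c x * (y - x) = 0" using neg[OF \<open>x \<le> 0\<close>] by (simp add: algebra_simps)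
      then show ?thesis using K2_nonneg by simp
    qed
  qed
qed

lemma supersol_vf:
  assumes c: "0 \<le> c" "c \<le> cb"
  shows "supersol c (vf c) (plim c)"
  unfolding supersol_def
proof (intro allI impI)
  fix x y :: real assume xy: "0 \<le> x \<and> x \<le> y"
  show "plim c y - plim c x \<le> integral {x..y} (\<lambda>t. F c (vf c t) (plim c t))"
  proof (rule LIMSEQ_le)
    show "(\<lambda>n. pn n c y - pn n c x) \<longlonglongrightarrow> plim c y - plim c x" using xy by (intro tendsto_intros pn_LIMSEQ c) auto
    show "(\<lambda>n. integral {x..y} (\<lambda>t. F (level n (idx n c)) (vn n c t) (pn n c t))) \<longlonglongrightarrow> integral {x..y} (\<lambda>t. F c (vf c t) (plim c t))"
      using xy idx_bounds[OF c] level_bounds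
      by (intro integral_F_limit[OF profile_vn[OF c]] level_idx_LIMSEQ vf_LIMSEQ pn_LIMSEQ c) auto
    show "\<exists>N. \<forall>n\<ge>N. pn n c y - pn n c x \<le> integral {x..y} (\<lambda>t. F (level n (idx n c)) (vn n c t) (pn n c t))"
      using supersolD[OF profileD(6)[OF profile_vn[OF c]]] xy by blast
  qed
qed

text \<open>If no higher rate attains the same value at \<open>x\<close>, then arbitrarily close to the level \<open>c\<close> the discrete scheme makes a
  strict step at \<open>x\<close>, and the step solves the equation on \<open>[0, x]\<close>; the equation survives in the limit.\<close>
lemma vf_solves_if_strict:
  assumes c: "0 \<le> c" "c < cb" and x: "0 \<le> x" and strict: "\<And>s. c < s \<Longrightarrow> s \<le> cb \<Longrightarrow> vf s x < vf c x"
  shows "solves c (vf c) (plim c) x"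
proof -
  have c': "c \<le> cb" using c by simp
  define s where "s m = c + (cb - c) / real (Suc m)" for m
  have s: "c < s m" "s m \<le> cb" "0 \<le> s m" for m
  proof -
    show "c < s m" using c by (simp add: s_def)
    have "(cb - c) / real (Suc m) \<le> (cb - c) / 1" using c by (intro divide_left_mono) auto
    then show "s m \<le> cb" by (simp add: s_def)
    show "0 \<le> s m" using \<open>c < s m\<close> c by simp
  qed
  have s_lim: "s \<longlonglongrightarrow> c"
  proof -
    have "(\<lambda>m. c + (cb - c) * (1 / real (Suc m))) \<longlonglongrightarrow> c + (cb - c) * 0"
      by (intro tendsto_intros LIMSEQ_Suc[OF lim_1_over_n])
    then show ?thesis by (simp add: s_def[abs_def])
  qed
  \<comment> \<open>The total increment at \<open>x\<close> between the rates \<open>s m\<close> and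
    \<open>c\<close> is positive on a fine grid, so at least one single step between them is strict
    at \<open>x\<close>.\<close>
  have "\<exists>n k. m \<le> n \<and> idx n (s m) \<le> k \<and> Suc k \<le> idx n c \<and> fst (V n k) x < fst (V n (Suc k)) x" for m
  proof -
    have "eventually (\<lambda>n. 0 < vn n c x - vn n (s m) x) sequentially"
      using order_tendstoD(1)[OF tendsto_diff[OF vf_LIMSEQ[OF c(1) c' x] vf_LIMSEQ[OF s(3,2) x]], of 0] strict[OF s(1,2)] by simp
    then obtain n where n: "m \<le> n" "vn n (s m) x < vn n c x"
    proof -
      obtain N where "\<And>n. N \<le> n \<Longrightarrow> 0 < vn n c x - vn n (s m) x"
        using \<open>eventually _ _\<close> unfolding eventually_sequentially by blast
      then show ?thesis using that[of "max m N"] by simp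
    qed
    have "\<exists>k\<ge>idx n (s m). Suc k \<le> idx n c \<and> fst (V n k) x < fst (V n (Suc k)) x"
    proof (rule ccontr)
      assume no: "\<not> (\<exists>k\<ge>idx n (s m). Suc k \<le> idx n c \<and> fst (V n k) x < fst (V n (Suc k)) x)"
      have "idx n (s m) + j \<le> idx n c \<longrightarrow> fst (V n (idx n (s m) + j)) x \<le> fst (V n (idx n (s m))) x" for j
      proof (induction j)
        case (Suc j)
        show ?case
        proof
          assume j: "idx n (s m) + Suc j \<le> idx n c"
          have "\<not> fst (V n (idx n (s m) + j)) x < fst (V n (Suc (idx n (s m) + j))) x"
            using no j by auto
          then show "fst (V n (idx n (s m) + Suc j)) x \<le> fst (V n (idx n (s m))) x" using Suc j by simp
        qed
      qed simp
      from this[of "idx n c - idx n (s m)"] have "vn n c x \<le> vn n (s m) x"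
        using idx_antimono[of c "s m" n] s(1)[of m] by (simp add: vn_def)
      with n show False by simp
    qed
    then show ?thesis using n by blast
  qed
  then obtain n k where nk: "\<And>m. m \<le> n m" "\<And>m. idx (n m) (s m) \<le> k m" "\<And>m. Suc (k m) \<le> idx (n m) c"
    "\<And>m. fst (V (n m) (k m)) x < fst (V (n m) (Suc (k m))) x" by metis
  define d where "d m = level (n m) (Suc (k m))" for m
  define f where "f m = fst (V (n m) (Suc (k m)))" for m
  define p where "p m = snd (V (n m) (Suc (k m)))" for m
  have kle: "Suc (k m) \<le> 2 ^ n m" for m using nk(3)[of m] idx_bounds(1)[OF c(1) c', of "n m"] by simp
  have f: "profile (d m) (f m) (p m)" for m unfolding d_def f_def p_def by (rule V_profile[OF kle])
  have sol: "solves (d m) (f m) (p m) x" for m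
  proof -
    obtain z where z: "solves (d m) (f m) (p m) z" "\<And>x. z \<le> x \<Longrightarrow> f m x = fst (V (n m) (k m)) x"
      using V_step[OF kle] unfolding is_step_def d_def f_def p_def by blast
    \<comment> \<open>Beyond \<open>z\<close> the step leaves the profile unchanged, so strictness
      at \<open>x\<close> places \<open>x\<close> in the stretch where the equation holds.\<close>
    have "x \<le> z" using z(2)[of x] nk(4)[of m] by (auto simp: f_def intro: ccontr)
    then show ?thesis by (rule solves_mono[OF z(1)])
  qed
  have ninf: "filterlim n at_top sequentially" using nk(1) by (intro filterlim_at_top_mono[OF filterlim_ident]) auto
  have lev_mono: "level N j \<le> level N i" if "i \<le> j" for N i j
    unfolding level_def using that cb by (intro mult_left_mono diff_left_mono divide_right_mono) auto
  have d_le: "level (n m) (idx (n m) c) \<le> d m" "d m \<le> level (n m) (idx (n m) (s m))" for m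
    unfolding d_def using nk(2,3)[of m] by (intro lev_mono; simp)+
  have lc: "(\<lambda>m. level (n m) (idx (n m) c)) \<longlonglongrightarrow> c"
    by (rule filterlim_compose[OF level_idx_LIMSEQ[OF c(1) c'] ninf])
  have up: "level (n m) (idx (n m) (s m)) \<le> s m + cb * (1 / 2) ^ m" for m
  proof -
    have "level (n m) (idx (n m) (s m)) \<le> s m + cb / 2 ^ n m" using idx_bounds(3)[OF s(3,2), of "n m" m] by simp
    also have "cb / 2 ^ n m \<le> cb / 2 ^ m" using cb nk(1)[of m] by (intro divide_left_mono power_increasing) auto
    finally show ?thesis by (simp add: power_divide)
  qed
  have upl: "(\<lambda>m. s m + cb * (1 / 2) ^ m) \<longlonglongrightarrow> c"
    using tendsto_add[OF s_lim tendsto_mult[OF tendsto_const LIMSEQ_realpow_zero[of "1/2"]], of cb] by simp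
  have d_lim: "d \<longlonglongrightarrow> c"
  proof (rule tendsto_sandwich[OF _ _ lc upl])
    show "\<forall>\<^sub>F m in sequentially. level (n m) (idx (n m) c) \<le> d m"
      using d_le(1) by (intro always_eventually allI)
    show "\<forall>\<^sub>F m in sequentially. d m \<le> s m + cb * (1 / 2) ^ m"
      using order_trans[OF d_le(2) up] by (intro always_eventually allI)
  qed
  \<comment> \<open>The selected profiles belong to rates \<open>d m\<close> that need not be the
    grid rates assigned to \<open>c\<close>; the Lipschitz bound in the rate shows that the
    difference vanishes in the limit.\<close>
  have f_lim: "(\<lambda>m. f m y) \<longlonglongrightarrow> vf c y" if y: "0 \<le> y" for y
  proof -
    have a: "(\<lambda>m. vn (n m) c y) \<longlonglongrightarrow> vf c y" by (rule filterlim_compose[OF vf_LIMSEQ[OF c(1) c' y] ninf])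
    have "f m y \<le> vn (n m) c y" "vn (n m) c y - f m y \<le> K1 / r * (d m - level (n m) (idx (n m) c))" for m
      unfolding f_def vn_def d_def using nk(3)[of m] idx_bounds(1)[OF c(1) c'] y by (intro V_mono V_lipschitz; simp)+
    then have b: "vn (n m) c y - K1 / r * (d m - level (n m) (idx (n m) c)) \<le> f m y" "f m y \<le> vn (n m) c y" for m
      by (simp_all add: algebra_simps)
    have "(\<lambda>m. vn (n m) c y - K1 / r * (d m - level (n m) (idx (n m) c))) \<longlonglongrightarrow> vf c y - K1 / r * (c - c)"
      by (intro tendsto_intros a d_lim lc)
    then have l: "(\<lambda>m. vn (n m) c y - K1 / r * (d m - level (n m) (idx (n m) c))) \<longlonglongrightarrow> vf c y" by simp
    show ?thesis by (rule tendsto_sandwich[OF _ _ l a]) (use b in auto)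
  qed
  have p_lim: "(\<lambda>m. p m y) \<longlonglongrightarrow> plim c y" if y: "0 \<le> y" for y
  proof -
    have "convergent (\<lambda>m. p m y)" by (rule slope_convergent[OF f f_lim y])
    then obtain \<pi> where \<pi>: "(\<lambda>m. p m y) \<longlonglongrightarrow> \<pi>" by (auto simp: convergent_def)
    have "\<pi> = plim c y"
    proof (rule ccontr)
      assume ne: "\<pi> \<noteq> plim c y"
      \<comment> \<open>Both slopes satisfy the Taylor bound for the same function, so they differ
        by at most \<open>2 * K2 * h\<close> for every positive \<open>h\<close>; this
        \<open>h\<close> is small enough for a contradiction.\<close>
      define h where "h = \<bar>\<pi> - plim c y\<bar> / (2 * (K2 + 1))"
      have h: "0 < h" using ne K2_nonneg by (simp add: h_def)
      have "\<bar>vf c (y + h) - vf c y - \<pi> * ((y + h) - y)\<bar> \<le> K2 * ((y + h) - y)\<^sup>2"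
        by (rule taylor_limit[OF f f_lim \<pi>]) (use y h in auto)
      moreover have "\<bar>vf c (y + h) - vf c y - plim c y * ((y + h) - y)\<bar> \<le> K2 * ((y + h) - y)\<^sup>2"
        by (rule vf_taylor[OF c(1) c']) (use y h in auto)
      ultimately have "\<bar>\<pi> - plim c y\<bar> \<le> 2 * 0 / h + 2 * K2 * h"
        by (rule slope_difference[OF _ _ h]) auto
      also have "\<dots> < 2 * (K2 + 1) * h" using h by simp
      also have "\<dots> = \<bar>\<pi> - plim c y\<bar>" using K2_nonneg by (simp add: h_def)
      finally show False by simp
    qed
    with \<pi> show ?thesis by simp
  qed
  have dr: "0 \<le> d m" "d m \<le> cb" for m using level_bounds kle unfolding d_def by auto
  show ?thesis
    unfolding solves_def
  proof (intro allI impI)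
    fix y1 y2 assume y: "0 \<le> y1 \<and> y1 \<le> y2 \<and> y2 \<le> x"
    have "(\<lambda>m. p m y2 - p m y1) \<longlonglongrightarrow> plim c y2 - plim c y1" using y by (intro tendsto_intros p_lim) auto
    moreover have "(\<lambda>m. integral {y1..y2} (\<lambda>t. F (d m) (f m t) (p m t))) \<longlonglongrightarrow> integral {y1..y2} (\<lambda>t. F c (vf c t) (plim c t))"
      using y by (intro integral_F_limit[OF f dr d_lim f_lim p_lim]) auto
    moreover have "p m y2 - p m y1 = integral {y1..y2} (\<lambda>t. F (d m) (f m t) (p m t))" for m
      using y by (intro solvesD[OF sol]) auto
    ultimately show "plim c y2 - plim c y1 = integral {y1..y2} (\<lambda>t. F c (vf c t) (plim c t))"
      using LIMSEQ_unique by simp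
  qed
qed

end

section \<open>Uniqueness\<close>

lemma bounded_if_L_infty:
  assumes f: "continuous_on {0..} f" and "L_infty f"
  obtains M where "\<And>x. 0 \<le> x \<Longrightarrow> \<bar>f x\<bar> \<le> M"
proof -
  obtain M where M: "AE x in lborel. x \<in> {0..} \<longrightarrow> \<bar>f x\<bar> \<le> M" using assms(2) unfolding L_infty_def by blast
  have "f x = max (- M) (min M (f x))" if "0 \<le> x" for x
  proof (rule continuous_eq_if_AE_eq[OF f _ _ that])
    show "continuous_on {0..} (\<lambda>x. max (- M) (min M (f x)))" by (intro continuous_intros f)
    show "AE x in lborel. 0 \<le> x \<longrightarrow> f x = max (- M) (min M (f x))" using M by eventually_elim auto
  qed
  then have "\<bar>f x\<bar> \<le> \<bar>M\<bar>" if "0 \<le> x" for x using that by (smt (verit))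
  then show ?thesis by (rule that)
qed

lemma integral_eq_LINT:
  assumes "set_integrable lborel {x..y::real} f"
  shows "(LINT t:{x..y}|lborel. f t) = integral {x..y} (f :: real \<Rightarrow> real)"
  using set_borel_integral_eq_integral(2)[OF assms] .

context ratcheting begin

lemma hjb_op_eq_F: "hjb_op \<mu> \<sigma> r b c u p s = \<sigma>\<^sup>2 / 2 * (F c u p - s)"
  unfolding hjb_op_def F_def T_def using sigma by (simp add: field_simps)

lemma hjb_op_nonneg_iff: "0 \<le> hjb_op \<mu> \<sigma> r b c u p s \<longleftrightarrow> s \<le> F c u p"
  and hjb_op_zero_iff: "hjb_op \<mu> \<sigma> r b c u p s = 0 \<longleftrightarrow> s = F c u p"
  unfolding hjb_op_eq_F using sigma by (auto simp: zero_le_mult_iff)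

lemma solution_slices:
  assumes "hjb_solution \<mu> \<sigma> r cb b v" "c \<in> {0..cb}"
  shows "continuous_on {0..} (\<lambda>x. v x c)"
proof -
  have c: "continuous_on (Qset cb) (\<lambda>z. v (fst z) (snd z))"
    using assms unfolding hjb_solution_def classA_def by blast
  have "continuous_on {0..} (\<lambda>x. (\<lambda>z. v (fst z) (snd z)) (x, c))"
    by (rule continuous_on_compose2[OF c]) (use assms in \<open>auto intro!: continuous_intros simp: Qset_def\<close>)
  then show ?thesis by simp
qed

text \<open>Each slice has its own bound only. Monotonicity in the rate sandwiches all slices
  between those at 0 and \<open>cb\<close>, which makes the bound uniform.\<close>

lemma solution_bounded:
  assumes s: "hjb_solution \<mu> \<sigma> r cb b v"
  obtains M where "\<And>x c. 0 \<le> x \<Longrightarrow> c \<in> {0..cb} \<Longrightarrow> \<bar>v x c\<bar> \<le> M"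
proof -
  have L: "L_infty (\<lambda>x. v x c)" if "c \<in> {0..cb}" for c
    using s that unfolding hjb_solution_def classA_def by blast
  have mono: "v x c2 \<le> v x c1" if "0 \<le> x" "c1 \<in> {0..cb}" "c2 \<in> {0..cb}" "c1 \<le> c2" for x c1 c2
    using s that unfolding hjb_solution_def classA_def by blast
  have e: "0 \<in> {0..cb}" "cb \<in> {0..cb}" using cb by auto
  obtain M1 where M1: "\<And>x. 0 \<le> x \<Longrightarrow> \<bar>v x 0\<bar> \<le> M1" using bounded_if_L_infty[OF solution_slices[OF s e(1)] L[OF e(1)]] by blast
  obtain M2 where M2: "\<And>x. 0 \<le> x \<Longrightarrow> \<bar>v x cb\<bar> \<le> M2" using bounded_if_L_infty[OF solution_slices[OF s e(2)] L[OF e(2)]] by blast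
  have "\<bar>v x c\<bar> \<le> M1 + M2" if "0 \<le> x" "c \<in> {0..cb}" for x c
    using M1[OF that(1)] M2[OF that(1)] mono[OF that(1) e(1) that(2)] mono[OF that(1,2) e(2)] that(2) by auto
  then show ?thesis by (rule that)
qed

text \<open>At a maximum of \<open>v - w - \<epsilon> x\<close> taken with the largest possible rate, \<open>v\<close> satisfies the strictness
  condition, hence the equation to the left of the maximum, which contradicts \<open>w\<close> being a supersolution there.\<close>
lemma hjb_solution_le:
  assumes v: "hjb_solution \<mu> \<sigma> r cb b v" and w: "hjb_solution \<mu> \<sigma> r cb b w"
    and xc: "0 \<le> xb" "cx \<in> {0..cb}"
  shows "v xb cx \<le> w xb cx"
proof (rule ccontr)
  assume "\<not> v xb cx \<le> w xb cx"
  define \<eta> where "\<eta> = v xb cx - w xb cx"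
  have \<eta>: "0 < \<eta>" using \<open>\<not> v xb cx \<le> w xb cx\<close> by (simp add: \<eta>_def)
  \<comment> \<open>The first bound leaves at least \<open>\<eta> / 2\<close> of the gap after the
    penalty at \<open>xb\<close>; the second keeps \<open>B * \<epsilon>\<close>, the effect of the
    slope difference \<open>\<epsilon>\<close> at the maximum, below
    \<open>\<rho> * (\<eta> / 2)\<close>.\<close>
  define \<epsilon> where "\<epsilon> = min (\<eta> / (2 * (xb + 1))) (r * \<eta> / (4 * (\<mu> + cb)))"
  have \<epsilon>: "0 < \<epsilon>" unfolding \<epsilon>_def using \<eta> xc r mu cb by simp
  have \<epsilon>1: "\<epsilon> * xb \<le> \<eta> / 2"
  proof -
    have "\<epsilon> * (xb + 1) \<le> \<eta> / 2" using xc unfolding \<epsilon>_def by (subst pos_le_divide_eq[symmetric]) auto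
    then show ?thesis using \<epsilon> by (simp add: distrib_left)
  qed
  have \<epsilon>2: "B * \<epsilon> < \<rho> * (\<eta> / 2)"
  proof -
    have "\<epsilon> \<le> r * \<eta> / (4 * (\<mu> + cb))" by (simp add: \<epsilon>_def)
    then have "B * \<epsilon> \<le> B * (r * \<eta> / (4 * (\<mu> + cb)))" using B_pos by (intro mult_left_mono) auto
    also have "\<dots> = \<rho> * (\<eta> / 4)"
    proof -
      define m where "m = \<mu> + cb"
      have "m \<noteq> 0" using mu cb by (simp add: m_def)
      then show ?thesis unfolding B_def \<rho>_def m_def[symmetric] using sigma by (simp add: field_simps)
    qed
    also have "\<dots> < \<rho> * (\<eta> / 2)" using rho_pos \<eta> by simp
    finally show ?thesis .
  qed
  obtain Mv where Mv: "\<And>x c. 0 \<le> x \<Longrightarrow> c \<in> {0..cb} \<Longrightarrow> \<bar>v x c\<bar> \<le> Mv" using solution_bounded[OF v] by blast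
  obtain Mw where Mw: "\<And>x c. 0 \<le> x \<Longrightarrow> c \<in> {0..cb} \<Longrightarrow> \<bar>w x c\<bar> \<le> Mw" using solution_bounded[OF w] by blast
  define \<Psi> where "\<Psi> z = v (fst z) (snd z) - w (fst z) (snd z) - \<epsilon> * fst z" for z
  have c\<Psi>: "continuous_on (Qset cb) \<Psi>"
    unfolding \<Psi>_def using v w by (intro continuous_intros) (auto simp: hjb_solution_def classA_def)
  \<comment> \<open>Beyond \<open>X\<close> the penalty \<open>\<epsilon> * x\<close> outweighs any
    value of \<open>v - w\<close>, so the supremum is attained on a compact set.\<close>
  define X where "X = max xb ((Mv + Mw) / \<epsilon>)"
  define K where "K = {0..X} \<times> {0..cb}"
  have KQ: "K \<subseteq> Qset cb" by (auto simp: K_def Qset_def)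
  have cpt: "compact K" unfolding K_def by (intro compact_Times compact_Icc)
  have start: "(xb, cx) \<in> K" "\<eta> / 2 \<le> \<Psi> (xb, cx)" using xc \<epsilon>1 by (auto simp: K_def X_def \<Psi>_def \<eta>_def)
  obtain z1 where z1: "z1 \<in> K" "\<And>y. y \<in> K \<Longrightarrow> \<Psi> y \<le> \<Psi> z1"
    using continuous_attains_sup[OF cpt _ continuous_on_subset[OF c\<Psi> KQ]] start by blast
  define Z where "Z = {z \<in> K. \<Psi> z = \<Psi> z1}"
  have "closed Z" unfolding Z_def
    by (rule continuous_closed_preimage_constant[OF continuous_on_subset[OF c\<Psi> KQ] compact_imp_closed[OF cpt]])
  then have "compact Z" using cpt compact_Int_closed[of K Z] by (simp add: Z_def Int_absorb1 inf.absorb_iff2[symmetric])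
  moreover have "Z \<noteq> {}" using z1(1) unfolding Z_def by blast
  moreover have "continuous_on Z (snd :: real \<times> real \<Rightarrow> real)" by (intro continuous_intros)
  ultimately obtain z0 where z0: "z0 \<in> Z" "\<And>y. y \<in> Z \<Longrightarrow> snd y \<le> snd z0"
    using continuous_attains_sup[of Z snd] by blast
  define x0 where "x0 = fst z0" define c0 where "c0 = snd z0"
  have zK: "0 \<le> x0" "x0 \<le> X" "c0 \<in> {0..cb}" using z0(1) by (auto simp: Z_def K_def x0_def c0_def)
  have \<Psi>0: "\<Psi> (x0, c0) = \<Psi> z1" using z0(1) by (simp add: Z_def x0_def c0_def)
  have big: "\<eta> / 2 \<le> \<Psi> (x0, c0)" using z1(2)[OF start(1)] start(2) unfolding \<Psi>0 by simp
  have mx: "\<Psi> (x, c) \<le> \<Psi> (x0, c0)" if "0 \<le> x" "c \<in> {0..cb}" for x c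
  proof (cases "x \<le> X")
    case True then show ?thesis using z1(2)[of "(x, c)"] that unfolding \<Psi>0 by (auto simp: K_def)
  next
    case False
    then have "(Mv + Mw) / \<epsilon> \<le> x" by (simp add: X_def)
    then have "Mv + Mw \<le> \<epsilon> * x" using \<epsilon> by (simp add: field_simps)
    then have "\<Psi> (x, c) \<le> 0" using Mv[OF that] Mw[OF that] by (simp add: \<Psi>_def)
    then show ?thesis using big \<eta> by simp
  qed
  have strict: "\<Psi> (x0, s) < \<Psi> (x0, c0)" if "c0 < s" "s \<le> cb" for s
  proof -
    have "s \<in> {0..cb}" using that zK by auto
    then have "(x0, s) \<in> K" using zK by (auto simp: K_def)
    then have "\<Psi> (x0, s) \<noteq> \<Psi> z1" using z0(2)[of "(x0, s)"] that by (auto simp: Z_def c0_def)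
    then show ?thesis using mx[OF zK(1) \<open>s \<in> {0..cb}\<close>] unfolding \<Psi>0 by simp
  qed
  have x0: "0 < x0"
  proof (rule ccontr)
    assume "\<not> 0 < x0"
    then have "x0 = 0" using zK by simp
    then have "\<Psi> (x0, c0) = 0" using v w zK by (simp add: \<Psi>_def hjb_solution_def)
    then show False using big \<eta> by simp
  qed
  have c0: "c0 < cb"
  proof (rule ccontr)
    assume "\<not> c0 < cb"
    then have "c0 = cb" using zK by simp
    then have "\<Psi> (x0, c0) = - \<epsilon> * x0" using v w zK by (simp add: \<Psi>_def hjb_solution_def)
    also have "\<dots> \<le> 0" using \<epsilon> x0 by simp
    finally show False using big \<eta> by simp
  qed
  \<comment> \<open>\<open>w\<close> is non-increasing in the rate, so the strict drop of
    \<open>v - w\<close> at higher rates is one of \<open>v\<close> itself.\<close>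
  have "v x0 s < v x0 c0" if "s \<in> {c0<..cb}" for s
  proof -
    have "w x0 s \<le> w x0 c0" using w that zK unfolding hjb_solution_def classA_def by auto
    then show ?thesis using strict[of s] that by (simp add: \<Psi>_def)
  qed
  then have "\<exists>f1 f2. weak_deriv (\<lambda>x. v x c0) f1 \<and> weak_deriv f1 f2 \<and>
         (AE y in lborel. y \<in> {0..x0} \<longrightarrow> hjb_op \<mu> \<sigma> r b c0 (v y c0) (f1 y) (f2 y) = 0)"
    using v zK c0 unfolding hjb_solution_def Q0set_def by auto
  then obtain f1 f2 where f: "weak_deriv (\<lambda>x. v x c0) f1" "weak_deriv f1 f2"
    "AE y in lborel. y \<in> {0..x0} \<longrightarrow> f2 y = F c0 (v y c0) (f1 y)" unfolding hjb_op_zero_iff by blast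
  obtain e1 e2 where e: "weak_deriv (\<lambda>x. w x c0) e1" "weak_deriv e1 e2"
    "AE y in lborel. y \<in> {0..} \<longrightarrow> e2 y \<le> F c0 (w y c0) (e1 y)"
    using w zK unfolding hjb_solution_def hjb_op_nonneg_iff by blast
  note cv = solution_slices[OF v zK(3)] and cw = solution_slices[OF w zK(3)]
  obtain P where P: "continuous_on {0..} P" "\<And>x. 0 < x \<Longrightarrow> ((\<lambda>x. v x c0) has_real_derivative P x) (at x)"
    "AE x in lborel. 0 \<le> x \<longrightarrow> f1 x = P x" "\<And>x y. 0 \<le> x \<Longrightarrow> x \<le> y \<Longrightarrow> P y - P x = (LINT t:{x..y}|lborel. f2 t)"
    "\<And>x y. 0 \<le> x \<Longrightarrow> set_integrable lborel {x..y} f2"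
    by (rule weak_deriv_twice_representation[OF cv f(1,2)]) blast
  obtain R where R: "continuous_on {0..} R" "\<And>x. 0 < x \<Longrightarrow> ((\<lambda>x. w x c0) has_real_derivative R x) (at x)"
    "AE x in lborel. 0 \<le> x \<longrightarrow> e1 x = R x" "\<And>x y. 0 \<le> x \<Longrightarrow> x \<le> y \<Longrightarrow> R y - R x = (LINT t:{x..y}|lborel. e2 t)"
    "\<And>x y. 0 \<le> x \<Longrightarrow> set_integrable lborel {x..y} e2"
    by (rule weak_deriv_twice_representation[OF cw e(1,2)]) blast
  define u where "u x = \<Psi> (x, c0)" for x
  have du: "(u has_real_derivative P x - R x - \<epsilon>) (at x)" if "0 < x" for x
    unfolding u_def \<Psi>_def fst_conv snd_conv by (intro DERIV_diff DERIV_cmult_Id P(2) R(2) that)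
  have um: "u x \<le> u x0" if "0 \<le> x" for x unfolding u_def using mx[OF that zK(3)] .
  have up0: "P x0 - R x0 - \<epsilon> = 0"
    by (rule DERIV_local_max[OF du[OF x0] x0]) (auto intro!: um)
  define G where "G t = F c0 (v t c0) (P t) - F c0 (w t c0) (R t)" for t
  have cG: "continuous_on {0..} G" unfolding G_def by (intro continuous_intros cv cw P(1) R(1))
  have "\<exists>\<delta>>0. \<delta> \<le> x0 / 2 \<and> (\<forall>y. x0 - \<delta> \<le> y \<and> y < x0 \<longrightarrow>
      P y - R y - \<epsilon> < P x0 - R x0 - \<epsilon> \<and> u x0 + (P x0 - R x0 - \<epsilon>) * (y - x0) < u y)"
  proof (rule local_convex_left[where G = G])
    show "(u has_real_derivative P x - R x - \<epsilon>) (at x)" if "x0 - x0 / 2 \<le> x" for x using that x0 by (intro du) simp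
    show "continuous_on {x0 - x0 / 2..x0} G" by (rule continuous_on_subset[OF cG]) (use x0 in auto)
    have "\<eta> / 2 \<le> v x0 c0 - w x0 c0" using big \<epsilon> x0 by (simp add: \<Psi>_def) (smt (verit) mult_pos_pos)
    then have "\<rho> * (\<eta> / 2) \<le> \<rho> * (v x0 c0 - w x0 c0)" using rho_pos by (intro mult_left_mono) auto
    moreover have slope0: "\<bar>P x0 - R x0\<bar> = \<epsilon>" using up0 \<epsilon> by simp
    have "\<rho> * (v x0 c0 - w x0 c0) - B * \<epsilon> \<le> G x0"
      using F_diff(1)[of c0 "v x0 c0" "w x0 c0" "P x0" "R x0"] zK unfolding slope0 G_def by simp
    ultimately show "0 < G x0" using \<epsilon>2 by linarith
    fix x y assume xy: "x0 - x0 / 2 \<le> x" "x \<le> y" "y \<le> x0"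
    have x: "0 \<le> x" using xy x0 by simp
    have iG: "set_integrable lborel {x..y} G"
      by (rule borel_integrable_atLeastAtMost'[OF continuous_on_subset[OF cG]]) (use x in auto)
    have id: "set_integrable lborel {x..y} (\<lambda>t. f2 t - e2 t)" using P(5)[OF x] R(5)[OF x] by (rule set_integral_diff)
    have "(LINT t:{x..y}|lborel. G t) \<le> (LINT t:{x..y}|lborel. f2 t - e2 t)"
    proof (rule set_integral_mono_AE[OF iG id])
      show "AE t\<in>{x..y} in lborel. G t \<le> f2 t - e2 t"
        using f(3) e(3) P(3) R(3) by eventually_elim (use xy x in \<open>auto simp: G_def\<close>)
    qed
    also have "\<dots> = (P y - P x) - (R y - R x)"
      using P(4)[OF x xy(2)] R(4)[OF x xy(2)] set_integral_diff(2)[OF P(5)[OF x] R(5)[OF x]] by simp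
    finally show "integral {x..y} G \<le> P y - R y - \<epsilon> - (P x - R x - \<epsilon>)" using integral_eq_LINT[OF iG] by simp
  qed (use x0 in simp)
  then obtain \<delta> where \<delta>: "0 < \<delta>" "\<delta> \<le> x0 / 2" "\<And>y. x0 - \<delta> \<le> y \<Longrightarrow> y < x0 \<Longrightarrow> u x0 + (P x0 - R x0 - \<epsilon>) * (y - x0) < u y" by blast
  from \<delta>(3)[of "x0 - \<delta>"] \<delta>(1) have "u x0 < u (x0 - \<delta>)" unfolding up0 by simp
  moreover have "u (x0 - \<delta>) \<le> u x0" using \<delta> x0 by (intro um) simp
  ultimately show False by simp
qed

end

section \<open>Existence and estimates\<close>

lemma antimono_lipschitz_DERIV_bounds:
  fixes f :: "real \<Rightarrow> real"
  assumes d: "(f has_real_derivative D) (at x)" and anti: "\<And>x y. x \<le> y \<Longrightarrow> f y \<le> f x" and lip: "L-lipschitz_on UNIV f"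
  shows "0 \<le> - D" "- D \<le> L"
proof -
  have lim: "((\<lambda>h. (f (x + h) - f x) / h) \<longlongrightarrow> D) (at_right 0)"
    using d unfolding DERIV_def filterlim_at_split by blast
  have ev: "eventually (\<lambda>h. (f (x + h) - f x) / h \<le> 0 \<and> - L \<le> (f (x + h) - f x) / h) (at_right 0)"
    unfolding eventually_at_filter
  proof (intro always_eventually allI impI)
    fix h :: real assume "h \<noteq> 0" "h \<in> {0<..}"
    then have h: "0 < h" by simp
    have "\<bar>f (x + h) - f x\<bar> \<le> L * h" using lipschitz_onD[OF lip, of "x + h" x] h by (simp add: dist_real_def)
    moreover have "f (x + h) \<le> f x" using h by (intro anti) simp
    ultimately show "(f (x + h) - f x) / h \<le> 0 \<and> - L \<le> (f (x + h) - f x) / h"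
      using h by (simp add: field_simps)
  qed
  have "D \<le> 0" by (rule tendsto_upperbound[OF lim]) (use ev in \<open>auto elim: eventually_mono\<close>)
  moreover have "- L \<le> D" by (rule tendsto_lowerbound[OF lim]) (use ev in \<open>auto elim: eventually_mono\<close>)
  ultimately show "0 \<le> - D" "- D \<le> L" by auto
qed

section \<open>Norms of bounded and Lipschitz functions\<close>

lemma Lp_int_bounded:
  assumes p: "0 < p" and M: "\<And>x. x \<in> {u..v} \<Longrightarrow> \<bar>f x\<bar> \<le> M" and M0: "0 \<le> M" and uv: "u \<le> v"
  shows "Lp_int p {u..v} f \<le> ennreal (M powr p * (v - u))"
proof -
  have "Lp_int p {u..v} f \<le> (\<integral>\<^sup>+ x. ennreal (M powr p) * indicator {u..v} x \<partial>lborel)"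
    unfolding Lp_int_def
  proof (rule nn_integral_mono)
    fix x
    show "ennreal (\<bar>f x\<bar> powr p) * indicator {u..v} x \<le> ennreal (M powr p) * indicator {u..v} x"
      using M[of x] p by (cases "x \<in> {u..v}") (auto intro!: ennreal_leI powr_mono2)
  qed
  also have "\<dots> = ennreal (M powr p) * ennreal (v - u)" using uv by (simp add: nn_integral_cmult)
  also have "\<dots> = ennreal (M powr p * (v - u))" using uv by (simp add: ennreal_mult)
  finally show ?thesis .
qed

lemma Lp_norm_bounded:
  assumes p: "0 < p" and M: "\<And>x. x \<in> {u..u+1} \<Longrightarrow> \<bar>f x\<bar> \<le> M" and M0: "0 \<le> M"
  shows "Lp_norm p {u..u+1} f \<le> M"
proof -
  have "Lp_int p {u..u+1} f \<le> ennreal (M powr p)" using Lp_int_bounded[where p=p and u=u and v="u + 1" and f=f and M=M] p M M0 by simp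
  then have "enn2real (Lp_int p {u..u+1} f) \<le> M powr p" by (intro enn2real_leI) auto
  then have "enn2real (Lp_int p {u..u+1} f) powr (1 / p) \<le> (M powr p) powr (1 / p)"
    using p by (intro powr_mono2) auto
  also have "\<dots> = M" using p M0 by (cases "M = 0") (auto simp: powr_powr)
  finally show ?thesis by (simp add: Lp_norm_def)
qed

lemma Lp_loc_bounded:
  assumes p: "0 < p" and f: "f \<in> borel_measurable borel" and M: "\<And>x. 0 \<le> x \<Longrightarrow> \<bar>f x\<bar> \<le> M"
  shows "Lp_loc p f"
  unfolding Lp_loc_def
proof (intro conjI allI)
  show "set_borel_measurable lborel {0..} f" using f unfolding set_borel_measurable_def by measurable
  fix N :: real
  have M0: "0 \<le> M" using M[of 0] by simp
  show "Lp_int p {0..N} f < \<infinity>"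
  proof (cases "0 \<le> N")
    case True
    then have "Lp_int p {0..N} f \<le> ennreal (M powr p * (N - 0))" using M by (intro Lp_int_bounded[OF p _ M0]) auto
    then show ?thesis by (simp add: le_less_trans)
  qed (simp add: Lp_int_def)
qed

text \<open>For points at distance at most 1 the Lipschitz bound controls the Hoelder quotient, for
  distant points boundedness does. The resulting constant is free of
  \<open>\<alpha>\<close>.\<close>

lemma C1alpha_norm_bounded:
  assumes \<alpha>: "0 < \<alpha>" "\<alpha> < 1" and f: "\<And>x. 0 \<le> x \<Longrightarrow> \<bar>f x\<bar> \<le> M0" and p: "\<And>x. 0 \<le> x \<Longrightarrow> \<bar>p x\<bar> \<le> M1"
    and lip: "\<And>x y. \<bar>p x - p y\<bar> \<le> M2 * \<bar>x - y\<bar>" and M: "0 \<le> M2"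
  shows "C1alpha_norm \<alpha> f p \<le> ereal (M0 + M1 + (2 * M1 + M2))"
proof -
  have M1: "0 \<le> M1" using p[of 0] by simp
  have 1: "(SUP x\<in>{0::real..}. ereal \<bar>f x\<bar>) \<le> ereal M0" by (rule SUP_least) (use f in auto)
  have 2: "(SUP x\<in>{0::real..}. ereal \<bar>p x\<bar>) \<le> ereal M1" by (rule SUP_least) (use p in auto)
  have 3: "(SUP z\<in>{(x,y). 0 \<le> x \<and> 0 \<le> y \<and> x \<noteq> y}. ereal (\<bar>p (fst z) - p (snd z)\<bar> / \<bar>fst z - snd z\<bar> powr \<alpha>))
      \<le> ereal (2 * M1 + M2)"
  proof (rule SUP_least)
    fix z :: "real \<times> real" assume z: "z \<in> {(x,y). 0 \<le> x \<and> 0 \<le> y \<and> x \<noteq> y}"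
    define x y where "x = fst z" and "y = snd z"
    have xy: "0 \<le> x" "0 \<le> y" "x \<noteq> y" using z by (auto simp: x_def y_def)
    define d where "d = \<bar>x - y\<bar>"
    have d: "0 < d" using xy by (simp add: d_def)
    have "\<bar>p x - p y\<bar> \<le> (2 * M1 + M2) * d powr \<alpha>"
    proof (cases "d \<le> 1")
      case True
      have "d powr 1 \<le> d powr \<alpha>" using d True \<alpha> by (intro powr_mono') auto
      then have "M2 * d \<le> M2 * d powr \<alpha>" using d M by (intro mult_left_mono) auto
      also have "\<dots> \<le> (2 * M1 + M2) * d powr \<alpha>" using M1 by (intro mult_right_mono) auto
      finally show ?thesis using lip[of x y] by (simp add: d_def)
    next
      case False
      have "\<bar>p x - p y\<bar> \<le> 2 * M1" using p[OF xy(1)] p[OF xy(2)] by linarith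
      also have "\<dots> \<le> (2 * M1 + M2) * 1" using M by simp
      also have "\<dots> \<le> (2 * M1 + M2) * d powr \<alpha>" using False \<alpha> M M1 by (intro mult_left_mono ge_one_powr_ge_zero) auto
      finally show ?thesis .
    qed
    then have "\<bar>p x - p y\<bar> / d powr \<alpha> \<le> 2 * M1 + M2" using d by (simp add: divide_le_eq)
    then show "ereal (\<bar>p (fst z) - p (snd z)\<bar> / \<bar>fst z - snd z\<bar> powr \<alpha>) \<le> ereal (2 * M1 + M2)"
      by (simp add: x_def y_def d_def)
  qed
  have "C1alpha_norm \<alpha> f p \<le> ereal M0 + ereal M1 + ereal (2 * M1 + M2)"
    unfolding C1alpha_norm_def by (intro add_mono 1 2 3)
  then show ?thesis by simp
qed

context ratcheting begin

section \<open>Joint regularity of the value function\<close>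

lemma plim_bounds:
  assumes c: "c \<in> {0..cb}"
  shows "0 \<le> plim c x" "plim c x \<le> K1"
proof -
  have "plim c x = plim c (max 0 x)" by (simp add: plim_def max_def)
  then show "0 \<le> plim c x" "plim c x \<le> K1" using vf_slope_bounds(1,2)[of c "max 0 x"] c by auto
qed

lemma lipschitz_vf:
  assumes c: "c \<in> {0..cb}"
  shows "K1-lipschitz_on UNIV (vf c)"
proof (rule lipschitz_onI)
  have d: "(vf c has_real_derivative plim c x) (at x)" for x using primitiveD(2)[OF primitive_vf] c by auto
  have *: "\<bar>vf c y - vf c x\<bar> \<le> K1 * \<bar>y - x\<bar>" if xy: "x < y" for x y
  proof -
    obtain t where "vf c y - vf c x = (y - x) * plim c t" using MVT2[OF xy d] by blast
    moreover have "\<bar>(y - x) * plim c t\<bar> \<le> \<bar>y - x\<bar> * K1" unfolding abs_mult using plim_bounds[OF c, of t] by (intro mult_left_mono) auto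
    ultimately show ?thesis by (simp add: mult.commute)
  qed
  show "dist (vf c x) (vf c y) \<le> K1 * dist x y" for x y
    using *[of x y] *[of y x] by (cases x y rule: linorder_cases) (auto simp: dist_real_def abs_minus_commute)
qed (use K1_ge in simp)

lemma plim_level_diff:
  assumes c: "c1 \<in> {0..cb}" "c2 \<in> {0..cb}" and x: "0 \<le> x" and h: "0 < h"
  shows "\<bar>plim c1 x - plim c2 x\<bar> \<le> 2 * (K1 / r * \<bar>c1 - c2\<bar>) / h + 2 * K2 * h"
proof -
  have v: "\<bar>vf c1 y - vf c2 y\<bar> \<le> K1 / r * \<bar>c1 - c2\<bar>" if "0 \<le> y" for y
    using vf_levels[of c1 c2 y] vf_levels[of c2 c1 y] c that by (cases "c1 \<le> c2") auto
  have "\<bar>vf c (x + h) - vf c x - plim c x * ((x + h) - x)\<bar> \<le> K2 * ((x + h) - x)\<^sup>2" if "c \<in> {0..cb}" for c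
    using that x h by (intro vf_taylor) auto
  from slope_difference[OF this[OF c(1)] this[OF c(2)] h refl v v] x h show ?thesis by auto
qed

lemma continuous_on_vf: "continuous_on (Qset cb) (\<lambda>z. vf (snd z) (fst z))"
proof (rule continuous_on_eq_continuous_within[THEN iffD2], rule ballI)
  fix z assume z: "z \<in> Qset cb"
  have "((\<lambda>y. vf (snd y) (fst y) - vf (snd z) (fst z)) \<longlongrightarrow> 0) (at z within Qset cb)"
  proof (rule Lim_null_comparison)
    show "\<forall>\<^sub>F y in at z within Qset cb. norm (vf (snd y) (fst y) - vf (snd z) (fst z)) \<le> K1 * \<bar>fst y - fst z\<bar> + K1 / r * \<bar>snd y - snd z\<bar>"
      unfolding eventually_at_filter
    proof (intro always_eventually allI impI)
      fix y assume y: "y \<in> Qset cb"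
      have c: "snd y \<in> {0..cb}" "snd z \<in> {0..cb}" "0 \<le> fst y" "0 \<le> fst z" using y z by (auto simp: Qset_def)
      have "\<bar>vf (snd y) (fst y) - vf (snd y) (fst z)\<bar> \<le> K1 * \<bar>fst y - fst z\<bar>"
        using lipschitz_onD[OF lipschitz_vf[OF c(1)], of "fst y" "fst z"] by (simp add: dist_real_def)
      moreover have "\<bar>vf (snd y) (fst z) - vf (snd z) (fst z)\<bar> \<le> K1 / r * \<bar>snd y - snd z\<bar>"
        using vf_levels[of "snd y" "snd z" "fst z"] vf_levels[of "snd z" "snd y" "fst z"] c by (cases "snd y \<le> snd z") auto
      ultimately show "norm (vf (snd y) (fst y) - vf (snd z) (fst z)) \<le> K1 * \<bar>fst y - fst z\<bar> + K1 / r * \<bar>snd y - snd z\<bar>" by simp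
    qed
    have "((\<lambda>y. K1 * \<bar>fst y - fst z\<bar> + K1 / r * \<bar>snd y - snd z\<bar>) \<longlongrightarrow> K1 * \<bar>fst z - fst z\<bar> + K1 / r * \<bar>snd z - snd z\<bar>) (at z within Qset cb)"
      by (intro tendsto_intros)
    then show "((\<lambda>y. K1 * \<bar>fst y - fst z\<bar> + K1 / r * \<bar>snd y - snd z\<bar>) \<longlongrightarrow> 0) (at z within Qset cb)" by simp
  qed
  then show "continuous (at z within Qset cb) (\<lambda>z. vf (snd z) (fst z))" unfolding continuous_within by (rule LIM_zero_cancel)
qed

lemma continuous_on_plim: "continuous_on (Qset cb) (\<lambda>z. plim (snd z) (fst z))"
proof (rule continuous_on_eq_continuous_within[THEN iffD2], rule ballI)
  fix z assume z: "z \<in> Qset cb"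
  have "((\<lambda>y. plim (snd y) (fst y) - plim (snd z) (fst z)) \<longlongrightarrow> 0) (at z within Qset cb)"
  proof (rule Lim_null_comparison)
    show "\<forall>\<^sub>F y in at z within Qset cb. norm (plim (snd y) (fst y) - plim (snd z) (fst z))
        \<le> K2 * \<bar>fst y - fst z\<bar> + (2 * K1 / r + 2 * K2) * sqrt \<bar>snd y - snd z\<bar>"
      unfolding eventually_at_filter
    proof (intro always_eventually allI impI)
      fix y assume y: "y \<in> Qset cb"
      have c: "snd y \<in> {0..cb}" "snd z \<in> {0..cb}" "0 \<le> fst y" "0 \<le> fst z" using y z by (auto simp: Qset_def)
      have 1: "\<bar>plim (snd y) (fst y) - plim (snd y) (fst z)\<bar> \<le> K2 * \<bar>fst y - fst z\<bar>"
        using lipschitz_onD[OF lipschitz_plim, of "snd y" "fst y" "fst z"] c by (simp add: dist_real_def)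
      have 2: "\<bar>plim (snd y) (fst z) - plim (snd z) (fst z)\<bar> \<le> (2 * K1 / r + 2 * K2) * sqrt \<bar>snd y - snd z\<bar>"
      proof (cases "snd y = snd z")
        case False
        \<comment> \<open>With increment \<open>h\<close> equal to the square root of the rate
          difference both error terms are of order \<open>h\<close>: the slope is Hoelder continuous
          of order \<open>1 / 2\<close> in the rate.\<close>
        define h where "h = sqrt \<bar>snd y - snd z\<bar>"
        have h: "0 < h" "h * h = \<bar>snd y - snd z\<bar>" using False by (auto simp: h_def)
        have "\<bar>plim (snd y) (fst z) - plim (snd z) (fst z)\<bar> \<le> 2 * (K1 / r * (h * h)) / h + 2 * K2 * h"
          using plim_level_diff[OF c(1,2,4) h(1)] unfolding h(2) .
        also have "\<dots> = (2 * K1 / r + 2 * K2) * h" using h(1) by (simp add: distrib_right)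
        finally show ?thesis by (simp add: h_def)
      qed simp
      show "norm (plim (snd y) (fst y) - plim (snd z) (fst z))
        \<le> K2 * \<bar>fst y - fst z\<bar> + (2 * K1 / r + 2 * K2) * sqrt \<bar>snd y - snd z\<bar>" using 1 2 by simp
    qed
    have "((\<lambda>y. K2 * \<bar>fst y - fst z\<bar> + (2 * K1 / r + 2 * K2) * sqrt \<bar>snd y - snd z\<bar>) \<longlongrightarrow>
        K2 * \<bar>fst z - fst z\<bar> + (2 * K1 / r + 2 * K2) * sqrt \<bar>snd z - snd z\<bar>) (at z within Qset cb)"
      by (intro tendsto_intros)
    then show "((\<lambda>y. K2 * \<bar>fst y - fst z\<bar> + (2 * K1 / r + 2 * K2) * sqrt \<bar>snd y - snd z\<bar>) \<longlongrightarrow> 0) (at z within Qset cb)" by simp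
  qed
  then show "continuous (at z within Qset cb) (\<lambda>z. plim (snd z) (fst z))" unfolding continuous_within by (rule LIM_zero_cancel)
qed

text \<open>Both arguments are clamped to \<open>Qset cb\<close>, so that the almost-everywhere
  theorem on the whole plane applies. On \<open>Qset cb\<close> nothing changes, which leaves the
  derivative within \<open>{0..cb}\<close>.\<close>

lemma vf_differentiable_in_level:
  "AE z in lborel. z \<in> Qset cb \<longrightarrow>
     (\<exists>D. ((\<lambda>s. vf s (fst z)) has_real_derivative D) (at (snd z) within {0..cb}) \<and> 0 \<le> - D \<and> - D \<le> K1 / r)"
proof -
  define cl where "cl s = max 0 (min cb s)" for s
  have cl: "cl s \<in> {0..cb}" for s using cb by (auto simp: cl_def)
  define u where "u x s = vf (cl s) (max 0 x)" for x s
  have lip: "(K1 / r)-lipschitz_on UNIV (u x)" for x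
  proof (rule lipschitz_onI)
    show "dist (u x s) (u x t) \<le> K1 / r * dist s t" for s t
    proof -
      have "\<bar>u x s - u x t\<bar> \<le> K1 / r * \<bar>cl s - cl t\<bar>"
        unfolding u_def using vf_levels[of "cl s" "cl t" "max 0 x"] vf_levels[of "cl t" "cl s" "max 0 x"] cl
        by (cases "cl s \<le> cl t") auto
      also have "\<dots> \<le> K1 / r * \<bar>s - t\<bar>" using K1_ge r by (intro mult_left_mono) (auto simp: cl_def)
      finally show ?thesis by (simp add: dist_real_def)
    qed
  qed (use K1_ge r in simp)
  have anti: "u x t \<le> u x s" if "s \<le> t" for x s t
    unfolding u_def using that cl by (intro vf_levels(1)) (auto simp: cl_def)
  have cont: "continuous_on UNIV (\<lambda>x. u x s)" for s
    unfolding u_def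
    by (rule continuous_on_compose2[OF lipschitz_on_continuous_on[OF lipschitz_vf[OF cl]]]) (auto intro!: continuous_intros)
  show ?thesis
    using partial_lipschitz_differentiable_AE[of "K1 / r" u, OF lip cont]
  proof eventually_elim
    case (elim z)
    show ?case
    proof
      assume z: "z \<in> Qset cb"
      obtain D where D: "(u (fst z) has_real_derivative D) (at (snd z))" using elim by blast
      have "(u (fst z) has_real_derivative D) (at (snd z) within {0..cb})" using D by (rule has_field_derivative_at_within)
      moreover have "vf s (fst z) = u (fst z) s" if "s \<in> {0..cb}" for s using that z by (auto simp: u_def cl_def Qset_def)
      ultimately have "((\<lambda>s. vf s (fst z)) has_real_derivative D) (at (snd z) within {0..cb})"
        using z by (intro has_field_derivative_transform_within[of "u (fst z)" D "snd z" "{0..cb}" 1 "\<lambda>s. vf s (fst z)"]) (auto simp: Qset_def)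
      then show "\<exists>D. ((\<lambda>s. vf s (fst z)) has_real_derivative D) (at (snd z) within {0..cb}) \<and> 0 \<le> - D \<and> - D \<le> K1 / r"
        using antimono_lipschitz_DERIV_bounds[OF D anti lip] by blast
    qed
  qed
qed

section \<open>The limit solves the problem\<close>

lemma second_derivative_exists:
  obtains q where "\<And>c. c \<in> {0..cb} \<Longrightarrow> q c \<in> borel_measurable borel" "\<And>c x. c \<in> {0..cb} \<Longrightarrow> \<bar>q c x\<bar> \<le> K2"
    "\<And>c. c \<in> {0..cb} \<Longrightarrow> AE x in lborel. (plim c has_real_derivative q c x) (at x)"
proof -
  have "\<forall>c. \<exists>q. c \<in> {0..cb} \<longrightarrow> q \<in> borel_measurable borel \<and> (\<forall>x. \<bar>q x\<bar> \<le> K2) \<and> (AE x in lborel. (plim c has_real_derivative q x) (at x))"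
  proof
    fix c
    show "\<exists>q. c \<in> {0..cb} \<longrightarrow> q \<in> borel_measurable borel \<and> (\<forall>x. \<bar>q x\<bar> \<le> K2) \<and> (AE x in lborel. (plim c has_real_derivative q x) (at x))"
    proof (cases "c \<in> {0..cb}")
      case True
      then have "K2-lipschitz_on UNIV (plim c)" by (intro lipschitz_plim) auto
      then show ?thesis by (rule lipschitz_AE_derivative) blast
    qed blast
  qed
  from choice[OF this] obtain q where "\<forall>c. c \<in> {0..cb} \<longrightarrow> q c \<in> borel_measurable borel \<and> (\<forall>x. \<bar>q c x\<bar> \<le> K2) \<and>
    (AE x in lborel. (plim c has_real_derivative q c x) (at x))" by blast
  then show ?thesis by (intro that[of q]) auto
qed

text \<open>The integrated inequality says that \<open>plim c\<close> minus the integral of the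
  right side is non-increasing; a larger second derivative at \<open>y\<close> would make it
  increase just to the right of \<open>y\<close>.\<close>

lemma second_derivative_le:
  assumes c: "c \<in> {0..cb}" and y: "0 < y" and d: "(plim c has_real_derivative s) (at y)"
  shows "s \<le> F c (vf c y) (plim c y)"
proof (rule ccontr)
  assume "\<not> s \<le> F c (vf c y) (plim c y)"
  have pv: "primitive (vf c) (plim c)" using c by (intro primitive_vf) auto
  have ss: "supersol c (vf c) (plim c)" using c by (intro supersol_vf) auto
  define I where "I t = integral {0..t} (\<lambda>t. F c (vf c t) (plim c t))" for t
  have "(I has_real_derivative F c (vf c y) (plim c y)) (at y within {0..y+1})"
    unfolding I_def using y by (intro integral_has_real_derivative continuous_intros primitiveD[OF pv]) auto
  then have "(I has_real_derivative F c (vf c y) (plim c y)) (at y)" using y by (simp add: at_within_Icc_at)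
  then have "((\<lambda>t. plim c t - I t) has_real_derivative s - F c (vf c y) (plim c y)) (at y)" by (rule DERIV_diff[OF d])
  moreover have "0 < s - F c (vf c y) (plim c y)" using \<open>\<not> s \<le> F c (vf c y) (plim c y)\<close> by simp
  ultimately obtain e where e: "0 < e" "\<And>h. 0 < h \<Longrightarrow> h < e \<Longrightarrow> plim c y - I y < plim c (y + h) - I (y + h)"
    using DERIV_pos_inc_right[of "\<lambda>t. plim c t - I t"] by blast
  have "I y + integral {y..y + e/2} (\<lambda>t. F c (vf c t) (plim c t)) = I (y + e/2)"
    unfolding I_def using y e by (intro Henstock_Kurzweil_Integration.integral_combine primitive_integrable[OF pv]) auto
  then show False using e(2)[of "e/2"] e(1) supersolD[OF ss, of y "y + e/2"] y by auto
qed

lemma vf_weak_derivs: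
  assumes c: "c \<in> {0..cb}" and q: "q \<in> borel_measurable borel" "\<And>x. \<bar>q x\<bar> \<le> K2" "AE x in lborel. (plim c has_real_derivative q x) (at x)"
  shows "weak_deriv (vf c) (plim c)" "weak_deriv (plim c) q"
proof -
  have c': "0 \<le> c" "c \<le> cb" using c by auto
  have "continuous_on UNIV (plim c)" by (rule primitiveD[OF primitive_vf[OF c']])
  then have "plim c \<in> borel_measurable borel" by (rule borel_measurable_continuous_onI)
  moreover have "\<bar>plim c x\<bar> \<le> K1" for x using plim_bounds[OF c, of x] by simp
  moreover have "AE x in lborel. (vf c has_real_derivative plim c x) (at x)"
    by (intro AE_I2 primitiveD(2)[OF primitive_vf[OF c']])
  ultimately show "weak_deriv (vf c) (plim c)" by (rule weak_deriv_lipschitz[OF lipschitz_vf[OF c]])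
  show "weak_deriv (plim c) q" by (rule weak_deriv_lipschitz[OF lipschitz_plim[OF c'] q])
qed

lemma vf_abs_le: "c \<in> {0..cb} \<Longrightarrow> 0 \<le> x \<Longrightarrow> \<bar>vf c x\<bar> \<le> cb / r"
  using vf_slope_bounds(3,4)[of c x] by auto

lemma vf_solution: "hjb_solution \<mu> \<sigma> r cb b (\<lambda>x c. vf c x)"
proof -
  obtain q where q: "\<And>c. c \<in> {0..cb} \<Longrightarrow> q c \<in> borel_measurable borel" "\<And>c x. c \<in> {0..cb} \<Longrightarrow> \<bar>q c x\<bar> \<le> K2"
    "\<And>c. c \<in> {0..cb} \<Longrightarrow> AE x in lborel. (plim c has_real_derivative q c x) (at x)"
    using second_derivative_exists by blast
  have wd: "weak_deriv (vf c) (plim c)" "weak_deriv (plim c) (q c)" if c: "c \<in> {0..cb}" for c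
    using vf_weak_derivs[OF c q(1)[OF c] q(2)[OF c] q(3)[OF c]] by auto
  have m: "vf c \<in> borel_measurable borel" "plim c \<in> borel_measurable borel" if c: "c \<in> {0..cb}" for c
    using primitiveD(3,4)[OF primitive_vf, of c UNIV] c by (auto intro!: borel_measurable_continuous_onI)
  have "classA cb (\<lambda>x c. vf c x)"
    unfolding classA_def
  \<comment> \<open>Any exponent above 1 would do, the function and both derivatives being bounded
    on the half-line.\<close>
  proof (intro conjI allI impI ballI exI[of _ 2])
    show "continuous_on (Qset cb) (\<lambda>z. vf (snd z) (fst z))" by (rule continuous_on_vf)
    show "vf c2 x \<le> vf c1 x" if "0 \<le> x" "c1 \<in> {0..cb}" "c2 \<in> {0..cb}" "c1 \<le> c2" for x c1 c2
      using that by (intro vf_levels) auto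
    fix c assume c: "c \<in> {0..cb}"
    have "W2p_loc_with 2 (vf c) (plim c) (q c)"
      unfolding W2p_loc_with_def
    proof (intro conjI wd[OF c])
      show "Lp_loc 2 (vf c)" by (rule Lp_loc_bounded[OF _ m(1)[OF c] vf_abs_le[OF c]]) auto
      show "Lp_loc 2 (plim c)" by (rule Lp_loc_bounded[OF _ m(2)[OF c], of _ K1]) (use plim_bounds[OF c] in auto)
      show "Lp_loc 2 (q c)" by (rule Lp_loc_bounded[OF _ q(1)[OF c], of _ K2]) (use q(2)[OF c] in auto)
    qed
    then show "W2p_loc 2 (vf c)" unfolding W2p_loc_def by blast
    have "set_borel_measurable lborel {0..} (vf c)" using m(1)[OF c] unfolding set_borel_measurable_def by measurable
    then show "L_infty (vf c)" unfolding L_infty_def using vf_abs_le[OF c] by (auto intro!: exI[of _ "cb / r"])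
  qed auto
  moreover have "\<forall>c\<in>{0..cb}. vf c 0 = 0" using primitiveD(1)[OF primitive_vf] by auto
  moreover have "\<forall>x\<ge>0. vf cb x = gfun \<mu> \<sigma> r cb b x" using vf_cb g_eq_gfun by simp
  moreover have "\<forall>c\<in>{0..cb}. \<exists>f1 f2. weak_deriv (\<lambda>x. vf c x) f1 \<and> weak_deriv f1 f2 \<and>
      (AE y in lborel. y \<in> {0..} \<longrightarrow> hjb_op \<mu> \<sigma> r b c (vf c y) (f1 y) (f2 y) \<ge> 0)"
  proof
    fix c assume c: "c \<in> {0..cb}"
    have "AE y in lborel. y \<in> {0..} \<longrightarrow> hjb_op \<mu> \<sigma> r b c (vf c y) (plim c y) (q c y) \<ge> 0"
      using q(3)[OF c] AE_lborel_singleton[of 0]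
      by eventually_elim (auto simp: hjb_op_nonneg_iff intro!: second_derivative_le[OF c])
    with wd[OF c] show "\<exists>f1 f2. weak_deriv (\<lambda>x. vf c x) f1 \<and> weak_deriv f1 f2 \<and>
      (AE y in lborel. y \<in> {0..} \<longrightarrow> hjb_op \<mu> \<sigma> r b c (vf c y) (f1 y) (f2 y) \<ge> 0)" by blast
  qed
  moreover have "\<forall>x c. (x, c) \<in> Q0set cb \<and> (\<forall>s\<in>{c<..cb}. vf c x > vf s x) \<longrightarrow>
        (\<exists>f1 f2. weak_deriv (\<lambda>x. vf c x) f1 \<and> weak_deriv f1 f2 \<and>
         (AE y in lborel. y \<in> {0..x} \<longrightarrow> hjb_op \<mu> \<sigma> r b c (vf c y) (f1 y) (f2 y) = 0))"
  proof (intro allI impI)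
    fix x c assume H: "(x, c) \<in> Q0set cb \<and> (\<forall>s\<in>{c<..cb}. vf c x > vf s x)"
    then have c: "c \<in> {0..cb}" "0 \<le> c" "c \<le> cb" "c < cb" and x: "0 \<le> x" by (auto simp: Q0set_def)
    have s: "solves c (vf c) (plim c) x" using H c x by (intro vf_solves_if_strict) auto
    have "AE y in lborel. y \<in> {0..x} \<longrightarrow> hjb_op \<mu> \<sigma> r b c (vf c y) (plim c y) (q c y) = 0"
      \<comment> \<open>The integrated equation is differentiated at interior points, so the two
        endpoints are discarded as null sets.\<close>
      using q(3)[OF c(1)] AE_lborel_singleton[of 0] AE_lborel_singleton[of x]
    proof eventually_elim
      case (elim y)
      then show ?case unfolding hjb_op_zero_iff
        using solves_DERIV[OF primitive_vf[OF c(2,3)] s, of y] DERIV_unique by fastforce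
    qed
    with wd[OF c(1)] show "\<exists>f1 f2. weak_deriv (\<lambda>x. vf c x) f1 \<and> weak_deriv f1 f2 \<and>
         (AE y in lborel. y \<in> {0..x} \<longrightarrow> hjb_op \<mu> \<sigma> r b c (vf c y) (f1 y) (f2 y) = 0)" by blast
  qed
  ultimately show ?thesis unfolding hjb_solution_def by simp
qed

lemma vf_norm_bounds:
  assumes c: "c \<in> {0..cb}" and q: "\<And>x. \<bar>q x\<bar> \<le> K2" and p: "1 < p" and N: "1 \<le> N"
  shows "Lp_int p {real N - 1..real N} (vf c) < \<infinity>" "Lp_int p {real N - 1..real N} (plim c) < \<infinity>"
    "Lp_int p {real N - 1..real N} q < \<infinity>"
    "ereal (W2p_norm p {real N - 1..real N} (vf c) (plim c) q) + C1alpha_norm (1 - 1 / p) (vf c) (plim c)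
      \<le> ereal ((cb / r + K1 + K2) + (cb / r + K1 + (2 * K1 + K2)))"
proof -
  have p0: "0 < p" using p by simp
  have u: "real N = (real N - 1) + 1" "0 \<le> real N - 1" using N by auto
  have v: "\<bar>vf c x\<bar> \<le> cb / r" if "x \<in> {real N - 1..real N}" for x using that u by (intro vf_abs_le[OF c]) auto
  have v': "\<bar>plim c x\<bar> \<le> K1" for x using plim_bounds[OF c, of x] by simp
  have pos: "0 \<le> cb / r" "0 \<le> K1" using cb r K1_ge by auto
  have fin: "Lp_int p {real N - 1..real N} f < \<infinity>" if "\<And>x. x \<in> {real N - 1..real N} \<Longrightarrow> \<bar>f x\<bar> \<le> M" "0 \<le> M" for f M
    using Lp_int_bounded[where p=p and u="real N - 1" and v="real N" and f=f and M=M] p0 that by (auto simp: le_less_trans)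
  show "Lp_int p {real N - 1..real N} (vf c) < \<infinity>" by (rule fin[OF v pos(1)])
  show "Lp_int p {real N - 1..real N} (plim c) < \<infinity>" by (rule fin[OF v' pos(2)])
  show "Lp_int p {real N - 1..real N} q < \<infinity>" by (rule fin[OF q K2_nonneg])
  have nb: "Lp_norm p {real N - 1..real N} f \<le> M" if "\<And>x. x \<in> {real N - 1..real N} \<Longrightarrow> \<bar>f x\<bar> \<le> M" "0 \<le> M" for f M
    using Lp_norm_bounded[OF p0, of "real N - 1" f M] that by simp
  have W: "W2p_norm p {real N - 1..real N} (vf c) (plim c) q \<le> cb / r + K1 + K2"
    unfolding W2p_norm_def by (intro add_mono nb v v' q pos K2_nonneg)
  have C: "C1alpha_norm (1 - 1 / p) (vf c) (plim c) \<le> ereal (cb / r + K1 + (2 * K1 + K2))"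
  proof (rule C1alpha_norm_bounded[OF _ _ vf_abs_le[OF c] v' _ K2_nonneg])
    show "\<bar>plim c x - plim c y\<bar> \<le> K2 * \<bar>x - y\<bar>" for x y
      using lipschitz_onD[OF lipschitz_plim, of c x y] c by (simp add: dist_real_def)
  qed (use p in auto)
  show "ereal (W2p_norm p {real N - 1..real N} (vf c) (plim c) q) + C1alpha_norm (1 - 1 / p) (vf c) (plim c)
      \<le> ereal ((cb / r + K1 + K2) + (cb / r + K1 + (2 * K1 + K2)))"
    using add_mono[OF ereal_less_eq(3)[THEN iffD2, OF W] C] by simp
qed

theorem hjb_well_posed:
  "\<exists>v. hjb_solution \<mu> \<sigma> r cb b v \<and>
     (\<forall>w. hjb_solution \<mu> \<sigma> r cb b w \<longrightarrow> (\<forall>z\<in>Qset cb. w (fst z) (snd z) = v (fst z) (snd z))) \<and>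
     (\<exists>vx vxx.
        (\<forall>c\<in>{0..cb}. weak_deriv (\<lambda>x. v x c) (\<lambda>x. vx x c) \<and> weak_deriv (\<lambda>x. vx x c) (\<lambda>x. vxx x c)) \<and>
        continuous_on (Qset cb) (\<lambda>z. vx (fst z) (snd z)) \<and>
        (\<exists>L. \<forall>x\<ge>0. \<forall>c1\<in>{0..cb}. \<forall>c2\<in>{0..cb}. \<bar>v x c1 - v x c2\<bar> \<le> L * \<bar>c1 - c2\<bar>) \<and>
        (\<forall>p>1. \<exists>K>0.
           (AE z in lborel. z \<in> Qset cb \<longrightarrow>
              (\<exists>D. ((\<lambda>s. v (fst z) s) has_real_derivative D) (at (snd z) within {0..cb}) \<and>
                   0 \<le> - D \<and> - D \<le> K)) \<and>
           (\<forall>z\<in>Qset cb. 0 \<le> v (fst z) (snd z) \<and> v (fst z) (snd z) \<le> cb / r) \<and>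
           (\<forall>z\<in>Qset cb. 0 \<le> vx (fst z) (snd z) \<and> vx (fst z) (snd z) \<le> K) \<and>
           (\<forall>x c y. (x, c) \<in> Qset cb \<and> y \<ge> x \<longrightarrow> vx y c \<le> max (vx x c) 1) \<and>
           (\<forall>c\<in>{0..cb}. \<forall>N::nat. N \<ge> 1 \<longrightarrow>
              Lp_int p {real N - 1..real N} (\<lambda>x. v x c) < \<infinity> \<and>
              Lp_int p {real N - 1..real N} (\<lambda>x. vx x c) < \<infinity> \<and>
              Lp_int p {real N - 1..real N} (\<lambda>x. vxx x c) < \<infinity> \<and>
              ereal (W2p_norm p {real N - 1..real N} (\<lambda>x. v x c) (\<lambda>x. vx x c) (\<lambda>x. vxx x c))
                + C1alpha_norm (1 - 1 / p) (\<lambda>x. v x c) (\<lambda>x. vx x c) \<le> ereal K)))"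
proof -
  obtain q where q: "\<And>c. c \<in> {0..cb} \<Longrightarrow> q c \<in> borel_measurable borel" "\<And>c x. c \<in> {0..cb} \<Longrightarrow> \<bar>q c x\<bar> \<le> K2"
    "\<And>c. c \<in> {0..cb} \<Longrightarrow> AE x in lborel. (plim c has_real_derivative q c x) (at x)"
    using second_derivative_exists by blast
  \<comment> \<open>One constant serves all exponents: the two bracketed sums bound the Sobolev norm
    on a unit interval and the Hoelder norm, and \<open>K1 / r\<close> bounds the derivative in the
    rate.\<close>
  define K where "K = (cb / r + K1 + K2) + (cb / r + K1 + (2 * K1 + K2)) + K1 / r"
  have pos: "0 < cb / r" "1 < K1" "0 \<le> K2" "0 < K1 / r" using cb r K1_ge K2_nonneg by auto
  have unique: "w (fst z) (snd z) = vf (snd z) (fst z)" if "hjb_solution \<mu> \<sigma> r cb b w" "z \<in> Qset cb" for w z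
    using that hjb_solution_le[OF that(1) vf_solution, of "fst z" "snd z"] hjb_solution_le[OF vf_solution that(1), of "fst z" "snd z"]
    by (auto simp: Qset_def)
  have wd: "weak_deriv (\<lambda>x. vf c x) (\<lambda>x. plim c x)" "weak_deriv (\<lambda>x. plim c x) (\<lambda>x. q c x)" if c: "c \<in> {0..cb}" for c
    using vf_weak_derivs[OF c q(1)[OF c] q(2)[OF c] q(3)[OF c]] by auto
  have lip: "\<exists>L. \<forall>x\<ge>0. \<forall>c1\<in>{0..cb}. \<forall>c2\<in>{0..cb}. \<bar>vf c1 x - vf c2 x\<bar> \<le> L * \<bar>c1 - c2\<bar>"
  proof (intro exI[of _ "K1 / r"] allI impI ballI)
    show "\<bar>vf c1 x - vf c2 x\<bar> \<le> K1 / r * \<bar>c1 - c2\<bar>" if "0 \<le> x" "c1 \<in> {0..cb}" "c2 \<in> {0..cb}" for x c1 c2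
      using vf_levels[of c1 c2 x] vf_levels[of c2 c1 x] that by (cases "c1 \<le> c2") auto
  qed
  have level: "AE z in lborel. z \<in> Qset cb \<longrightarrow>
    (\<exists>D. ((\<lambda>s. vf s (fst z)) has_real_derivative D) (at (snd z) within {0..cb}) \<and> 0 \<le> - D \<and> - D \<le> K)"
    using vf_differentiable_in_level
  proof eventually_elim
    case (elim z)
    have "K1 / r \<le> K" using pos by (simp add: K_def)
    with elim show ?case by (meson order_trans)
  qed
  have vb: "0 \<le> vf (snd z) (fst z)" "vf (snd z) (fst z) \<le> cb / r" if "z \<in> Qset cb" for z
    using that vf_slope_bounds(3,4)[of "snd z" "fst z"] by (auto simp: Qset_def)
  have "K1 \<le> K" using pos by (simp add: K_def)
  then have pb: "0 \<le> plim (snd z) (fst z)" "plim (snd z) (fst z) \<le> K" if "z \<in> Qset cb" for z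
    using that plim_bounds[of "snd z" "fst z"] by (auto simp: Qset_def)
  have sm: "plim c y \<le> max (plim c x) 1" if "(x, c) \<in> Qset cb" "x \<le> y" for x c y
    using that by (intro vf_slope_max) (auto simp: Qset_def)
  have nb: "Lp_int p {real N - 1..real N} (vf c) < \<infinity> \<and> Lp_int p {real N - 1..real N} (plim c) < \<infinity> \<and>
      Lp_int p {real N - 1..real N} (q c) < \<infinity> \<and>
      ereal (W2p_norm p {real N - 1..real N} (vf c) (plim c) (q c)) + C1alpha_norm (1 - 1 / p) (vf c) (plim c) \<le> ereal K"
    if p: "1 < p" and c: "c \<in> {0..cb}" and N: "1 \<le> N" for p c and N :: nat
  proof -
    have "ereal ((cb / r + K1 + K2) + (cb / r + K1 + (2 * K1 + K2))) \<le> ereal K" using pos by (simp add: K_def)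
    then show ?thesis using vf_norm_bounds[OF c q(2)[OF c] p N] by (meson order_trans)
  qed
  have K: "0 < K" using pos by (simp add: K_def)
  have all_p: "\<forall>p>1. \<exists>K>0.
           (AE z in lborel. z \<in> Qset cb \<longrightarrow>
              (\<exists>D. ((\<lambda>s. vf s (fst z)) has_real_derivative D) (at (snd z) within {0..cb}) \<and>
                   0 \<le> - D \<and> - D \<le> K)) \<and>
           (\<forall>z\<in>Qset cb. 0 \<le> vf (snd z) (fst z) \<and> vf (snd z) (fst z) \<le> cb / r) \<and>
           (\<forall>z\<in>Qset cb. 0 \<le> plim (snd z) (fst z) \<and> plim (snd z) (fst z) \<le> K) \<and>
           (\<forall>x c y. (x, c) \<in> Qset cb \<and> y \<ge> x \<longrightarrow> plim c y \<le> max (plim c x) 1) \<and>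
           (\<forall>c\<in>{0..cb}. \<forall>N::nat. N \<ge> 1 \<longrightarrow>
              Lp_int p {real N - 1..real N} (vf c) < \<infinity> \<and>
              Lp_int p {real N - 1..real N} (plim c) < \<infinity> \<and>
              Lp_int p {real N - 1..real N} (q c) < \<infinity> \<and>
              ereal (W2p_norm p {real N - 1..real N} (vf c) (plim c) (q c))
                + C1alpha_norm (1 - 1 / p) (vf c) (plim c) \<le> ereal K)"
  proof (intro allI impI exI[of _ K] conjI K level)
  qed (use vb pb sm nb in blast)+
  show ?thesis
    by (rule exI[of _ "\<lambda>x c. vf c x"], intro conjI,
        rule vf_solution, use unique in blast,
        rule exI[of _ "\<lambda>x c. plim c x"], rule exI[of _ "\<lambda>x c. q c x"], intro conjI,
        use wd in blast, rule continuous_on_plim, rule lip, rule all_p)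
qed

end

theorem theorem5p2:
  fixes \<mu> \<sigma> r cb b :: real
  assumes "\<sigma> > 0" and "r > 0" and "0 < cb" and "cb \<le> \<mu>" and "0 \<le> b" and "b \<le> 1"
    and "2 * \<mu> * cb > \<sigma>^2 * r"
  shows "\<exists>v. hjb_solution \<mu> \<sigma> r cb b v \<and>
     (\<forall>w. hjb_solution \<mu> \<sigma> r cb b w \<longrightarrow> (\<forall>z\<in>Qset cb. w (fst z) (snd z) = v (fst z) (snd z))) \<and>
     (\<exists>vx vxx.
        (\<forall>c\<in>{0..cb}. weak_deriv (\<lambda>x. v x c) (\<lambda>x. vx x c) \<and> weak_deriv (\<lambda>x. vx x c) (\<lambda>x. vxx x c)) \<and>
        continuous_on (Qset cb) (\<lambda>z. vx (fst z) (snd z)) \<and>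
        (\<exists>L. \<forall>x\<ge>0. \<forall>c1\<in>{0..cb}. \<forall>c2\<in>{0..cb}. \<bar>v x c1 - v x c2\<bar> \<le> L * \<bar>c1 - c2\<bar>) \<and>
        (\<forall>p>1. \<exists>K>0.
           (AE z in lborel. z \<in> Qset cb \<longrightarrow>
              (\<exists>D. ((\<lambda>s. v (fst z) s) has_real_derivative D) (at (snd z) within {0..cb}) \<and>
                   0 \<le> - D \<and> - D \<le> K)) \<and>
           (\<forall>z\<in>Qset cb. 0 \<le> v (fst z) (snd z) \<and> v (fst z) (snd z) \<le> cb / r) \<and>
           (\<forall>z\<in>Qset cb. 0 \<le> vx (fst z) (snd z) \<and> vx (fst z) (snd z) \<le> K) \<and>
           (\<forall>x c y. (x, c) \<in> Qset cb \<and> y \<ge> x \<longrightarrow> vx y c \<le> max (vx x c) 1) \<and>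
           (\<forall>c\<in>{0..cb}. \<forall>N::nat. N \<ge> 1 \<longrightarrow>
              Lp_int p {real N - 1..real N} (\<lambda>x. v x c) < \<infinity> \<and>
              Lp_int p {real N - 1..real N} (\<lambda>x. vx x c) < \<infinity> \<and>
              Lp_int p {real N - 1..real N} (\<lambda>x. vxx x c) < \<infinity> \<and>
              ereal (W2p_norm p {real N - 1..real N} (\<lambda>x. v x c) (\<lambda>x. vx x c) (\<lambda>x. vxx x c))
                + C1alpha_norm (1 - 1 / p) (\<lambda>x. v x c) (\<lambda>x. vx x c) \<le> ereal K)))"
proof -
  interpret ratcheting \<mu> \<sigma> r cb b by unfold_locales (use assms in auto)
  show ?thesis by (rule hjb_well_posed)
qed

end
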